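(* There is an absolute constant $C>0$ such that for every modulus $q \geq 1$, every integer $L$ with $1 \leq L \leq q$ and every integer $c$ with $(c,q)=1$, $$S := \sum_{a = 1}^{q} \sum_{b = 1}^{q} \Bigl( \mathop{\sum_{q_1 \in (a, a+L]} \mathop{{\sum\nolimits}'}_{q_2 \in (b, b+L]}}_{q_1 q_2 \equiv c \pmod q} 1 - \frac{1}{q} \sum_{q_1 \in (a, a+L]} \mathop{{\sum\nolimits}'}_{q_2 \in (b, b+L]} 1 \Bigr)^2 \leq C\, L^2 q\, d(q)^3 .$$
   Context: The sums are over integers $q_1, q_2$ in the indicated half-open intervals. The notation $\sum'$ means that the summation is restricted to integers $q_2$ relatively prime to $q$ (the variable $q_1$ is unrestricted apart from the congruence condition). $d(q)$ denotes the number of positive divisors of $q$. *)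

theory Defs
  imports "HOL-Analysis.Analysis" "HOL-Number_Theory.Number_Theory"
begin

definition divisor_count :: "int \<Rightarrow> nat" where
  "divisor_count q = card {d::int. d > 0 \<and> d dvd q}"

end

theory Submission
  imports Defs "HOL-Algebra.Algebraic_Closure_Type" "Berlekamp_Zassenhaus.Finite_Field"
begin

text \<open>
  Expanding both window counts in additive characters modulo \<open>q\<close>, Parseval turns the left-hand side into
  \<open>q\<^sup>-\<^sup>2 \<Sum>\<^sub>k\<^sub>\<noteq>\<^sub>0 \<Sum>\<^sub>l |I(k)|\<^sup>2 |I(l)|\<^sup>2 |K(-l, -kc; q)|\<^sup>2\<close>, where \<open>I(k) = \<Sum>\<^sub>j\<^sub>\<le>\<^sub>L e(kj/q)\<close> and \<open>K\<close> is the
  Kloosterman sum. It remains to insert \<open>|K(a, b; q)|\<^sup>2 \<le> 4 d(q)\<^sup>2 q gcd(a, b, q)\<close> and to bound, for each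
  divisor of \<open>q\<close>, the sum of \<open>|I|\<^sup>2\<close> over its multiples.

  The bound for \<open>K\<close> reduces to prime powers, where it is stationary phase unless the modulus is a prime \<open>p\<close>.
  At a prime it is Weil's bound, obtained by Stepanov's method: in characteristic \<open>p\<close> an auxiliary
  polynomial shows that \<open>Tr(ax + b/x)\<close> takes each value at most \<open>p\<^sup>2\<^sup>s\<^sup>-\<^sup>1 + 3p\<^sup>s\<close> times on the field with
  \<open>p\<^sup>2\<^sup>s\<close> elements, so the Kloosterman sums \<open>S\<^sub>2\<^sub>s\<close> over these fields are \<open>O(p\<^sup>s)\<close>. The associated
  \<open>L\<close>-function is the polynomial \<open>1 + S\<^sub>1 T + p T\<^sup>2 = (1 - \<alpha>T)(1 - \<beta>T)\<close>, hence \<open>S\<^sub>n = -(\<alpha>\<^sup>n + \<beta>\<^sup>n)\<close>, and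
  the growth bound for even \<open>n\<close> forces \<open>|\<alpha>| = |\<beta>| = \<surd>p\<close>.
\<close>

text \<open>Subtracting the expected count removes the frequency k = 0 exactly, and the bound
  depends on this. Let d be a divisor of q for which m = q/d is small against L. With k = 0 kept,
  the zero frequencies alone would contribute L^4 to the product of the two sums of |I|^2 over
  multiples of d; with it removed from one factor, 2 m^2 L^2 is enough. Two of the three factors
  d(q) come from the Kloosterman bound, which at a prime is Weil's 2 sqrt p = d(p) sqrt p; the third
  counts the divisors that can occur as the gcd. Everything in characteristic p happens inside one
  algebraically closed type. The finite fields are the fixed sets of the powers of Frobenius, so
  extensions of all degrees can be handled together.\<close>

hide_const (open) up_ring.coeff up_ring.monom Polynomials.degree Polynomials.lead_coeff Coset.order Divisibility.prime Module.smult

section \<open>Stepanov's method\<close>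

text \<open>Gaussian elimination on the top coefficient: a pivot \<open>j\<close> with nonzero
  coefficient at \<open>M\<close> clears it from all other members, at the price of one member and
  one degree. Dependence is stated for the indexed family, so repeated polynomials count
  separately.\<close>

lemma poly_family_linearly_dependent:
  fixes P :: "'i \<Rightarrow> 'a::field poly"
  assumes "finite I" and "card I > M" and "\<And>i n. i \<in> I \<Longrightarrow> n \<ge> M \<Longrightarrow> coeff (P i) n = 0"
  shows "\<exists>c. (\<exists>i\<in>I. c i \<noteq> 0) \<and> (\<Sum>i\<in>I. smult (c i) (P i)) = 0"
  using assms
proof (induction M arbitrary: I P)
  case 0
  then obtain i where "i \<in> I" by fastforce
  moreover have "P i = 0" if "i \<in> I" for i
    using 0(3)[OF that] by (simp add: poly_eq_iff)
  ultimately show ?case by (intro exI[of _ "\<lambda>_. 1"]) auto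
next
  case (Suc M)
  show ?case
  proof (cases "\<forall>i\<in>I. coeff (P i) M = 0")
    case True
    have "coeff (P i) n = 0" if "i \<in> I" "n \<ge> M" for i n
      using True Suc(4)[of i n] that by (cases "n = M") auto
    then show ?thesis using Suc.IH[of I P] Suc.prems by auto
  next
    case False
    then obtain j where j: "j \<in> I" "coeff (P j) M \<noteq> 0" by blast
    define r where "r i = coeff (P i) M / coeff (P j) M" for i
    define P' where "P' i = P i - smult (r i) (P j)" for i
    have "coeff (P' i) n = 0" if "i \<in> I - {j}" "n \<ge> M" for i n
      using j Suc(4)[of i n] Suc(4)[of j n] that by (cases "n = M") (auto simp: P'_def r_def)
    moreover have "card (I - {j}) > M" using Suc.prems j by (simp add: card_Diff_singleton)
    ultimately obtain c where c: "\<exists>i\<in>I-{j}. c i \<noteq> 0" "(\<Sum>i\<in>I-{j}. smult (c i) (P' i)) = 0"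
      using Suc.IH[of "I - {j}" P'] Suc.prems by auto
    \<comment> \<open>The coefficient of the pivot undoes the multiples of \<open>P j\<close> that
      were subtracted from the other members.\<close>
    define c' where "c' = c(j := - (\<Sum>i\<in>I-{j}. c i * r i))"
    have "(\<Sum>i\<in>I. smult (c' i) (P i)) = smult (c' j) (P j) + (\<Sum>i\<in>I-{j}. smult (c' i) (P i))"
      using j Suc.prems by (simp add: sum.remove)
    also have "(\<Sum>i\<in>I-{j}. smult (c' i) (P i)) = (\<Sum>i\<in>I-{j}. smult (c i) (P' i) + smult (c i * r i) (P j))"
      by (intro sum.cong) (auto simp: c'_def P'_def smult_diff_right)
    also have "smult (c' j) (P j) + \<dots> = 0"
      by (simp add: sum.distrib c c'_def smult_sum)
    finally have "(\<Sum>i\<in>I. smult (c' i) (P i)) = 0" .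
    moreover have "\<exists>i\<in>I. c' i \<noteq> 0" using c(1) by (auto simp: c'_def)
    ultimately show ?thesis by blast
  qed
qed

text \<open>The term of largest degree among those with nonzero coefficient has no partner to cancel
  against.\<close>

lemma sum_distinct_degrees_neq_0:
  fixes P :: "'i \<Rightarrow> 'a::field poly"
  assumes "finite I" and "inj_on (\<lambda>i. degree (P i)) I" and "\<And>i. i \<in> I \<Longrightarrow> P i \<noteq> 0"
    and "\<exists>i\<in>I. c i \<noteq> 0"
  shows "(\<Sum>i\<in>I. smult (c i) (P i)) \<noteq> 0"
proof -
  define I' where "I' = {i\<in>I. c i \<noteq> 0}"
  have fin: "finite I'" "I' \<noteq> {}" using assms by (auto simp: I'_def)
  then have "Max ((\<lambda>i. degree (P i)) ` I') \<in> (\<lambda>i. degree (P i)) ` I'" by (intro Max_in) auto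
  then obtain m where "m \<in> I'" "degree (P m) = Max ((\<lambda>i. degree (P i)) ` I')" by force
  then have m: "m \<in> I'" "\<And>i. i \<in> I' \<Longrightarrow> degree (P i) \<le> degree (P m)"
    using fin by auto
  have "coeff (\<Sum>i\<in>I. smult (c i) (P i)) (degree (P m)) = (\<Sum>i\<in>I. c i * coeff (P i) (degree (P m)))"
    by (simp add: coeff_sum)
  also have "\<dots> = (\<Sum>i\<in>{m}. c i * coeff (P i) (degree (P m)))"
  proof (rule sum.mono_neutral_right)
    show "\<forall>i\<in>I - {m}. c i * coeff (P i) (degree (P m)) = 0"
    proof
      fix i assume i: "i \<in> I - {m}"
      show "c i * coeff (P i) (degree (P m)) = 0"
      proof (cases "c i = 0")
        case False
        then have "degree (P i) \<le> degree (P m)" using m(2) i by (auto simp: I'_def)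
        moreover have "degree (P i) \<noteq> degree (P m)"
          using assms(2) i m(1) by (auto simp: I'_def inj_on_def)
        ultimately show ?thesis by (simp add: coeff_eq_0)
      qed auto
    qed
  qed (use assms m in \<open>auto simp: I'_def\<close>)
  also have "\<dots> \<noteq> 0" using m assms(3) by (auto simp: I'_def)
  finally show ?thesis by auto
qed

text \<open>In an algebraically closed field and for n at least 1, this is the subfield with p^n
  elements; \<open>gf 0\<close> is the whole type.\<close>

definition gf :: "nat \<Rightarrow> 'a::field_prime_char set" where
  "gf n = {x. x ^ (CHAR('a) ^ n) = x}"

lemma sum_lessThan_add:
  fixes f :: "nat \<Rightarrow> 'a::comm_monoid_add"
  shows "(\<Sum>i<m+n. f i) = (\<Sum>i<m. f i) + (\<Sum>i<n. f (m + i))"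
  by (induction n) (auto simp: add.assoc)

lemma gf_1_imp_gf: "x \<in> gf 1 \<Longrightarrow> x \<in> gf n"
  by (induction n) (auto simp: gf_def power_mult)

lemma frobenius_sum:
  fixes f :: "'i \<Rightarrow> 'a::field_prime_char"
  shows "(\<Sum>i\<in>A. f i) ^ (CHAR('a) ^ n) = (\<Sum>i\<in>A. f i ^ (CHAR('a) ^ n))"
  by (rule freshmans_dream_sum') auto

lemma frobenius_add:
  fixes x y :: "'a::field_prime_char"
  shows "(x + y) ^ (CHAR('a) ^ n) = x ^ (CHAR('a) ^ n) + y ^ (CHAR('a) ^ n)"
  by (rule freshmans_dream') auto

text \<open>
  With \<open>Q = p\<^sup>s\<close>, the half trace \<open>T(x) = \<Sum>\<^sub>i\<^sub><\<^sub>s (ax + b/x)\<^bsup>p^i\<^esup>\<close> satisfies \<open>T\<^sup>Q = t - T\<close> and \<open>x\<^bsup>Q\<cdot>Q\<^esup> = x\<close> on the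
  set to be counted. So for a combination \<open>F\<close> of products \<open>X\<^sup>k T\<^sup>i X\<^sup>j\<^sup>Q\<close>, the values of \<open>F\<^sup>Q\<close> there are those
  of a combination of \<open>X\<^sup>k\<^sup>Q (t - T)\<^sup>i X\<^sup>j\<close>, whose degree is small enough for linear algebra to make it vanish
  identically; yet \<open>F \<noteq> 0\<close> because the degrees of its terms are distinct. The polynomial \<open>U\<close> is \<open>T\<close>
  cleared of its pole at \<open>0\<close>.
\<close>

lemma stepanov_bound:
  fixes a b t :: "'a::{alg_closed_field, field_prime_char}"
  assumes s: "s \<ge> 1" and a: "a \<in> gf 1" "a \<noteq> 0" and b: "b \<in> gf 1"
  defines "p \<equiv> CHAR('a)"
  shows "card {x \<in> gf (2 * s). x \<noteq> 0 \<and> (\<Sum>i<2 * s. (a * x + b / x) ^ (p ^ i)) = t}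
           \<le> p ^ (2 * s - 1) + 3 * p ^ s"
proof -
  \<comment> \<open>\<open>R\<close> is the largest Frobenius exponent in the half trace, hence the
    order of the pole that \<open>U\<close> has to clear. \<open>J\<close> = R + 2 yields RQ + 2Q
    products against at most RQ + Q - R + 2 coefficients.\<close>
  define Q R J where "Q = p ^ s" and "R = p ^ (s - 1)" and "J = R + 2"
  have p: "p \<ge> 2" unfolding p_def by (simp add: prime_ge_2_nat)
  have R: "R \<ge> 1" unfolding R_def using p by simp
  have QR: "Q = p * R" unfolding Q_def R_def using s by (metis Suc_pred' less_eq_Suc_le One_nat_def power_Suc)
  have Q: "Q \<ge> 2" using QR p R by (metis mult.commute mult_le_mono nat_mult_1)
  define U where "U = (\<Sum>i<s. monom a (R + p ^ i) + monom b (R - p ^ i))"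
  have le: "p ^ i \<le> R" if "i < s" for i
    unfolding R_def using that p by (intro power_increasing) auto
  have degU_le: "degree U \<le> 2 * R"
    unfolding U_def
  proof (rule degree_sum_le)
    fix i assume "i \<in> {..<s}"
    then have "p ^ i \<le> R" using le by auto
    then show "degree (monom a (R + p ^ i) + monom b (R - p ^ i)) \<le> 2 * R"
      by (intro degree_add_le order_trans[OF degree_monom_le]) auto
  qed auto
  have "coeff U (2*R) = (\<Sum>i<s. if i = s - 1 then a else 0)"
    unfolding U_def coeff_sum
  proof (rule sum.cong[OF refl])
    fix i assume "i \<in> {..<s}"
    then have "p ^ i = R \<longleftrightarrow> i = s - 1"
      unfolding R_def using p by (subst power_inject_exp) auto
    then show "coeff (monom a (R + p ^ i) + monom b (R - p ^ i)) (2*R) = (if i = s - 1 then a else 0)"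
      using R by auto
  qed
  also have "\<dots> = a" using s by (simp add: sum.delta)
  finally have coU: "coeff U (2*R) = a" .
  then have degU: "degree U = 2 * R" using degU_le a le_degree[of U "2*R"] by auto
  have U0: "U \<noteq> 0" using coU a by auto
  define T where "T x = (\<Sum>i<s. (a * x + b / x) ^ (p ^ i))" for x
  have apow: "a ^ (p ^ i) = a" "b ^ (p ^ i) = b" for i
    using gf_1_imp_gf[OF a(1), of i] gf_1_imp_gf[OF b, of i] by (auto simp: gf_def p_def)
  have polyU: "poly U x = x ^ R * T x" if "x \<noteq> 0" for x
  proof -
    have "x ^ R * (a * x + b / x) ^ (p ^ i) = a * x ^ (R + p ^ i) + b * x ^ (R - p ^ i)" if "i < s" for i
    proof -
      have "(a * x + b / x) ^ (p ^ i) = a * x ^ (p ^ i) + b / x ^ (p ^ i)"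
        unfolding p_def frobenius_add power_mult_distrib power_divide
        using apow[of i] by (simp add: p_def)
      moreover have "x ^ R = x ^ (R - p ^ i) * x ^ (p ^ i)"
        using le[OF that] by (simp flip: power_add)
      ultimately show ?thesis using \<open>x \<noteq> 0\<close>
        by (simp add: distrib_left power_add mult_ac)
    qed
    then show ?thesis
      unfolding U_def T_def by (simp add: poly_sum poly_monom sum_distrib_left)
  qed
  define I where "I = {..<p} \<times> {..<J} \<times> {..<R}"
  \<comment> \<open>The factor X^((p-1-i)R) tops up the power of x^R that comes with the i-th power
    of \<open>U\<close>, so that every product carries the same x^((p-1)R) and this can be
    cancelled. \<open>P\<close> lists what is left of the Q-th powers of the \<open>G\<close> after
    T^Q = t - T and x^(QQ) = x.\<close>
  define P where "P = (\<lambda>(i,j,k). monom (1::'a) (k*Q) * (monom t R - U) ^ i * monom 1 ((p-1-i)*R) * monom 1 j)"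
  define G where "G = (\<lambda>(i,j,k). monom (1::'a) k * U ^ i * monom 1 ((p-1-i)*R) * monom 1 (j*Q))"
  have finI: "finite I" unfolding I_def by auto
  have cardI: "card I = R * Q + 2 * Q" unfolding I_def J_def QR by (simp add: algebra_simps)
  have degP: "degree (P u) < R * Q + Q - R + 2" if "u \<in> I" for u
  proof -
    obtain i j k where u: "u = (i,j,k)" by (cases u)
    have ijk: "i < p" "j < J" "k < R" using that by (auto simp: I_def u)
    have "degree (P u) \<le> k*Q + i * (2*R) + (p-1-i)*R + j"
    proof -
      have 1: "degree (monom t R - U) \<le> 2*R"
        by (intro degree_diff_le degU_le order_trans[OF degree_monom_le]) auto
      have "degree ((monom t R - U) ^ i) \<le> i * (2*R)"
        using degree_power_le[of "monom t R - U" i] 1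
        by (metis (no_types, lifting) le_trans mult.commute mult_le_mono1)
      then show ?thesis unfolding P_def u prod.case
        by (intro order_trans[OF degree_mult_le] add_mono) (auto simp: degree_monom_eq)
    qed
    also have "\<dots> \<le> (R-1)*Q + (p-1)*(2*R) + (J-1)"
    proof -
      have "i * (2*R) + (p-1-i)*R \<le> i * (2*R) + (p-1-i)*(2*R)" by auto
      also have "\<dots> = (p-1)*(2*R)" using ijk by (simp flip: add_mult_distrib)
      finally have "i * (2*R) + (p-1-i)*R \<le> (p-1)*(2*R)" .
      moreover have "k*Q \<le> (R-1)*Q" using ijk by auto
      ultimately show ?thesis using ijk by linarith
    qed
    also have "\<dots> < R * Q + Q - R + 2"
    proof -
      have "(R-1)*Q + Q = R * Q" using R by (metis Suc_pred' add.commute less_eq_Suc_le mult_Suc One_nat_def)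
      moreover have "(p-1)*(2*R) + 2*R = 2*Q" using p unfolding QR
        by (metis Suc_pred' add.commute less_eq_Suc_le mult_Suc mult.left_commute One_nat_def Suc_1 Suc_leD)
      moreover have "R \<le> Q" using QR p by simp
      ultimately show ?thesis unfolding J_def by linarith
    qed
    finally show ?thesis .
  qed
  have "\<exists>c. (\<exists>u\<in>I. c u \<noteq> 0) \<and> (\<Sum>u\<in>I. smult (c u) (P u)) = 0"
  proof (rule poly_family_linearly_dependent[OF finI])
    have "R \<le> Q" using QR p by simp
    then show "R * Q + Q - R + 2 < card I" unfolding cardI using Q R by linarith
    show "coeff (P u) n = 0" if "u \<in> I" "n \<ge> R * Q + Q - R + 2" for u n
      using degP[OF that(1)] that(2) by (intro coeff_eq_0) auto
  qed
  then obtain c where c: "\<exists>u\<in>I. c u \<noteq> 0" "(\<Sum>u\<in>I. smult (c u) (P u)) = 0" by blast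
  \<comment> \<open>The relation found is one between Q-th powers, so \<open>F\<close> takes Q-th
    roots of its coefficients; they exist because the field is algebraically closed.\<close>
  have "\<exists>y. y ^ Q = c u" for u using Q by (intro nth_root_exists) auto
  then obtain d where d: "\<And>u. d u ^ Q = c u" by metis
  define F where "F = (\<Sum>u\<in>I. smult (d u) (G u))"
  have Gnz: "G u \<noteq> 0" for u unfolding G_def using U0 by (auto simp: split_beta monom_eq_0_iff)
  \<comment> \<open>As k < R and i < p, this is a mixed-radix expansion, and (i, j, k) can be read
    off from the degree.\<close>
  have degG: "degree (G (i,j,k)) = (p-1)*R + (k + R * (i + p * j))" if "i < p" for i j k
  proof -
    have "degree (G (i,j,k)) = k + i * (2*R) + (p-1-i)*R + j*Q"
      unfolding G_def prod.case using U0
      by (simp add: degree_mult_eq degree_monom_eq degree_power_eq degU monom_eq_0_iff)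
    also have "i * (2*R) + (p-1-i)*R = i*R + (p-1)*R"
      using less_imp_Suc_add[OF that] by (auto simp: algebra_simps)
    ultimately show ?thesis unfolding QR by (simp add: algebra_simps)
  qed
  have "F \<noteq> 0" unfolding F_def
  proof (rule sum_distinct_degrees_neq_0[OF finI _ Gnz])
    show "\<exists>i\<in>I. d i \<noteq> 0" using c(1) d Q by (metis power_0_left not_numeral_le_zero)
    show "inj_on (\<lambda>i. degree (G i)) I"
    proof (rule inj_onI)
      fix v v' assume v: "v \<in> I" "v' \<in> I" "degree (G v) = degree (G v')"
      obtain i j k i' j' k' where vv: "v = (i,j,k)" "v' = (i',j',k')" by (cases v, cases v')
      note u = v(1,2)[unfolded vv] and eq = v(3)[unfolded vv]
      have eq': "k + R * (i + p * j) = k' + R * (i' + p * j')"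
        using eq u degG by (auto simp: I_def)
      have "k = k'" using arg_cong[OF eq', of "\<lambda>x. x mod R"] u by (auto simp: I_def)
      moreover from this have eq2: "i + p * j = i' + p * j'" using eq' R by auto
      moreover have "i = i'" using arg_cong[OF eq2, of "\<lambda>x. x mod p"] u by (auto simp: I_def)
      ultimately show "v = v'" using p vv by auto
    qed
  qed
  \<comment> \<open>RQ = p^(2s-1) is the average size of a fibre up to 1/p, and 3Q is the
    error.\<close>
  have degF: "degree F \<le> R * Q + 3 * Q" unfolding F_def
  proof (rule degree_sum_le[OF finI])
    fix u assume "u \<in> I"
    then obtain i j k where u: "u = (i,j,k)" "i < p" "j < J" "k < R" by (auto simp: I_def)
    have "k + R * (i + p * j) = k + R * i + j * Q" unfolding QR by (simp add: algebra_simps)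
    also have "R * i \<le> R * (p-1)" using u by auto
    also have "j * Q \<le> (R+1) * Q" using u by (intro mult_le_mono1) (auto simp: J_def)
    finally have "k + R * (i + p * j) \<le> k + R * (p-1) + (R+1)*Q" by simp
    moreover have "(p-1)*R \<le> Q" unfolding QR by auto
    moreover have "R * (p-1) + R = Q" unfolding QR using p
      by (metis Suc_pred' add.commute less_eq_Suc_le mult_Suc_right mult.commute One_nat_def Suc_1 Suc_leD)
    ultimately have "(p-1)*R + (k + R * (i + p * j)) \<le> R * Q + 3 * Q"
      using u by (simp add: algebra_simps)
    then show "degree (smult (d u) (G u)) \<le> R * Q + 3 * Q"
      using degG[OF u(2)] u(1) by (metis degree_smult_le le_trans)
  qed
  have "{x \<in> gf (2 * s). x \<noteq> 0 \<and> (\<Sum>i<2 * s. (a * x + b / x) ^ (p ^ i)) = t} \<subseteq> {x. poly F x = 0}"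
  proof safe
    fix x assume x: "x \<in> gf (2 * s)" "x \<noteq> 0" and t: "t = (\<Sum>i<2 * s. (a * x + b / x) ^ (p ^ i))"
    have QQ: "p ^ (2 * s) = Q * Q" unfolding Q_def by (simp flip: power_add add: mult_2)
    have xq: "x ^ (Q * Q) = x" using x(1) QQ by (simp add: gf_def p_def)
    have TQ: "T x ^ Q = t - T x"
    proof -
      have "T x ^ Q = (\<Sum>i<s. (a * x + b / x) ^ (p ^ (s + i)))"
        unfolding T_def Q_def p_def frobenius_sum by (simp flip: power_mult power_add add: add.commute)
      moreover have "t = T x + (\<Sum>i<s. (a * x + b / x) ^ (p ^ (s + i)))"
        unfolding t T_def mult_2 by (rule sum_lessThan_add)
      ultimately show ?thesis by simp
    qed
    have tm: "poly (smult (d u) (G u)) x ^ Q * x ^ ((p-1)*R) = x ^ ((p-1)*R*Q) * (c u * poly (P u) x)"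
      if uI: "u \<in> I" for u
    proof -
      obtain i j k where u: "u = (i,j,k)" "i < p" using uI by (auto simp: I_def)
      have e: "i + (p-1-i) = p-1" using u by auto
      have "poly (smult (d u) (G u)) x ^ Q
          = c u * (x ^ (k*Q) * (x ^ R * T x) ^ (i*Q) * x ^ ((p-1-i)*R*Q) * x ^ (j*(Q*Q)))"
        by (simp add: u G_def poly_monom power_mult_distrib d polyU[OF x(2)] mult.assoc flip: power_mult d)
      also have "x ^ (j*(Q*Q)) = x ^ j" by (metis xq mult.commute power_mult)
      also have "(x ^ R * T x) ^ (i*Q) = x ^ (i*R*Q) * (t - T x) ^ i"
        unfolding power_mult_distrib TQ[symmetric] by (simp flip: power_mult add: mult_ac)
      also have "c u * (x ^ (k*Q) * (x ^ (i*R*Q) * (t - T x) ^ i) * x ^ ((p-1-i)*R*Q) * x ^ j)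
          = c u * x ^ (k*Q) * (t - T x) ^ i * x ^ j * x ^ ((i + (p-1-i))*R*Q)"
        by (simp add: power_add add_mult_distrib add_mult_distrib2 mult_ac)
      finally have 1: "poly (smult (d u) (G u)) x ^ Q
         = c u * x ^ (k*Q) * (t - T x) ^ i * x ^ j * x ^ ((p-1)*R*Q)" unfolding e .
      have "poly (P u) x = x ^ (k*Q) * (x ^ R * (t - T x)) ^ i * x ^ ((p-1-i)*R) * x ^ j"
        by (simp add: u P_def poly_monom polyU[OF x(2)] algebra_simps)
      also have "\<dots> = x ^ (k*Q) * (t - T x) ^ i * x ^ j * x ^ ((i + (p-1-i))*R)"
        by (simp add: power_add add_mult_distrib add_mult_distrib2 power_mult_distrib mult_ac flip: power_mult)
      finally have "poly (P u) x = x ^ (k*Q) * (t - T x) ^ i * x ^ j * x ^ ((p-1)*R)" unfolding e .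
      then show ?thesis unfolding 1 by simp
    qed
    have "poly F x ^ Q = (\<Sum>u\<in>I. poly (smult (d u) (G u)) x ^ Q)"
      unfolding F_def poly_sum Q_def p_def by (rule frobenius_sum)
    then have "poly F x ^ Q * x ^ ((p-1)*R) = (\<Sum>u\<in>I. poly (smult (d u) (G u)) x ^ Q * x ^ ((p-1)*R))"
      by (simp add: sum_distrib_right)
    also have "\<dots> = x ^ ((p-1)*R*Q) * poly (\<Sum>u\<in>I. smult (c u) (P u)) x"
      unfolding poly_sum sum_distrib_left by (intro sum.cong refl) (use tm in \<open>simp only: poly_smult\<close>)
    also have "\<dots> = 0" by (simp add: c)
    finally show "poly F x = 0" using x(2) by simp
  qed
  then have "card {x \<in> gf (2 * s). x \<noteq> 0 \<and> (\<Sum>i<2 * s. (a * x + b / x) ^ (p ^ i)) = t} \<le> card {x. poly F x = 0}"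
    using poly_roots_finite[OF \<open>F \<noteq> 0\<close>] by (intro card_mono) auto
  also have "\<dots> \<le> degree F" by (rule card_poly_roots_bound[OF \<open>F \<noteq> 0\<close>])
  also have "\<dots> \<le> R * Q + 3 * Q" by (rule degF)
  also have "R * Q = p ^ (2 * s - 1)" unfolding R_def Q_def using s by (simp add: mult_2 flip: power_add)
  finally show ?thesis unfolding Q_def .
qed

section \<open>Finite subfields of an algebraically closed field of characteristic p\<close>

lemma frobenius_minus:
  fixes x :: "'a::field_prime_char"
  shows "(- x) ^ (CHAR('a) ^ n) = - (x ^ (CHAR('a) ^ n))"
proof -
  have "(- x) ^ (CHAR('a) ^ n) + x ^ (CHAR('a) ^ n) = (- x + x) ^ (CHAR('a) ^ n)"
    by (rule frobenius_add [symmetric])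
  also have "\<dots> = 0" by simp
  finally show ?thesis by (simp add: add_eq_0_iff2)
qed

lemma frobenius_inj:
  fixes x y :: "'a::field_prime_char"
  assumes "x ^ (CHAR('a) ^ n) = y ^ (CHAR('a) ^ n)"
  shows "x = y"
proof -
  have "(x + - y) ^ (CHAR('a) ^ n) = 0" unfolding frobenius_add frobenius_minus using assms by simp
  then show ?thesis by simp
qed

lemma gf_closed:
  shows gf_0: "0 \<in> gf n" and gf_1: "1 \<in> gf n"
    and gf_add: "x \<in> gf n \<Longrightarrow> y \<in> gf n \<Longrightarrow> x + y \<in> gf n"
    and gf_minus: "x \<in> gf n \<Longrightarrow> - x \<in> gf n"
    and gf_mult: "x \<in> gf n \<Longrightarrow> y \<in> gf n \<Longrightarrow> x * y \<in> gf n"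
    and gf_divide: "x \<in> gf n \<Longrightarrow> y \<in> gf n \<Longrightarrow> x / y \<in> gf n"
  by (auto simp: gf_def frobenius_add frobenius_minus power_mult_distrib power_divide)

lemma gf_diff: "x \<in> gf n \<Longrightarrow> y \<in> gf n \<Longrightarrow> x - y \<in> gf n"
  using gf_add[of x n "- y"] gf_minus[of y n] by simp

lemma sum_order_alg_closed:
  fixes g :: "'a::alg_closed_field poly"
  assumes "g \<noteq> 0"
  shows "(\<Sum>x | poly g x = 0. order x g) = degree g"
proof -
  obtain A where A: "size A = degree g" "g = smult (lead_coeff g) (\<Prod>x\<in>#A. [:-x, 1:])"
    using alg_closed_imp_factorization[OF assms] by blast
  have "proots g = proots (\<Prod>x\<in>#A. [:-x, 1:])"
    using assms by (subst A(2), subst proots_smult) auto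
  also have "\<dots> = A" proof (induction A)
    case (add x A)
    have "(\<Prod>x\<in>#A. [:-x, 1:]) \<noteq> 0" by auto
    then show ?case
      using add by (simp add: proots_mult del: mult_pCons_left)
  qed simp
  finally have "proots g = A" .
  then have "degree g = (\<Sum>x\<in>set_mset (proots g). count (proots g) x)"
    using A(1) by (simp add: size_multiset_overloaded_eq)
  also have "\<dots> = (\<Sum>x | poly g x = 0. order x g)" using assms by simp
  finally show ?thesis by simp
qed

text \<open>X^(p^n) - X has derivative -1, so each of its roots, which are the elements of
  \<open>gf n\<close>, is simple.\<close>

lemma card_gf:
  assumes "n \<ge> 1"
  shows "finite (gf n :: 'a::{alg_closed_field, field_prime_char} set)"
    and "card (gf n :: 'a set) = CHAR('a) ^ n"
proof -
  define N where "N = CHAR('a) ^ n"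
  have N: "N \<ge> 2" unfolding N_def using assms
    by (metis CHAR_prime One_nat_def Suc_1 Suc_le_eq one_less_power less_le_trans prime_gt_1_nat zero_less_one)
  define f :: "'a poly" where "f = monom 1 N + monom (-1) 1"
  have deg: "degree f = N"
    unfolding f_def using N by (subst degree_add_eq_left) (auto simp: degree_monom_eq)
  then have f0: "f \<noteq> 0" using N by auto
  have roots: "{x. poly f x = 0} = gf n"
    by (auto simp: f_def gf_def poly_monom N_def)
  show "finite (gf n :: 'a set)" unfolding roots[symmetric] by (rule poly_roots_finite[OF f0])
  have "of_nat N = (0::'a)" unfolding N_def using assms by (simp add: power_0_left)
  then have pd: "pderiv f = - 1"
    by (simp add: f_def pderiv_add pderiv_monom flip: monom_0) (simp add: one_pCons monom_0)
  have ord: "order x f = 1" if "x \<in> gf n" for x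
  proof (rule ccontr)
    assume "order x f \<noteq> 1"
    moreover have "order x f \<noteq> 0" using that roots f0 by (auto simp: order_root)
    ultimately have "[:-x, 1:] ^ 2 dvd f" using f0 by (subst order_divides) auto
    then obtain h where "f = [:-x, 1:] ^ 2 * h" by (elim dvdE)
    then have h: "f = [:-x, 1:] * ([:-x, 1:] * h)" by (simp only: power2_eq_square mult.assoc)
    have "poly (pderiv f) x = 0" by (simp add: h pderiv_mult pderiv_pCons del: mult_pCons_left)
    then show False by (simp add: pd)
  qed
  have "N = (\<Sum>x\<in>gf n. order x f)" using sum_order_alg_closed[OF f0] deg roots by simp
  also have "\<dots> = card (gf n :: 'a set)" by (simp add: ord)
  finally show "card (gf n :: 'a set) = CHAR('a) ^ n" by (simp add: N_def)
qed

section \<open>The L-function of a Kloosterman sum\<close>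

text \<open>
  A way to say that the coefficients lie in the prime field which is visibly stable under products and
  quotients.
\<close>

definition frob_poly :: "'a::field_prime_char poly \<Rightarrow> bool" where
  "frob_poly g \<longleftrightarrow> g ^ CHAR('a) = pcompose g (monom 1 (CHAR('a)))"

lemma CHAR_poly_prime: "prime CHAR('a::field_prime_char poly)"
  by simp

lemma frob_poly_mult: "frob_poly g \<Longrightarrow> frob_poly h \<Longrightarrow> frob_poly (g * h)"
  by (simp add: frob_poly_def power_mult_distrib pcompose_mult)

lemma frob_poly_add: "frob_poly g \<Longrightarrow> frob_poly h \<Longrightarrow> frob_poly (g + h)"
  for g h :: "'a::field_prime_char poly"
  using freshmans_dream[OF CHAR_poly_prime, of "CHAR('a)" g h]
  by (simp add: frob_poly_def pcompose_add)

lemma pcompose_monom_1: "pcompose (monom c n) (monom 1 m) = monom c (n * m)" for c :: "'a::field"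
  by (induction n) (auto simp: monom_0 monom_Suc pcompose_pCons mult_monom)

lemma frob_poly_monom: "c \<in> gf 1 \<Longrightarrow> frob_poly (monom c n)"
  by (simp add: frob_poly_def pcompose_monom_1 monom_power gf_def mult.commute)

lemma frob_poly_quotient:
  assumes "frob_poly (g * h)" "frob_poly g" "g \<noteq> 0"
  shows "frob_poly h"
  using assms by (simp add: frob_poly_def power_mult_distrib pcompose_mult flip: assms(2)[unfolded frob_poly_def])

lemma frob_poly_root:
  fixes g :: "'a::field_prime_char poly"
  assumes "frob_poly g" "poly g x = 0"
  shows "poly g (x ^ (CHAR('a) ^ n)) = 0"
proof (induction n)
  case (Suc n)
  have "poly g (y ^ CHAR('a)) = poly g y ^ CHAR('a)" for y
    using arg_cong[OF assms(1)[unfolded frob_poly_def], of "\<lambda>h. poly h y"]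
    by (simp add: poly_pcompose poly_monom)
  from this[of "x ^ (CHAR('a) ^ n)"] Suc show ?case
    by (simp add: mult.commute power_0_left flip: power_mult)
qed (use assms in auto)

text \<open>Compare the coefficients of X^(ip): in g^p it is the p-th power of the i-th coefficient
  of g, in g(X^p) it is that coefficient itself.\<close>

lemma frob_poly_coeff:
  fixes g :: "'a::field_prime_char poly"
  assumes "frob_poly g"
  shows "coeff g i \<in> gf 1"
proof -
  let ?p = "CHAR('a)"
  have p: "?p > 0" by simp
  have 1: "coeff (h ^ ?p) (i * ?p) = coeff h i ^ ?p" for h :: "'a poly" and i
  proof (induction h arbitrary: i)
    case (pCons c h)
    have "pCons c h = [:c:] + monom 1 1 * h" by (simp add: monom_Suc)
    then have "pCons c h ^ ?p = [:c:] ^ ?p + (monom 1 1 * h) ^ ?p"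
      using freshmans_dream[OF CHAR_poly_prime, of "CHAR('a)" "[:c:]"] by simp
    also have "\<dots> = [:c ^ ?p:] + monom 1 ?p * h ^ ?p"
      by (simp add: power_mult_distrib monom_power poly_const_pow)
    finally have *: "pCons c h ^ ?p = [:c ^ ?p:] + monom 1 ?p * h ^ ?p" .
    show ?case unfolding * using pCons.IH
      by (cases i) (auto simp: coeff_monom_mult coeff_pCons split: nat.split)
  qed (simp add: power_0_left)
  have 2: "coeff (pcompose h (monom 1 ?p)) (i * ?p) = coeff h i" for h :: "'a poly" and i
  proof (induction h arbitrary: i)
    case (pCons c h)
    show ?case unfolding pcompose_pCons using pCons.IH
      by (cases i) (auto simp: coeff_monom_mult coeff_pCons split: nat.split)
  qed simp
  show ?thesis using 1[of g i] 2[of g i] assms by (simp add: frob_poly_def gf_def)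
qed

text \<open>If d is the least period of x under Frobenius and d divides j, this is the (j/d)-th
  power of the minimal polynomial of x over the prime field. The pairs (x, j) thus play the part of
  prime powers in the Euler product of the L-function.\<close>

definition orbit_poly :: "'a::field_prime_char \<Rightarrow> nat \<Rightarrow> 'a poly" where
  "orbit_poly x j = (\<Prod>i<j. [:- (x ^ (CHAR('a) ^ i)), 1:])"

lemma poly_orbit_poly: "poly (orbit_poly x j) y = 0 \<longleftrightarrow> (\<exists>i<j. y = x ^ (CHAR('a) ^ i))"
  for x :: "'a::field_prime_char"
  by (auto simp: orbit_poly_def poly_prod)

lemma orbit_poly_monic: "lead_coeff (orbit_poly x j) = 1" and degree_orbit_poly: "degree (orbit_poly x j) = j"
proof -
  show "lead_coeff (orbit_poly x j) = 1" by (simp add: orbit_poly_def lead_coeff_prod)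
  show "degree (orbit_poly x j) = j" by (simp add: orbit_poly_def degree_prod_eq_sum_degree)
qed

lemma coeff_0_orbit_poly: "x \<noteq> 0 \<Longrightarrow> coeff (orbit_poly x j) 0 \<noteq> 0"
  by (auto simp: orbit_poly_def poly_0_coeff_0[symmetric] poly_prod)

text \<open>The p-th power moves each conjugate to the next one, and \<open>x \<in> gf j\<close>
  closes the cycle.\<close>

lemma frob_orbit_poly:
  fixes x :: "'a::field_prime_char"
  assumes "x \<in> gf j"
  shows "frob_poly (orbit_poly x j)"
proof (cases j)
  case (Suc k)
  let ?p = "CHAR('a)"
  let ?l = "\<lambda>i. monom 1 ?p + [:- (x ^ (?p ^ i)):]"
  have lin: "[:- y, 1:] ^ ?p = monom 1 ?p + [:- (y ^ ?p):]" for y :: 'a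
  proof -
    have "[:- y, 1:] = monom 1 1 + [:- y:]" by (simp add: monom_Suc)
    then have "[:- y, 1:] ^ ?p = monom 1 1 ^ ?p + [:- y:] ^ ?p"
      using freshmans_dream[OF CHAR_poly_prime, of "CHAR('a)" "monom 1 1" "[:- y:]"] by simp
    then show ?thesis using frobenius_minus[of y 1] by (simp add: monom_power poly_const_pow)
  qed
  have "orbit_poly x j ^ ?p = (\<Prod>i<j. ?l (Suc i))"
    by (simp add: orbit_poly_def prod_power_distrib lin mult.commute flip: power_mult)
  also have "\<dots> = (\<Prod>i<k. ?l (Suc i)) * ?l j" by (simp add: Suc)
  also have "?l j = ?l 0" using assms by (simp add: gf_def)
  also have "(\<Prod>i<k. ?l (Suc i)) * ?l 0 = (\<Prod>i<j. ?l i)"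
    unfolding Suc by (subst prod.lessThan_Suc_shift) (simp add: mult.commute)
  also have "\<dots> = pcompose (orbit_poly x j) (monom 1 ?p)"
    by (simp add: orbit_poly_def pcompose_prod pcompose_pCons add.commute)
  finally show ?thesis by (simp add: frob_poly_def)
qed (simp add: orbit_poly_def frob_poly_def)

lemma orbit_poly_add:
  fixes x :: "'a::field_prime_char"
  assumes "x \<in> gf d"
  shows "orbit_poly x (d + j) = orbit_poly x d * orbit_poly x j"
proof (induction j)
  case (Suc j)
  have "x ^ (CHAR('a) ^ (d + j)) = x ^ (CHAR('a) ^ j)"
    using assms by (simp add: gf_def power_add power_mult)
  then show ?case using Suc by (simp add: orbit_poly_def mult.assoc del: mult_pCons_left mult_pCons_right)
qed (simp add: orbit_poly_def)

text \<open>The j with \<open>x \<in> gf j\<close> are the multiples of the least period d of x, and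
  \<open>orbit_poly x j\<close> is then a power of an irreducible polynomial with x as a simple
  root; so the count is the multiplicity of x in g. The induction divides out one copy of
  \<open>orbit_poly x d\<close> and shifts all other j by d.\<close>

lemma card_orbit_divisors:
  fixes x :: "'a::field_prime_char"
  assumes "frob_poly g" "g \<noteq> 0"
  shows "finite {j. 1 \<le> j \<and> x \<in> gf j \<and> orbit_poly x j dvd g}"
    and "card {j. 1 \<le> j \<and> x \<in> gf j \<and> orbit_poly x j dvd g} = order x g"
proof -
  let ?A = "\<lambda>g. {j. 1 \<le> j \<and> x \<in> gf j \<and> orbit_poly x j dvd g}"
  let ?p = "CHAR('a)"
  have fin: "finite (?A g)" if "g \<noteq> 0" for g
  proof (rule finite_subset)
    show "?A g \<subseteq> {..degree g}" using that dvd_imp_degree_le[of _ g] by (auto simp: degree_orbit_poly dest!: dvd_imp_degree_le)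
  qed auto
  show "finite (?A g)" by (rule fin[OF assms(2)])
  show "card (?A g) = order x g" using assms
  proof (induction "degree g" arbitrary: g rule: less_induct)
    case less
    show ?case
    proof (cases "poly g x = 0")
      case False
      have "poly (orbit_poly x j) x = 0" if "j \<ge> 1" for j
        using that by (auto simp: poly_orbit_poly intro!: exI[of _ 0])
      then have e: "?A g = {}" using False by (auto elim!: dvdE)
      show ?thesis unfolding e using False by (simp add: order_0I)
    next
      case True
      \<comment> \<open>All iterates of Frobenius at x are roots of g, so two of them agree;
        injectivity of Frobenius then makes x periodic.\<close>
      have "\<not> inj_on (\<lambda>i. x ^ (?p ^ i)) UNIV"
      proof
        assume "inj_on (\<lambda>i. x ^ (?p ^ i)) UNIV"
        then have "infinite (range (\<lambda>i. x ^ (?p ^ i)))" using finite_imageD by blast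
        moreover have "range (\<lambda>i. x ^ (?p ^ i)) \<subseteq> {y. poly g y = 0}"
          using frob_poly_root[OF less(2) True] by auto
        ultimately show False using poly_roots_finite[OF less(3)] finite_subset by blast
      qed
      then obtain i k where ik: "i < k" "x ^ (?p ^ i) = x ^ (?p ^ k)"
        by (metis (no_types, lifting) inj_onI linorder_neqE_nat)
      have per: "x \<in> gf (k - i)" if "i < k" "x ^ (?p ^ i) = x ^ (?p ^ k)" for i k
      proof -
        have "(x ^ (?p ^ (k - i))) ^ (?p ^ i) = x ^ (?p ^ i)"
          using that by (simp flip: power_mult power_add)
        then show ?thesis using frobenius_inj unfolding gf_def by blast
      qed
      define d where "d = (LEAST j. 1 \<le> j \<and> x \<in> gf j)"
      have d: "1 \<le> d" "x \<in> gf d"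
        using LeastI[of "\<lambda>j. 1 \<le> j \<and> x \<in> gf j" "k - i"] per[OF ik] ik(1) by (auto simp: d_def)
      have d_le: "d \<le> j" if "1 \<le> j" "x \<in> gf j" for j
        unfolding d_def using that by (intro Least_le) auto
      have dist: "x ^ (?p ^ i) \<noteq> x ^ (?p ^ k)" if "i < k" "k < d" for i k
      proof
        assume "x ^ (?p ^ i) = x ^ (?p ^ k)"
        then have "d \<le> k - i" using per[of i k] that by (intro d_le) auto
        then show False using that by linarith
      qed
      \<comment> \<open>The conjugates below the least period are distinct, so each new one is a
        root of the cofactor.\<close>
      have "orbit_poly x k dvd g" if "k \<le> d" for k
        using that
      proof (induction k)
        case (Suc k)
        then have "orbit_poly x k dvd g" by simp
        then obtain h where h: "g = orbit_poly x k * h" by (rule dvdE)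
        have "poly (orbit_poly x k) (x ^ (?p ^ k)) \<noteq> 0"
          unfolding poly_orbit_poly using dist[of _ k] Suc.prems by (metis Suc_le_eq)
        then have "poly h (x ^ (?p ^ k)) = 0"
          using frob_poly_root[OF less(2) True, of k] by (simp add: h)
        then have "[:- (x ^ (?p ^ k)), 1:] dvd h" by (simp add: poly_eq_0_iff_dvd)
        then show ?case unfolding h orbit_poly_def prod.lessThan_Suc by (intro mult_dvd_mono dvd_refl)
      qed (simp add: orbit_poly_def)
      from this[of d] obtain h where h: "g = orbit_poly x d * h" by (auto simp: dvd_def)
      have nz: "orbit_poly x d \<noteq> 0" "h \<noteq> 0" using less(3) h by auto
      have fh: "frob_poly h" using frob_poly_quotient[of "orbit_poly x d" h] less(2) h frob_orbit_poly[OF d(2)] nz by simp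
      have "degree h < degree g" using nz d(1) by (simp add: h degree_mult_eq degree_orbit_poly)
      then have IH: "card (?A h) = order x h" using less(1)[of h] fh nz by blast
      have "order x (orbit_poly x d) = 1"
      proof -
        define r where "r = (\<Prod>i<d-1. [:- (x ^ (?p ^ Suc i)), 1:])"
        have "orbit_poly x d = (\<Prod>i<Suc (d-1). [:- (x ^ (?p ^ i)), 1:])" using d(1) by (simp add: orbit_poly_def)
        then have o: "orbit_poly x d = [:- x, 1:] * r"
          unfolding r_def by (subst (asm) prod.lessThan_Suc_shift) simp
        have "poly r x \<noteq> 0"
          using dist[of 0 "Suc i" for i] by (auto simp: r_def poly_prod simp del: power_Suc)
        then have "order x r = 0" by (rule order_0I)
        then show ?thesis using nz unfolding o
          using order_power_n_n[of x 1] by (subst order_mult) auto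
      qed
      then have "order x g = Suc (order x h)" using nz by (simp add: h order_mult)
      moreover have "?A g = insert d ((\<lambda>j. d + j) ` ?A h)"
      proof (intro equalityI subsetI)
        fix j assume j: "j \<in> ?A g"
        then have "d \<le> j" using d_le by auto
        show "j \<in> insert d ((\<lambda>j. d + j) ` ?A h)"
        proof (cases "j = d")
          case False
          define e where "e = j - d"
          have e: "j = d + e" "e \<ge> 1" using \<open>d \<le> j\<close> False by (auto simp: e_def)
          have "x \<in> gf e" using j d(2) unfolding e by (simp add: gf_def power_add power_mult)
          moreover have "orbit_poly x e dvd h" using j nz unfolding e h by (simp add: orbit_poly_add[OF d(2)])
          ultimately show ?thesis using e by blast
        qed auto
      next
        fix j assume j: "j \<in> insert d ((\<lambda>j. d + j) ` ?A h)"
        show "j \<in> ?A g"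
        proof (cases "j = d")
          case True
          then show ?thesis using d by (auto simp: h)
        next
          case False
          then obtain e where e: "j = d + e" "e \<in> ?A h" using j by auto
          have "x \<in> gf j" using e d(2) by (simp add: gf_def power_add power_mult)
          then show ?thesis using e d nz by (auto simp: h orbit_poly_add[OF d(2)])
        qed
      qed
      moreover have "d \<notin> (\<lambda>j. d + j) ` ?A h" by auto
      ultimately show ?thesis using fin[OF nz(2)] IH by (simp add: card_image)
    qed
  qed
qed

section \<open>Newton's identities for the sums over all extensions\<close>

locale kloosterman_character =
  fixes \<psi> :: "'a::{alg_closed_field, field_prime_char} \<Rightarrow> complex" and a b :: 'a
  assumes psi_add: "x \<in> gf 1 \<Longrightarrow> y \<in> gf 1 \<Longrightarrow> \<psi> (x + y) = \<psi> x * \<psi> y"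
    and psi_norm: "x \<in> gf 1 \<Longrightarrow> norm (\<psi> x) = 1"
    and psi_nontrivial: "\<exists>x\<in>gf 1. \<psi> x \<noteq> 1"
    and a: "a \<in> gf 1" "a \<noteq> 0" and b: "b \<in> gf 1" "b \<noteq> 0"
begin

text \<open>On \<open>gf n\<close> with n at least 1, the trace of a x + b/x to the prime
  field.\<close>

definition power_trace :: "nat \<Rightarrow> 'a \<Rightarrow> 'a" where
  "power_trace n x = (\<Sum>i<n. (a * x + b / x) ^ (CHAR('a) ^ i))"

definition S :: "nat \<Rightarrow> complex" where
  "S n = (\<Sum>x\<in>gf n - {0}. \<psi> (power_trace n x))"

text \<open>Monic polynomials over the prime field, prime to X because b/x has a pole at 0.\<close>

definition monics :: "nat \<Rightarrow> 'a poly set" where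
  "monics n = {g. degree g = n \<and> lead_coeff g = 1 \<and> coeff g 0 \<noteq> 0 \<and> frob_poly g}"

text \<open>For \<open>g = (X - x\<^sub>1) \<dots> (X - x\<^sub>n)\<close> this is \<open>\<Sum>\<^sub>i a x\<^sub>i + b / x\<^sub>i\<close>.\<close>
definition root_sum :: "'a poly \<Rightarrow> 'a" where
  "root_sum g = - (a * coeff (reflect_poly g) 1) - b * coeff g 1 / coeff g 0"

text \<open>The coefficients of the \<open>L\<close>-function.\<close>

definition l :: "nat \<Rightarrow> complex" where
  "l n = (\<Sum>g\<in>monics n. \<psi> (root_sum g))"

lemma psi_0: "\<psi> 0 = 1"
proof -
  have "\<psi> 0 * \<psi> 0 = \<psi> 0" using psi_add[OF gf_0 gf_0] by simp
  moreover have "\<psi> 0 \<noteq> 0" using psi_norm[OF gf_0] by auto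
  ultimately show ?thesis by simp
qed

lemma sum_psi_mult:
  assumes "c \<in> gf 1"
  shows "(\<Sum>u\<in>gf 1. \<psi> (u * c)) = (if c = 0 then of_nat CHAR('a) else 0)"
proof (cases "c = 0")
  case True
  then show ?thesis using card_gf(2)[of 1, where 'a = 'a] by (simp add: psi_0)
next
  case False
  obtain x where x: "x \<in> gf 1" "\<psi> x \<noteq> 1" using psi_nontrivial by blast
  define y where "y = x / c"
  have y: "y \<in> gf 1" "y * c = x" using x assms False gf_divide by (auto simp: y_def)
  have "(\<Sum>u\<in>gf 1. \<psi> (u * c)) = (\<Sum>u\<in>gf 1. \<psi> ((u + y) * c))"
    by (rule sum.reindex_bij_witness[of _ "\<lambda>u. u + y" "\<lambda>u. u - y"])
       (use y gf_add gf_diff in auto)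
  also have "\<dots> = (\<Sum>u\<in>gf 1. \<psi> (u * c) * \<psi> x)"
    by (intro sum.cong refl) (use y x assms in \<open>simp add: distrib_right psi_add gf_mult\<close>)
  also have "\<dots> = (\<Sum>u\<in>gf 1. \<psi> (u * c)) * \<psi> x" by (simp add: sum_distrib_right)
  finally show ?thesis using x False by auto
qed

lemma finite_monics: "finite (monics n)"
proof (rule finite_subset)
  show "monics n \<subseteq> Poly ` {xs. set xs \<subseteq> gf 1 \<and> length xs \<le> Suc n}"
  proof
    fix g assume g: "g \<in> monics n"
    have "set (coeffs g) \<subseteq> gf 1"
      using g frob_poly_coeff by (auto simp: monics_def coeffs_def)
    moreover have "length (coeffs g) \<le> Suc n"
      using g by (auto simp: monics_def coeffs_def)
    ultimately show "g \<in> Poly ` {xs. set xs \<subseteq> gf 1 \<and> length xs \<le> Suc n}"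
      by (intro image_eqI[of _ _ "coeffs g"]) auto
  qed
  show "finite (Poly ` {xs. set xs \<subseteq> (gf 1 :: 'a set) \<and> length xs \<le> Suc n})"
    by (intro finite_imageI finite_lists_length_le card_gf) auto
qed

lemma root_sum_gf: "g \<in> monics n \<Longrightarrow> root_sum g \<in> gf 1"
proof -
  assume "g \<in> monics n"
  then have c: "coeff g i \<in> gf 1" for i using frob_poly_coeff by (auto simp: monics_def)
  then have "coeff (reflect_poly g) 1 \<in> gf 1" by (auto simp: coeff_reflect_poly gf_0)
  then show ?thesis unfolding root_sum_def using c a b
    by (intro gf_diff gf_minus gf_mult gf_divide) auto
qed

text \<open>The ratio of the two lowest coefficients is the logarithmic derivative at 0, of g in one
  term and of its reversal in the other, hence additive in products.\<close>

lemma root_sum_mult: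
  assumes "lead_coeff g = 1" "lead_coeff h = 1" "coeff g 0 \<noteq> 0" "coeff h 0 \<noteq> 0"
  shows "root_sum (g * h) = root_sum g + root_sum h"
proof -
  have c1: "coeff (u * v) 1 = coeff u 0 * coeff v 1 + coeff u 1 * coeff v 0" for u v :: "'a poly"
    by (simp add: coeff_mult atMost_Suc)
  have "coeff (reflect_poly g) 0 = 1" "coeff (reflect_poly h) 0 = 1"
    using assms by (auto simp: coeff_reflect_poly)
  then have "coeff (reflect_poly (g * h)) 1 = coeff (reflect_poly h) 1 + coeff (reflect_poly g) 1"
    unfolding reflect_poly_mult c1 by simp
  moreover have "coeff (g * h) 1 / coeff (g * h) 0 = coeff h 1 / coeff h 0 + coeff g 1 / coeff g 0"
    unfolding c1 coeff_mult_0 using assms by (simp add: field_simps)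
  ultimately show ?thesis
    unfolding root_sum_def by (simp add: algebra_simps flip: times_divide_eq_right)
qed

lemma root_sum_orbit_poly:
  assumes "x \<noteq> 0"
  shows "root_sum (orbit_poly x j) = power_trace j x"
proof (induction j)
  case 0
  show ?case by (simp add: orbit_poly_def root_sum_def power_trace_def)
next
  case (Suc j)
  let ?y = "x ^ (CHAR('a) ^ j)"
  have "root_sum (orbit_poly x (Suc j)) = root_sum (orbit_poly x j * [:- ?y, 1:])"
    by (simp only: orbit_poly_def prod.lessThan_Suc)
  also have "\<dots> = root_sum (orbit_poly x j) + root_sum [:- ?y, 1:]"
    using assms by (intro root_sum_mult) (auto simp: orbit_poly_monic coeff_0_orbit_poly)
  also have "root_sum [:- ?y, 1:] = a * ?y + b / ?y"
    using assms by (simp add: root_sum_def reflect_poly_def)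
  also have "\<dots> = (a * x + b / x) ^ (CHAR('a) ^ j)"
    using gf_1_imp_gf[OF a(1), of j] gf_1_imp_gf[OF b(1), of j]
    by (simp add: frobenius_add power_mult_distrib power_divide gf_def)
  finally show ?case by (simp add: Suc power_trace_def)
qed

lemma orbit_poly_monics: "x \<in> gf j \<Longrightarrow> x \<noteq> 0 \<Longrightarrow> orbit_poly x j \<in> monics j"
  by (auto simp: monics_def orbit_poly_monic coeff_0_orbit_poly frob_orbit_poly degree_orbit_poly
      simp flip: orbit_poly_monic[of x j])

text \<open>Coefficient form of T L'(T) = L(T) (S_1 T + S_2 T^2 + ...). The factor n counts the
  roots of a monic g with multiplicity, that is, the pairs (x, j) with \<open>orbit_poly x j\<close>
  dividing g; each pair splits this factor off g, and \<open>root_sum\<close> is additive.\<close>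

lemma newton_identity: "of_nat n * l n = (\<Sum>j=1..n. S j * l (n - j))"
proof -
  let ?J = "\<lambda>g x. {j. 1 \<le> j \<and> x \<in> gf j \<and> orbit_poly x j dvd g}"
  have deg: "of_nat n = (\<Sum>j=1..n. \<Sum>x\<in>gf j - {0}. if orbit_poly x j dvd g then 1 else 0 :: complex)"
    if g: "g \<in> monics n" for g
  proof -
    have g0: "g \<noteq> 0" and fg: "frob_poly g" and dg: "degree g = n" and gc: "coeff g 0 \<noteq> 0"
      using g by (auto simp: monics_def)
    let ?R = "{x. poly g x = 0}"
    have "n = (\<Sum>x\<in>?R. card (?J g x))"
      using sum_order_alg_closed[OF g0] card_orbit_divisors(2)[OF fg g0] dg by simp
    also have "\<dots> = card (SIGMA x:?R. ?J g x)"
      using card_orbit_divisors(1)[OF fg g0] poly_roots_finite[OF g0] by (subst card_SigmaI) auto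
    also have "\<dots> = card (SIGMA j:{1..n}. {x \<in> gf j - {0}. orbit_poly x j dvd g})"
    proof (rule bij_betw_same_card[of prod.swap], rule bij_betw_byWitness[where f' = prod.swap])
      have jn: "j \<le> n" if "orbit_poly x j dvd g" for x j
        using dvd_imp_degree_le[OF that g0] by (simp add: degree_orbit_poly dg)
      have xn: "x \<noteq> 0" if "poly g x = 0" for x using that gc by (auto simp: poly_0_coeff_0)
      have rt: "poly g x = 0" if "orbit_poly x j dvd g" "1 \<le> j" for x j
      proof -
        have "poly (orbit_poly x j) x = 0" using that(2) by (auto simp: poly_orbit_poly intro!: exI[of _ 0])
        then show ?thesis using that(1) by auto
      qed
      show "prod.swap ` (SIGMA x:?R. ?J g x) \<subseteq> (SIGMA j:{1..n}. {x \<in> gf j - {0}. orbit_poly x j dvd g})"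
      proof (rule image_subsetI)
        fix u assume "u \<in> (SIGMA x:?R. ?J g x)"
        then obtain x j where "u = (x, j)" "poly g x = 0" "1 \<le> j" "x \<in> gf j" "orbit_poly x j dvd g" by auto
        then show "prod.swap u \<in> (SIGMA j:{1..n}. {x \<in> gf j - {0}. orbit_poly x j dvd g})"
          using jn[of x j] xn[of x] by simp
      qed
      show "prod.swap ` (SIGMA j:{1..n}. {x \<in> gf j - {0}. orbit_poly x j dvd g}) \<subseteq> (SIGMA x:?R. ?J g x)"
      proof (rule image_subsetI)
        fix u assume "u \<in> (SIGMA j:{1..n}. {x \<in> gf j - {0}. orbit_poly x j dvd g})"
        then obtain x j where "u = (j, x)" "1 \<le> j" "x \<in> gf j" "orbit_poly x j dvd g" by auto
        then show "prod.swap u \<in> (SIGMA x:?R. ?J g x)"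
          using rt[of x j] by simp
      qed
    qed auto
    also have "\<dots> = (\<Sum>j=1..n. card {x \<in> gf j - {0}. orbit_poly x j dvd g})"
      by (subst card_SigmaI) (auto intro: finite_subset[OF _ card_gf(1)])
    also have "\<dots> = (\<Sum>j=1..n. \<Sum>x\<in>gf j - {0}. if orbit_poly x j dvd g then 1 else 0)"
    proof (intro sum.cong refl)
      fix j assume "j \<in> {1..n}"
      then have "finite (gf j - {0} :: 'a set)" using card_gf(1)[of j] by auto
      then show "card {x \<in> gf j - {0}. orbit_poly x j dvd g}
          = (\<Sum>x\<in>gf j - {0}. if orbit_poly x j dvd g then 1 else 0)"
        by (simp add: sum.If_cases Int_def)
    qed
    finally have "complex_of_nat n = of_nat (\<Sum>j=1..n. \<Sum>x\<in>gf j - {0}. if orbit_poly x j dvd g then 1 else 0)"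
      by (rule arg_cong)
    then show ?thesis by (simp add: if_distrib cong: if_cong)
  qed
  have "of_nat n * l n = (\<Sum>g\<in>monics n. (\<Sum>j=1..n. \<Sum>x\<in>gf j - {0}. if orbit_poly x j dvd g then 1 else 0) * \<psi> (root_sum g))"
    unfolding l_def sum_distrib_left by (intro sum.cong refl) (simp only: deg)
  also have "\<dots> = (\<Sum>g\<in>monics n. \<Sum>j=1..n. \<Sum>x\<in>gf j - {0}. if orbit_poly x j dvd g then \<psi> (root_sum g) else 0)"
    unfolding sum_distrib_right by (intro sum.cong refl) auto
  also have "\<dots> = (\<Sum>j=1..n. \<Sum>x\<in>gf j - {0}. \<Sum>g\<in>monics n. if orbit_poly x j dvd g then \<psi> (root_sum g) else 0)"
    by (subst sum.swap, intro sum.cong refl, subst sum.swap, rule refl)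
  also have "\<dots> = (\<Sum>j=1..n. \<Sum>x\<in>gf j - {0}. \<psi> (power_trace j x) * l (n - j))"
  proof (intro sum.cong refl)
    fix j and x :: 'a assume j: "j \<in> {1..n}" and x: "x \<in> gf j - {0}"
    let ?o = "orbit_poly x j"
    have o: "?o \<in> monics j" using orbit_poly_monics x by auto
    have o0: "?o \<noteq> 0" using o by (auto simp: monics_def)
    have "(\<Sum>g\<in>monics n. if ?o dvd g then \<psi> (root_sum g) else 0) = (\<Sum>g\<in>{g\<in>monics n. ?o dvd g}. \<psi> (root_sum g))"
      using finite_monics by (simp add: sum.inter_filter)
    \<comment> \<open>The cofactor again has its coefficients in the prime field, so nothing is lost
      by passing to \<open>monics (n - j)\<close>.\<close>
    also have "{g\<in>monics n. ?o dvd g} = (\<lambda>h. ?o * h) ` monics (n - j)"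
    proof (intro equalityI subsetI)
      fix g assume g: "g \<in> {g\<in>monics n. ?o dvd g}"
      then obtain h where h: "g = ?o * h" by (auto simp: dvd_def)
      have "h \<noteq> 0" using g h by (auto simp: monics_def)
      have "frob_poly h" using g o o0 by (intro frob_poly_quotient[of ?o h]) (auto simp: h monics_def)
      moreover have "lead_coeff h = 1" "coeff h 0 \<noteq> 0"
        using g o by (auto simp: h monics_def lead_coeff_mult coeff_mult_0)
      moreover have "degree h = n - j"
        using g o \<open>h \<noteq> 0\<close> o0 by (auto simp: h monics_def degree_mult_eq)
      ultimately show "g \<in> (\<lambda>h. ?o * h) ` monics (n - j)" unfolding h monics_def by auto
    next
      fix g assume "g \<in> (\<lambda>h. ?o * h) ` monics (n - j)"
      then obtain h where h: "g = ?o * h" "h \<in> monics (n - j)" by auto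
      have "h \<noteq> 0" using h by (auto simp: monics_def)
      have "degree g = n" using h o o0 \<open>h \<noteq> 0\<close> j by (auto simp: monics_def degree_mult_eq)
      moreover have "lead_coeff g = 1" "coeff g 0 \<noteq> 0" "frob_poly g"
        using h o by (auto simp: monics_def lead_coeff_mult coeff_mult_0 intro: frob_poly_mult)
      ultimately show "g \<in> {g\<in>monics n. ?o dvd g}" using h by (auto simp: monics_def)
    qed
    also have "(\<Sum>g\<in>(\<lambda>h. ?o * h) ` monics (n - j). \<psi> (root_sum g)) = (\<Sum>h\<in>monics (n - j). \<psi> (root_sum (?o * h)))"
      using o0 by (subst sum.reindex) (auto simp: inj_on_def)
    also have "\<dots> = (\<Sum>h\<in>monics (n - j). \<psi> (power_trace j x) * \<psi> (root_sum h))"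
    proof (intro sum.cong refl)
      fix h assume h: "h \<in> monics (n - j)"
      have "root_sum (?o * h) = root_sum ?o + root_sum h"
        using o h by (intro root_sum_mult) (auto simp: monics_def)
      then show "\<psi> (root_sum (?o * h)) = \<psi> (power_trace j x) * \<psi> (root_sum h)"
        using psi_add[OF root_sum_gf[OF o] root_sum_gf[OF h]] root_sum_orbit_poly[of x j] x by simp
    qed
    finally show "(\<Sum>g\<in>monics n. if ?o dvd g then \<psi> (root_sum g) else 0) = \<psi> (power_trace j x) * l (n - j)"
      by (simp add: l_def sum_distrib_left)
  qed
  finally show ?thesis unfolding S_def by (simp add: sum_distrib_right)
qed

lemma l_0: "l 0 = 1"
proof -
  have "g = 1" if "degree g = 0" "lead_coeff g = 1" for g :: "'a poly"
    using that by (elim degree_eq_zeroE) (auto simp: one_pCons)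
  then have "monics 0 = {1}"
    by (auto simp: monics_def frob_poly_def)
  then show ?thesis by (simp add: l_def root_sum_def psi_0)
qed

text \<open>For X^2 + uX + v the root sum is -u (a + b/v). Summing over u leaves only v = -b/a, with
  weight p.\<close>

lemma l_2: "l 2 = of_nat CHAR('a)"
proof -
  have M2: "monics 2 = (\<lambda>(v,u). [:v, u, 1:]) ` ((gf 1 - {0}) \<times> gf 1)"
  proof (intro equalityI subsetI)
    fix g assume g: "g \<in> monics 2"
    have "coeff g n = coeff [:coeff g 0, coeff g 1, 1:] n" for n
    proof -
      consider "n = 0" | "n = 1" | "n = 2" | "n > 2" by linarith
      then show ?thesis
        using g by cases (auto simp: monics_def coeff_eq_0 numeral_2_eq_2 coeff_pCons split: nat.split)
    qed
    then have "g = [:coeff g 0, coeff g 1, 1:]" by (rule poly_eqI)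
    then show "g \<in> (\<lambda>(v,u). [:v, u, 1:]) ` ((gf 1 - {0}) \<times> gf 1)"
      using g frob_poly_coeff by (intro image_eqI[of _ _ "(coeff g 0, coeff g 1)"]) (auto simp: monics_def)
  next
    fix g assume "g \<in> (\<lambda>(v,u). [:v, u, 1:]) ` ((gf 1 - {0}) \<times> (gf 1 :: 'a set))"
    then obtain u v where uv: "g = [:v, u, 1:]" "v \<in> gf 1" "v \<noteq> 0" "u \<in> gf 1" by auto
    have "g = monom v 0 + monom u 1 + monom 1 2"
      by (simp add: uv monom_altdef numeral_2_eq_2)
    then have "frob_poly g" using uv gf_1 by (auto intro!: frob_poly_add frob_poly_monom)
    then show "g \<in> monics 2" using uv by (auto simp: monics_def)
  qed
  have "l 2 = (\<Sum>(v,u)\<in>(gf 1 - {0}) \<times> gf 1. \<psi> (root_sum [:v, u, 1:]))"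
    unfolding l_def M2 by (subst sum.reindex) (auto simp: inj_on_def split_beta)
  also have "\<dots> = (\<Sum>v\<in>gf 1 - {0}. \<Sum>u\<in>gf 1. \<psi> (root_sum [:v, u, 1:]))"
    by (simp add: sum.cartesian_product)
  also have "\<dots> = (\<Sum>v\<in>gf 1 - {0}. if v = - b / a then of_nat CHAR('a) else 0)"
  proof (intro sum.cong refl)
    fix v :: 'a assume v: "v \<in> gf 1 - {0}"
    have "root_sum [:v, u, 1:] = u * - (a + b / v)" if "u \<in> gf 1" for u
      using v by (simp add: root_sum_def reflect_poly_def field_simps)
    moreover have "- (a + b / v) \<in> gf 1" using v by (intro gf_minus gf_add gf_divide a(1) b(1)) auto
    moreover have "- (a + b / v) = 0 \<longleftrightarrow> v = - b / a"
      using v a(2) by (auto simp: field_simps add_eq_0_iff)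
    ultimately show "(\<Sum>u\<in>gf 1. \<psi> (root_sum [:v, u, 1:])) = (if v = - b / a then of_nat CHAR('a) else 0)"
      using sum_psi_mult[of "- (a + b / v)"] by simp
  qed
  also have "\<dots> = of_nat CHAR('a)"
    using a b card_gf(1)[of 1, where 'a = 'a] gf_divide[OF gf_minus[OF b(1)] a(1)] by (simp add: sum.delta)
  finally show ?thesis .
qed

text \<open>Changing the coefficient of X^(n-1) moves the sum of the roots freely. For n at least 3
  it leaves the two lowest coefficients alone, so the sum of the inverse roots is unchanged. A
  change that multiplies every term by the same \<psi> x \<noteq> 1 forces the total to
  vanish.\<close>

lemma l_eq_0:
  assumes "n \<ge> 3"
  shows "l n = 0"
proof -
  obtain x where x: "x \<in> gf 1" "\<psi> x \<noteq> 1" using psi_nontrivial by blast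
  define t where "t = - x / a"
  have t: "t \<in> gf 1" unfolding t_def by (intro gf_divide gf_minus x(1) a(1))
  let ?T = "\<lambda>t g. g + monom t (n - 1)"
  have T: "?T t g \<in> monics n" and R: "root_sum (?T t g) = root_sum g - a * t"
    if g: "g \<in> monics n" and t: "t \<in> gf 1" for g t
  proof -
    have m: "degree (monom t (n - 1)) < n" using assms degree_monom_le[of t "n - 1"] by linarith
    have g': "degree g = n" "lead_coeff g = 1" "coeff g 0 \<noteq> 0" "frob_poly g" using g by (auto simp: monics_def)
    have d: "degree (?T t g) = n" using m g' by (subst degree_add_eq_left) auto
    have c: "coeff (?T t g) i = coeff g i" if "i \<noteq> n - 1" for i using that by auto
    show "?T t g \<in> monics n"
      unfolding monics_def using d g' c[of n] c[of 0] assms frob_poly_add[OF g'(4) frob_poly_monom[OF t, of "n - 1"]]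
      by auto
    have "coeff (reflect_poly (?T t g)) 1 = coeff (reflect_poly g) 1 + t"
      unfolding coeff_reflect_poly d g'(1) using assms by simp
    then show "root_sum (?T t g) = root_sum g - a * t"
      unfolding root_sum_def using c[of 0] c[of 1] assms by (simp add: algebra_simps)
  qed
  have mm: "monom t (n - 1) + monom (- t) (n - 1) = 0" "monom (- t) (n - 1) + monom t (n - 1) = 0"
    by (simp_all add: add_monom)
  have "l n = (\<Sum>g\<in>monics n. \<psi> (root_sum (?T t g)))"
    unfolding l_def
    by (rule sum.reindex_bij_witness[of _ "?T t" "?T (- t)"])
       (use T t gf_minus mm in \<open>auto simp: add.assoc\<close>)
  also have "\<dots> = (\<Sum>g\<in>monics n. \<psi> (root_sum g) * \<psi> x)"
  proof (intro sum.cong refl)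
    fix g assume g: "g \<in> monics n"
    have "root_sum (?T t g) = root_sum g + x" unfolding R[OF g t] using a by (simp add: t_def)
    then show "\<psi> (root_sum (?T t g)) = \<psi> (root_sum g) * \<psi> x"
      using psi_add[OF root_sum_gf[OF g] x(1)] by simp
  qed
  also have "\<dots> = l n * \<psi> x" by (simp add: l_def sum_distrib_right)
  finally show ?thesis using x by auto
qed

lemma S_recurrence:
  shows "S 2 = 2 * of_nat CHAR('a) - S 1 ^ 2" and "S (n + 3) = - S 1 * S (n + 2) - of_nat CHAR('a) * S (n + 1)"
proof -
  have l1: "l 1 = S 1" using newton_identity[of 1] l_0 by simp
  have "2 * l 2 = S 1 * l 1 + S 2 * l 0"
    using newton_identity[of 2] by (simp add: numeral_2_eq_2)
  then show "S 2 = 2 * of_nat CHAR('a) - S 1 ^ 2" unfolding l_0 l1 l_2 by (simp add: power2_eq_square)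
  have "(\<Sum>j=1..n+3. S j * l (n + 3 - j)) = (\<Sum>j\<in>{n+1,n+2,n+3}. S j * l (n + 3 - j))"
  proof (rule sum.mono_neutral_right)
    show "\<forall>i\<in>{1..n + 3} - {n + 1, n + 2, n + 3}. S i * l (n + 3 - i) = 0"
      by (auto intro!: l_eq_0)
  qed auto
  also have "\<dots> = S (n + 1) * l 2 + S (n + 2) * l 1 + S (n + 3) * l 0" by simp
  finally have "0 = S (n + 1) * l 2 + S (n + 2) * l 1 + S (n + 3) * l 0"
    using newton_identity[of "n + 3"] l_eq_0[of "n + 3"] by simp
  then have "S (n + 3) + (S 1 * S (n + 2) + of_nat CHAR('a) * S (n + 1)) = 0"
    unfolding l_0 l1 l_2 by (simp add: algebra_simps)
  then show "S (n + 3) = - S 1 * S (n + 2) - of_nat CHAR('a) * S (n + 1)"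
    unfolding add_eq_0_iff2 by simp
qed

end

section \<open>Weil's bound\<close>

definition ee :: "int \<Rightarrow> int \<Rightarrow> complex" where
  "ee q k = cis (2 * pi * of_int k / of_int q)"

lemma ee_0 [simp]: "ee q 0 = 1"
  by (simp add: ee_def)

lemma ee_add: "ee q (k + l) = ee q k * ee q l"
  by (simp add: ee_def cis_mult add_divide_distrib distrib_left)

lemma ee_uminus: "ee q (- k) = cnj (ee q k)"
  by (simp add: ee_def cis_cnj)

lemma norm_ee [simp]: "norm (ee q k) = 1"
  by (simp add: ee_def)

lemma ee_eq_1_iff:
  assumes "q > 0"
  shows "ee q k = 1 \<longleftrightarrow> q dvd k"
proof
  assume "q dvd k"
  then obtain m where "k = q * m" by auto
  then have "2 * pi * of_int k / of_int q = 2 * pi * of_int m" using assms by simp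
  then show "ee q k = 1" unfolding ee_def by (metis cis_multiple_2pi Ints_of_int)
next
  assume "ee q k = 1"
  then have "cos (2 * pi * of_int k / of_int q) = 1" by (simp add: ee_def complex_eq_iff)
  then obtain n :: int where "2 * pi * of_int k / of_int q = of_int n * 2 * pi"
    by (auto simp: cos_one_2pi_int)
  then have "of_int k = (of_int (q * n) :: real)" using assms by (simp add: field_simps)
  then have "k = q * n" by (simp only: of_int_eq_iff)
  then show "q dvd k" by simp
qed

lemma ee_cong:
  assumes "q > 0" "[k = l] (mod q)"
  shows "ee q k = ee q l"
proof -
  have "ee q (k - l) = 1" using assms by (simp add: ee_eq_1_iff cong_iff_dvd_diff)
  then show ?thesis using ee_add[of q "k - l" l] by simp
qed

lemma ee_scale: "m \<noteq> 0 \<Longrightarrow> ee (m * q) (m * k) = ee q k"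
  by (simp add: ee_def mult.assoc)

lemma sum_residues_shift:
  fixes f :: "int \<Rightarrow> 'b::comm_monoid_add"
  assumes q: "q > 0" and per: "\<And>x y. [x = y] (mod q) \<Longrightarrow> f x = f y"
  shows "(\<Sum>x\<in>{0..<q}. f (x + t)) = (\<Sum>x\<in>{0..<q}. f x)"
proof (rule sum.reindex_bij_witness[of _ "\<lambda>x. (x - t) mod q" "\<lambda>x. (x + t) mod q"])
  fix x assume x: "x \<in> {0..<q}"
  show "((x + t) mod q - t) mod q = x" "((x - t) mod q + t) mod q = x"
    using x q by (simp_all add: mod_simps)
  show "f ((x + t) mod q) = f (x + t)" by (rule per) (simp add: cong_def)
qed (use q in auto)

text \<open>Residues start at 0, so that modulus 1 has the unit 0 and its Kloosterman sum is
  1.\<close>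

definition units_mod :: "int \<Rightarrow> int set" where
  "units_mod q = {x\<in>{0..<q}. coprime x q}"

lemma finite_units_mod [simp]: "finite (units_mod q)"
  unfolding units_mod_def by (rule finite_subset[of _ "{0..<q}"]) auto

lemma units_mod_prime:
  assumes "prime p"
  shows "units_mod p = {1..<p}"
proof (intro equalityI subsetI)
  fix x assume x: "x \<in> units_mod p"
  then have "x \<noteq> 0" using assms not_prime_unit[of p] by (auto simp: units_mod_def)
  then show "x \<in> {1..<p}" using x by (auto simp: units_mod_def)
next
  fix x assume x: "x \<in> {1..<p}"
  then have "\<not> p dvd x" by (auto simp: zdvd_not_zless)
  then have "coprime p x" using assms prime_imp_coprime by blast
  then show "x \<in> units_mod p" using x by (auto simp: units_mod_def coprime_commute)
qed

lemma sum_units_mult: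
  fixes f :: "int \<Rightarrow> 'b::comm_monoid_add"
  assumes q: "q > 0" and u: "coprime u q" and per: "\<And>x y. [x = y] (mod q) \<Longrightarrow> f x = f y"
  shows "(\<Sum>x\<in>units_mod q. f (u * x)) = (\<Sum>x\<in>units_mod q. f x)"
proof -
  define v where "v = modular_inverse q u"
  have v: "[v * u = 1] (mod q)" "coprime v q"
    using u by (auto simp: v_def intro: cong_modular_inverse2)
  have inv: "(v * (u * x mod q)) mod q = x" "(u * (v * x mod q)) mod q = x" if "x \<in> units_mod q" for x
  proof -
    have "[v * u * x = 1 * x] (mod q)" by (intro cong_mult v cong_refl)
    then show "(v * (u * x mod q)) mod q = x" "(u * (v * x mod q)) mod q = x"
      using that by (simp_all add: cong_def units_mod_def mod_simps mult_ac)
  qed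
  show ?thesis
  proof (rule sum.reindex_bij_witness[of _ "\<lambda>x. v * x mod q" "\<lambda>x. u * x mod q"])
    show "f (u * x mod q) = f (u * x)" for x by (rule per) (simp add: cong_def)
  qed (use q u v inv in \<open>auto simp: units_mod_def\<close>)
qed

lemma sum_ee:
  assumes "q > 0"
  shows "(\<Sum>x\<in>{0..<q}. ee q (x * m)) = (if q dvd m then of_int q else 0)"
proof (cases "q dvd m")
  case True
  then have "ee q (x * m) = 1" for x using assms by (simp add: ee_eq_1_iff)
  then show ?thesis using True assms by simp
next
  case False
  have "(\<Sum>x\<in>{0..<q}. ee q (x * m)) = (\<Sum>x\<in>{0..<q}. ee q ((x + 1) * m))"
    by (rule sum_residues_shift[symmetric]) (use assms in \<open>auto intro!: ee_cong cong_mult\<close>)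
  also have "\<dots> = (\<Sum>x\<in>{0..<q}. ee q (x * m)) * ee q m"
    by (simp add: distrib_right ee_add sum_distrib_right)
  finally show ?thesis using False assms by (auto simp: ee_eq_1_iff)
qed

definition kloosterman :: "int \<Rightarrow> int \<Rightarrow> int \<Rightarrow> complex" where
  "kloosterman q a b = (\<Sum>x\<in>units_mod q. ee q (a * x + b * modular_inverse q x))"

text \<open>If \<alpha> exceeds sqrt p in absolute value, then \<beta> = p/\<alpha> falls below it,
  so no cancellation can hide the growth of \<alpha>^(2s), which outruns every multiple of p^s.
  Hence even exponents suffice.\<close>

lemma norm_le_of_power_sums_bounded:
  fixes \<alpha> \<beta> :: complex
  assumes p: "p > 0" and prod: "\<alpha> * \<beta> = of_real p"
    and bound: "\<And>s::nat. s \<ge> 1 \<Longrightarrow> norm (\<alpha> ^ (2 * s) + \<beta> ^ (2 * s)) \<le> C * p ^ s"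
  shows "norm \<alpha> \<le> sqrt p"
proof (rule ccontr)
  assume "\<not> norm \<alpha> \<le> sqrt p"
  then have al: "norm \<alpha> > sqrt p" by simp
  have np: "norm \<alpha> * norm \<beta> = p" using prod p by (simp flip: norm_mult)
  have al2: "norm \<alpha> ^ 2 > p" using al p
    by (metis real_sqrt_abs real_sqrt_less_iff abs_norm_cancel)
  have be: "norm \<beta> ^ 2 \<le> p"
  proof -
    have "norm \<alpha> ^ 2 * norm \<beta> ^ 2 = p * p" 
      by (metis np power_mult_distrib power2_eq_square)
    moreover have "norm \<alpha> ^ 2 * norm \<beta> ^ 2 \<ge> p * norm \<beta> ^ 2" using al2 by (intro mult_right_mono) auto
    ultimately show ?thesis using p by simp
  qed
  define r where "r = norm \<alpha> ^ 2 / p"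
  have r: "r > 1" using al2 p by (simp add: r_def)
  obtain n where n: "r ^ n > max 1 (C + 1)" using real_arch_pow[OF r] by blast
  have "n \<ge> 1" using n by (cases n) auto
  have "(norm \<alpha> ^ 2) ^ n = norm ((\<alpha> ^ (2 * n) + \<beta> ^ (2 * n)) - \<beta> ^ (2 * n))"
    by (simp add: norm_power flip: power_mult)
  also have "\<dots> \<le> C * p ^ n + norm (\<beta> ^ (2 * n))"
    using bound[OF \<open>n \<ge> 1\<close>] norm_triangle_ineq4[of "\<alpha> ^ (2 * n) + \<beta> ^ (2 * n)" "\<beta> ^ (2 * n)"] by linarith
  also have "norm (\<beta> ^ (2 * n)) \<le> p ^ n"
    using power_mono[OF be, of n] by (simp add: norm_power flip: power_mult)
  finally have "(norm \<alpha> ^ 2) ^ n \<le> (C + 1) * p ^ n" by (simp add: algebra_simps)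
  then have "r ^ n \<le> C + 1" using p by (simp add: r_def power_divide divide_le_eq)
  then show False using n by simp
qed

context kloosterman_character
begin

lemma power_trace_gf:
  assumes "x \<in> gf n"
  shows "power_trace n x \<in> gf 1"
proof (cases n)
  case (Suc m)
  define f where "f = a * x + b / x"
  have "f \<in> gf n" unfolding f_def
    using gf_1_imp_gf[OF a(1)] gf_1_imp_gf[OF b(1)] assms by (intro gf_add gf_mult gf_divide) auto
  then have f: "f ^ (CHAR('a) ^ Suc m) = f" by (simp add: gf_def Suc)
  have "power_trace n x ^ CHAR('a) = (\<Sum>i<n. f ^ (CHAR('a) ^ Suc i))"
    unfolding power_trace_def f_def[symmetric]
    using frobenius_sum[of "\<lambda>i. f ^ (CHAR('a) ^ i)" "{..<n}" 1] by (simp add: mult.commute flip: power_mult)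
  also have "\<dots> = (\<Sum>i<m. f ^ (CHAR('a) ^ Suc i)) + f"
    unfolding Suc sum.lessThan_Suc f ..
  also have "\<dots> = power_trace n x"
    unfolding power_trace_def f_def[symmetric] Suc sum.lessThan_Suc_shift by (simp add: add.commute)
  finally show ?thesis by (simp add: gf_def)
qed (simp add: power_trace_def gf_0)

text \<open>Stepanov's method bounds the fibres of the trace only from above, by M + 3p^s. But their
  sizes add up to p^(2s) - 1 = pM - 1, so the deviations from M nearly cancel, and their absolute
  values are controlled on average.\<close>

lemma norm_S_even_le:
  assumes "s \<ge> 1"
  shows "norm (S (2 * s)) \<le> 7 * real CHAR('a) * real CHAR('a) ^ s"
proof -
  define p where "p = CHAR('a)"
  define A :: "'a set" where "A = gf (2 * s) - {0}"
  define N where "N t = card {x \<in> A. power_trace (2 * s) x = t}" for t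
  have p: "p \<ge> 1" unfolding p_def by (simp add: Suc_leI)
  have finA: "finite A" using card_gf(1)[of "2 * s"] assms by (simp add: A_def)
  have fin1: "finite (gf 1 :: 'a set)" and card1: "card (gf 1 :: 'a set) = p"
    using card_gf[of 1, where 'a = 'a] by (auto simp: p_def)
  have cardA: "card A + 1 = p ^ (2 * s)"
    using card_gf[of "2 * s", where 'a = 'a] assms gf_0[of "2 * s", where 'a = 'a] p
    by (simp add: A_def p_def)
  have tr: "power_trace (2 * s) ` A \<subseteq> gf 1" using power_trace_gf by (auto simp: A_def)
  have sumN: "(\<Sum>t\<in>gf 1. N t) = card A"
    using sum.group[OF finA fin1 tr, of "\<lambda>_. 1::nat"] by (simp add: N_def)
  define M where "M = p ^ (2 * s - 1)"
  have M: "p * M = p ^ (2 * s)" unfolding M_def using assms by (simp flip: power_Suc)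
  have N: "N t \<le> M + 3 * p ^ s" for t
    using stepanov_bound[OF assms a b(1), of t] unfolding N_def A_def power_trace_def p_def M_def
    by (simp add: conj_assoc)
  have "S (2 * s) = (\<Sum>t\<in>gf 1. \<Sum>x\<in>{x \<in> A. power_trace (2 * s) x = t}. \<psi> (power_trace (2 * s) x))"
    unfolding S_def A_def[symmetric] by (rule sum.group[OF finA fin1 tr, symmetric])
  also have "\<dots> = (\<Sum>t\<in>gf 1. of_nat (N t) * \<psi> t)"
    by (intro sum.cong refl) (simp add: N_def)
  \<comment> \<open>Subtracting the average costs nothing, since \<psi> sums to 0 over the prime
    field.\<close>
  also have "\<dots> = (\<Sum>t\<in>gf 1. of_nat (N t) * \<psi> t) - of_nat M * (\<Sum>t\<in>gf 1. \<psi> (t * 1))"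
    using sum_psi_mult[OF gf_1] by simp
  also have "\<dots> = (\<Sum>t\<in>gf 1. of_real (real (N t) - real M) * \<psi> t)"
    by (simp add: sum_distrib_left sum_subtractf left_diff_distrib)
  finally have "norm (S (2 * s)) \<le> (\<Sum>t\<in>gf 1. norm (of_real (real (N t) - real M) * \<psi> t))"
    by (simp add: sum_norm_le)
  also have "\<dots> = (\<Sum>t\<in>gf 1. \<bar>real (N t) - real M\<bar>)"
    by (intro sum.cong refl) (simp add: norm_mult psi_norm del: of_real_diff)
  \<comment> \<open>A real u \<le> B with B \<ge> 0 satisfies |u| \<le> 2B - u, and the u at hand
    add up to -1.\<close>
  also have "\<dots> \<le> (\<Sum>t\<in>gf 1. 2 * real (3 * p ^ s) - (real (N t) - real M))"
  proof (rule sum_mono)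
    fix t
    have "real (N t) \<le> real (M + 3 * p ^ s)" using N by (simp only: of_nat_le_iff)
    moreover have "0 \<le> real (3 * p ^ s)" by simp
    ultimately show "\<bar>real (N t) - real M\<bar> \<le> 2 * real (3 * p ^ s) - (real (N t) - real M)" by linarith
  qed
  also have "\<dots> = 6 * real p * real p ^ s - (real (card A) - real (p * M))"
    unfolding sumN[symmetric] by (simp add: sum_subtractf card1[unfolded One_nat_def] algebra_simps)
  also have "\<dots> = 6 * real p * real p ^ s + 1"
    unfolding M cardA[symmetric] by simp
  also have "\<dots> \<le> 7 * real p * real p ^ s"
  proof -
    have "1 * 1 \<le> real p * real p ^ s" using p by (intro mult_mono one_le_power) auto
    then show ?thesis by simp
  qed
  finally show ?thesis by (simp add: p_def)
qed

lemma norm_S_1_le: "norm (S 1) \<le> 2 * sqrt (real CHAR('a))"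
proof -
  let ?p = "CHAR('a)"
  have p: "real ?p > 0" by simp
  \<comment> \<open>\<alpha> and \<beta> are the roots of z^2 + S_1 z + p, and the recurrence for
    \<open>S\<close> is the one satisfied by their power sums.\<close>
  define r where "r = csqrt (S 1 ^ 2 - 4 * of_nat ?p)"
  define \<alpha> \<beta> where "\<alpha> = (- S 1 + r) / 2" and "\<beta> = (- S 1 - r) / 2"
  have r2: "r ^ 2 = S 1 ^ 2 - 4 * of_nat ?p" by (simp add: r_def)
  have sm: "S 1 = - (\<alpha> + \<beta>)" by (simp add: \<alpha>_def \<beta>_def field_simps)
  have "\<alpha> * \<beta> = (S 1 ^ 2 - r ^ 2) / 4" by (simp add: \<alpha>_def \<beta>_def power2_eq_square algebra_simps)
  then have pr: "\<alpha> * \<beta> = of_nat ?p" by (simp add: r2)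
  have S: "S (n + 1) = - (\<alpha> ^ (n + 1) + \<beta> ^ (n + 1))" for n
  proof (induction n rule: less_induct)
    case (less n)
    consider "n = 0" | "n = 1" | k where "n = k + 2" by (metis One_nat_def Suc_1 add_2_eq_Suc' not0_implies_Suc)
    then show ?case
    proof cases
      case 1
      then show ?thesis using sm by simp
    next
      case 2
      have "S 2 = - (\<alpha> ^ 2 + \<beta> ^ 2)"
        unfolding S_recurrence(1) pr[symmetric] sm by (simp add: power2_eq_square algebra_simps)
      then show ?thesis using 2 by (simp add: numeral_2_eq_2)
    next
      case 3
      have 1: "S (k + 2) = - (\<alpha> ^ (k + 2) + \<beta> ^ (k + 2))" "S (k + 1) = - (\<alpha> ^ (k + 1) + \<beta> ^ (k + 1))"
        using less[of "k + 1"] less[of k] 3 by (auto simp: add.commute)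
      have "S (k + 3) = - (\<alpha> ^ (k + 3) + \<beta> ^ (k + 3))"
        unfolding S_recurrence(2)[of k] 1 pr[symmetric] sm
        by (simp add: algebra_simps power_add power2_eq_square power3_eq_cube)
      then show ?thesis using 3 by (simp add: numeral_3_eq_3)
    qed
  qed
  have bd: "norm (\<alpha> ^ (2 * s) + \<beta> ^ (2 * s)) \<le> (7 * real ?p) * real ?p ^ s" if "s \<ge> 1" for s
  proof -
    have "S (2 * s) = - (\<alpha> ^ (2 * s) + \<beta> ^ (2 * s))" using S[of "2 * s - 1"] that by simp
    then show ?thesis using norm_S_even_le[OF that] by (metis norm_minus_cancel)
  qed
  have "norm \<alpha> \<le> sqrt (real ?p)"
    by (rule norm_le_of_power_sums_bounded[OF p, of \<alpha> \<beta> "7 * real ?p"]) (use pr bd in auto)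
  moreover have "norm \<beta> \<le> sqrt (real ?p)"
    by (rule norm_le_of_power_sums_bounded[OF p, of \<beta> \<alpha> "7 * real ?p"])
       (use pr bd in \<open>auto simp: mult.commute[of \<beta>] add.commute[of "\<beta> ^ _"]\<close>)
  ultimately show ?thesis
    unfolding sm norm_minus_cancel using norm_triangle_ineq[of \<alpha> \<beta>] by linarith
qed

end

lemma gf_1_eq: "(gf 1 :: 'a::{alg_closed_field, field_prime_char} set) = of_int ` {0..<int CHAR('a)}"
proof (rule sym, rule card_subset_eq)
  show "finite (gf 1 :: 'a set)" by (rule card_gf) simp
  have "of_nat n \<in> (gf 1 :: 'a set)" for n
    by (induction n) (auto intro: gf_closed[unfolded One_nat_def])
  then have "of_int k \<in> (gf 1 :: 'a set)" if "k \<ge> 0" for k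
    using that by (metis int_nat_eq nat_0_le of_int_of_nat_eq)
  then show "of_int ` {0..<int CHAR('a)} \<subseteq> (gf 1 :: 'a set)" by auto
  have "inj_on (of_int :: int \<Rightarrow> 'a) {0..<int CHAR('a)}"
    by (auto simp: inj_on_def of_int_eq_iff_cong_CHAR cong_def)
  then show "card (of_int ` {0..<int CHAR('a)} :: 'a set) = card (gf 1 :: 'a set)"
    using card_gf(2)[of 1, where 'a = 'a] by (simp add: card_image)
qed

lemma kloosterman_prime_le_CHAR:
  fixes a b :: int and ty :: "'a::{alg_closed_field, field_prime_char} itself"
  assumes "\<not> int CHAR('a) dvd a" "\<not> int CHAR('a) dvd b"
  shows "norm (kloosterman (int CHAR('a)) a b) \<le> 2 * sqrt (real CHAR('a))"
proof -
  define p where "p = int CHAR('a)"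
  have p: "p > 0" "prime p" unfolding p_def by auto
  \<comment> \<open>On the prime field any integer representative will do, as two of them agree
    modulo p. Elsewhere the value is arbitrary.\<close>
  define \<psi> :: "'a \<Rightarrow> complex" where "\<psi> x = ee p (SOME k. of_int k = x)" for x
  have psi: "\<psi> (of_int k) = ee p k" for k
  proof -
    have "of_int (SOME l. of_int l = (of_int k :: 'a)) = (of_int k :: 'a)" by (rule someI[of _ k]) simp
    then show ?thesis unfolding \<psi>_def p_def
      by (intro ee_cong) (auto simp: of_int_eq_iff_cong_CHAR)
  qed
  have gfE: "\<exists>k. x = of_int k" if "x \<in> gf 1" for x :: 'a using that unfolding gf_1_eq by blast
  have gfI: "of_int k \<in> (gf 1 :: 'a set)" for k
  proof -
    have "(of_int k :: 'a) = of_int (k mod p)" unfolding p_def by simp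
    then show ?thesis unfolding gf_1_eq using p by (intro image_eqI[of _ _ "k mod p"]) (auto simp: p_def)
  qed
  have nz: "(of_int k :: 'a) = 0 \<longleftrightarrow> p dvd k" for k
    using of_int_eq_iff_cong_CHAR[of k 0, where 'a = 'a] by (simp add: p_def cong_0_iff)
  interpret kloosterman_character \<psi> "of_int a" "of_int b"
  proof
    show "\<psi> (x + y) = \<psi> x * \<psi> y" if xy: "x \<in> gf 1" "y \<in> gf 1" for x y
    proof -
      obtain k l where "x = of_int k" "y = of_int l" using gfE[OF xy(1)] gfE[OF xy(2)] by blast
      then show ?thesis using psi[of "k + l"] by (simp add: psi ee_add)
    qed
    show "norm (\<psi> x) = 1" if "x \<in> gf 1" for x by (simp add: \<psi>_def)
    have "\<psi> (of_int 1) \<noteq> 1" unfolding psi using p by (auto simp: ee_eq_1_iff)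
    then show "\<exists>x\<in>gf 1. \<psi> x \<noteq> 1" using gfI by blast
  qed (use gfI nz assms in \<open>auto simp: p_def\<close>)
  have units: "units_mod p = {1..<p}" by (rule units_mod_prime[OF p(2)])
  have "S 1 = (\<Sum>x\<in>gf 1 - {0}. \<psi> (of_int a * x + of_int b / x))"
    by (simp add: S_def power_trace_def)
  also have "gf 1 - {0} = (of_int ` {1..<p} :: 'a set)"
    unfolding gf_1_eq p_def[symmetric]
  proof (intro equalityI subsetI)
    fix x :: 'a assume "x \<in> of_int ` {0..<p} - {0}"
    then obtain k where "x = of_int k" "k \<in> {0..<p}" "k \<noteq> 0" by fastforce
    then show "x \<in> of_int ` {1..<p}" by auto
  next
    fix x :: 'a assume "x \<in> of_int ` {1..<p}"
    then obtain k where "x = of_int k" "k \<in> {1..<p}" by auto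
    then show "x \<in> of_int ` {0..<p} - {0}" using nz[of k] zdvd_not_zless[of k p] by auto
  qed
  also have "(\<Sum>x\<in>of_int ` {1..<p}. \<psi> (of_int a * x + of_int b / x))
     = (\<Sum>k\<in>{1..<p}. \<psi> (of_int a * of_int k + of_int b / of_int k))"
    by (rule sum.reindex_cong[of of_int])
       (auto simp: inj_on_def of_int_eq_iff_cong_CHAR cong_def p_def)
  also have "\<dots> = kloosterman p a b"
    unfolding kloosterman_def units
  proof (intro sum.cong refl)
    fix k assume k1: "k \<in> {1..<p}"
    then have "k \<in> units_mod p" using units by blast
    then have k: "coprime k p" "\<not> p dvd k" using k1 zdvd_not_zless[of k p] by (simp_all add: units_mod_def)
    have "of_int (k * modular_inverse p k) = (of_int 1 :: 'a)"
      using cong_modular_inverse1[OF k(1)] unfolding of_int_eq_iff_cong_CHAR p_def .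
    then have "of_int b / of_int k = (of_int (b * modular_inverse p k) :: 'a)"
      using k nz[of k] by (simp add: field_simps)
    then show "\<psi> (of_int a * of_int k + of_int b / of_int k) = ee p (a * k + b * modular_inverse p k)"
      using psi[of "a * k + b * modular_inverse p k"] by simp
  qed
  finally show ?thesis using norm_S_1_le by (simp add: p_def)
qed

definition weil_bound_at :: "nat \<Rightarrow> bool" where
  "weil_bound_at p \<longleftrightarrow> (\<forall>a b. \<not> int p dvd a \<longrightarrow> \<not> int p dvd b \<longrightarrow>
     norm (kloosterman (int p) a b) \<le> 2 * sqrt (real p))"

text \<open>
  A type cannot depend on the variable \<open>p\<close>, but it may depend on a constant: choose a prime at which the
  bound fails, if there is one, and apply the bound over the algebraic closure of its prime field.
\<close>

definition exceptional_prime :: nat where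
  "exceptional_prime = (SOME p. prime p \<and> ((\<exists>p. prime p \<and> \<not> weil_bound_at p) \<longrightarrow> \<not> weil_bound_at p))"

lemma exceptional_prime:
  "prime exceptional_prime"
  "prime p \<Longrightarrow> \<not> weil_bound_at p \<Longrightarrow> \<not> weil_bound_at exceptional_prime"
proof -
  have "\<exists>p::nat. prime p \<and> ((\<exists>p. prime p \<and> \<not> weil_bound_at p) \<longrightarrow> \<not> weil_bound_at p)"
    using two_is_prime_nat by blast
  from someI_ex[OF this] show "prime exceptional_prime"
    "prime p \<Longrightarrow> \<not> weil_bound_at p \<Longrightarrow> \<not> weil_bound_at exceptional_prime"
    unfolding exceptional_prime_def[symmetric] by blast+
qed

typedef exceptional_index = "{0..<exceptional_prime}"
  using prime_gt_0_nat[OF exceptional_prime(1)] by auto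

lemma CARD_exceptional_index: "CARD(exceptional_index) = exceptional_prime"
  using type_definition.card[OF type_definition_exceptional_index] by simp

instance exceptional_index :: prime_card
  by standard (simp add: CARD_exceptional_index exceptional_prime)

instance alg_closure :: (field_prime_char) field_prime_char
  by (rule field_prime_charI') simp

theorem weil_bound:
  assumes "prime p" "\<not> p dvd a" "\<not> p dvd b"
  shows "norm (kloosterman p a b) \<le> 2 * sqrt (of_int p)"
proof -
  have "CHAR(exceptional_index mod_ring alg_closure) = exceptional_prime"
    by (simp add: CARD_exceptional_index)
  then have "weil_bound_at exceptional_prime"
    unfolding weil_bound_at_def
    using kloosterman_prime_le_CHAR[where 'a = "exceptional_index mod_ring alg_closure"] by metis
  moreover have "prime (nat p)" using assms(1) by simp
  ultimately have "weil_bound_at (nat p)" using exceptional_prime(2) by blast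
  moreover have "p > 0" using assms(1) by (simp add: prime_gt_0_int)
  ultimately show ?thesis using assms unfolding weil_bound_at_def by simp
qed

section \<open>Kloosterman sums to composite moduli\<close>

lemma modular_inverse_cong:
  fixes x y q :: int
  assumes "q > 0" "[x = y] (mod q)"
  shows "modular_inverse q x = modular_inverse q y"
proof (cases "coprime x q")
  case True
  then have y: "coprime y q" using assms(2) cong_imp_coprime by blast
  show ?thesis
  proof (rule modular_inverse_int_eqI)
    show "modular_inverse q y \<in> {0..<q}"
      using assms(1) by (simp add: modular_inverse_int_nonneg modular_inverse_int_less)
    have "[x * modular_inverse q y = y * modular_inverse q y] (mod q)"
      by (intro cong_mult assms cong_refl)
    then show "[x * modular_inverse q y = 1] (mod q)"
      using cong_modular_inverse1[OF y] cong_trans by blast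
  qed
next
  case False
  then have "\<not> coprime y q" using assms(2) cong_imp_coprime cong_sym by blast
  with False show ?thesis by (simp add: modular_inverse_def coprime_commute)
qed

lemma cong_modular_inverse_unique:
  fixes x y q :: int
  assumes "[x * y = 1] (mod q)"
  shows "[(modular_inverse q x) = y] (mod q)"
proof -
  have x: "coprime x q" using assms coprime_iff_invertible_int by blast
  have "[(modular_inverse q x) * (x * y) = modular_inverse q x * 1] (mod q)"
    by (intro cong_mult assms cong_refl)
  moreover have "[(modular_inverse q x) * x * y = 1 * y] (mod q)"
    by (intro cong_mult cong_modular_inverse2 x cong_refl)
  ultimately show ?thesis by (metis cong_sym cong_trans mult.assoc mult_1_left mult_1_right)
qed

lemma ee_kloosterman_cong:
  assumes "q > 0" "[x = y] (mod q)"
  shows "ee q (a * x + b * modular_inverse q x) = ee q (a * y + b * modular_inverse q y)"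
  using assms(1)
  by (rule ee_cong) (auto simp: modular_inverse_cong[OF assms] intro!: cong_add cong_mult assms(2))

lemma sum_residues_periodic:
  fixes f :: "int \<Rightarrow> 'b::comm_semiring_1"
  assumes "q > 0" and per: "\<And>x y. [x = y] (mod q) \<Longrightarrow> f x = f y"
  shows "(\<Sum>x\<in>{0..<int r * q}. f x) = of_nat r * (\<Sum>x\<in>{0..<q}. f x)"
proof (induction r)
  case (Suc r)
  have "0 \<le> int r * q" using assms(1) by simp
  moreover have "int (Suc r) * q = int r * q + q" by (simp add: algebra_simps)
  ultimately have "{0..<int (Suc r) * q} = {0..<int r * q} \<union> {int r * q..<int r * q + q}"
    using assms(1) ivl_disj_un_two(3)[of 0 "int r * q" "int r * q + q"] by simp
  then have "(\<Sum>x\<in>{0..<int (Suc r) * q}. f x)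
      = (\<Sum>x\<in>{0..<int r * q}. f x) + (\<Sum>x\<in>{int r * q..<int r * q + q}. f x)"
    by (simp add: sum.union_disjoint)
  also have "(\<Sum>x\<in>{int r * q..<int r * q + q}. f x) = (\<Sum>x\<in>{0..<q}. f x)"
    by (rule sum.reindex_bij_witness[of _ "\<lambda>x. x + int r * q" "\<lambda>x. x - int r * q"])
       (auto intro!: per simp: cong_iff_dvd_diff)
  also have "(\<Sum>x\<in>{0..<int r * q}. f x) + (\<Sum>x\<in>{0..<q}. f x) = of_nat (Suc r) * (\<Sum>x\<in>{0..<q}. f x)"
    unfolding Suc.IH by (simp add: algebra_simps)
  finally show ?case .
qed simp

lemma sum_units_eq:
  "(\<Sum>x\<in>units_mod q. f x) = (\<Sum>x\<in>{0..<q}. if coprime x q then f x else 0)"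
  unfolding units_mod_def by (rule sum.inter_filter) simp

lemma coprime_cong_iff: "[x = y] (mod q) \<Longrightarrow> coprime x q \<longleftrightarrow> coprime y q" for x y q :: int
  using cong_imp_coprime cong_sym by blast

text \<open>Once p^j is cancelled, the phase depends on x modulo p^k only; as k \<ge> 1, so does
  being prime to the modulus. Each class modulo p^k has p^j lifts.\<close>

lemma kloosterman_scale:
  fixes p :: int
  assumes p: "p > 1" and k: "k \<ge> 1"
  shows "kloosterman (p ^ (j + k)) (p ^ j * a) (p ^ j * b) = of_int (p ^ j) * kloosterman (p ^ k) a b"
proof -
  define q where "q = p ^ k"
  define f where "f x = ee q (a * x + b * modular_inverse q x)" for x
  have q: "q > 0" using p by (simp add: q_def)
  have Q: "p ^ (j + k) = p ^ j * q" by (simp add: q_def power_add)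
  have cop: "coprime x (p ^ (j + k)) \<longleftrightarrow> coprime x q" for x
    using k by (simp add: q_def)
  have "kloosterman (p ^ (j + k)) (p ^ j * a) (p ^ j * b) = (\<Sum>x\<in>units_mod (p ^ (j + k)). f x)"
    unfolding kloosterman_def
  proof (intro sum.cong refl)
    fix x assume "x \<in> units_mod (p ^ (j + k))"
    then have x: "coprime x (p ^ (j + k))" by (simp add: units_mod_def)
    let ?y = "modular_inverse (p ^ (j + k)) x"
    have "[x * ?y = 1] (mod q)" using cong_modular_inverse1[OF x] unfolding Q by (rule cong_dvd_modulus) simp
    then have "[(modular_inverse q x) = ?y] (mod q)" by (rule cong_modular_inverse_unique)
    then have "f x = ee q (a * x + b * ?y)" unfolding f_def by (intro ee_cong q cong_add cong_mult cong_refl)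
    also have "\<dots> = ee (p ^ j * q) (p ^ j * (a * x + b * ?y))" using p by (intro ee_scale[symmetric]) auto
    also have "p ^ j * (a * x + b * ?y) = p ^ j * a * x + p ^ j * b * ?y" by (simp add: algebra_simps)
    finally show "ee (p ^ (j + k)) (p ^ j * a * x + p ^ j * b * ?y) = f x" unfolding Q ..
  qed
  also have "\<dots> = (\<Sum>x\<in>{0..<int (nat (p ^ j)) * q}. if coprime x q then f x else 0)"
    unfolding sum_units_eq cop using p by (simp add: Q)
  also have "\<dots> = of_nat (nat (p ^ j)) * (\<Sum>x\<in>{0..<q}. if coprime x q then f x else 0)"
  proof (rule sum_residues_periodic[OF q])
    fix x y assume xy: "[x = y] (mod q)"
    show "(if coprime x q then f x else 0) = (if coprime y q then f y else 0)"
      unfolding f_def using coprime_cong_iff[OF xy] ee_kloosterman_cong[OF q xy] by simp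
  qed
  also have "\<dots> = of_int (p ^ j) * kloosterman q a b"
    unfolding kloosterman_def f_def sum_units_eq using p by simp
  finally show ?thesis by (simp add: q_def)
qed

text \<open>In |G|^2 the difference of the two phases is linear in the common variable u, with slope
  2sv. For odd p the factor 2s is a unit, so only v = 0 survives.\<close>

lemma norm_quadratic_gauss_sum_le:
  fixes p r s :: int
  assumes p: "prime p" "odd p" and s: "\<not> p dvd s"
  shows "norm (\<Sum>t\<in>{0..<p}. ee p (r * t + s * t\<^sup>2)) \<le> sqrt (of_int p)"
proof -
  have p0: "p > 0" using p by (simp add: prime_gt_0_int)
  define g where "g t = ee p (r * t + s * t\<^sup>2)" for t
  have gper: "g x = g y" if "[x = y] (mod p)" for x y
    unfolding g_def using that by (intro ee_cong p0 cong_add cong_mult cong_pow cong_refl) auto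
  define G where "G = (\<Sum>t\<in>{0..<p}. g t)"
  have "G * cnj G = (\<Sum>u\<in>{0..<p}. G * cnj (g u))"
    by (simp add: G_def sum_distrib_left)
  also have "\<dots> = (\<Sum>u\<in>{0..<p}. \<Sum>v\<in>{0..<p}. g (v + u) * cnj (g u))"
  proof (intro sum.cong refl)
    fix u
    have "G = (\<Sum>v\<in>{0..<p}. g (v + u))"
      unfolding G_def by (rule sum_residues_shift[OF p0 gper, symmetric])
    then show "G * cnj (g u) = (\<Sum>v\<in>{0..<p}. g (v + u) * cnj (g u))" by (simp add: sum_distrib_right)
  qed
  also have "\<dots> = (\<Sum>v\<in>{0..<p}. g v * (\<Sum>u\<in>{0..<p}. ee p (u * (2 * s * v))))"
  proof (subst sum.swap, intro sum.cong refl, unfold sum_distrib_left, intro sum.cong refl)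
    fix u v
    have "g (v + u) * cnj (g u) = ee p ((r * (v + u) + s * (v + u)\<^sup>2) + - (r * u + s * u\<^sup>2))"
      unfolding g_def ee_add ee_uminus ..
    also have "\<dots> = ee p ((r * v + s * v\<^sup>2) + u * (2 * s * v))"
      by (rule arg_cong[of _ _ "ee p"]) (simp add: power2_eq_square algebra_simps)
    finally show "g (v + u) * cnj (g u) = g v * ee p (u * (2 * s * v))" by (simp add: g_def ee_add)
  qed
  also have "\<dots> = (\<Sum>v\<in>{0..<p}. if v = 0 then of_int p else 0)"
  proof (intro sum.cong refl)
    fix v assume v: "v \<in> {0..<p}"
    have "p dvd 2 * s * v \<longleftrightarrow> v = 0"
    proof
      assume "p dvd 2 * s * v"
      moreover have "\<not> p dvd 2"
      proof
        assume "p dvd 2"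
        then have "p = 2" using zdvd_imp_le[of p 2] prime_ge_2_int[OF p(1)] by simp
        then show False using p(2) by simp
      qed
      ultimately have "p dvd v" using p s by (auto simp: prime_dvd_mult_iff)
      then show "v = 0" using v by (metis atLeastLessThan_iff order_le_less zdvd_not_zless)
    qed simp
    then show "g v * (\<Sum>u\<in>{0..<p}. ee p (u * (2 * s * v))) = (if v = 0 then of_int p else 0)"
      unfolding sum_ee[OF p0] by (simp add: g_def)
  qed
  also have "\<dots> = of_int p" using p0 by (simp add: sum.delta)
  finally have "norm G ^ 2 = of_int p"
    by (metis complex_norm_square of_real_eq_iff of_real_of_int_eq)
  then have "sqrt (norm G ^ 2) = sqrt (of_int p)" by (simp only:)
  then show ?thesis unfolding G_def g_def by simp
qed

section \<open>Stationary phase modulo proper prime powers\<close>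

context
  fixes p :: int and k m h :: nat and a b :: int
  assumes p: "prime p" and k: "k \<ge> 2" and m: "m = k div 2" and h: "h = k - m"
    and prim: "\<not> (p dvd a \<and> p dvd b)"
begin

text \<open>The critical points: under x \<mapsto> (1 + \<epsilon>) x the phase a x + b/x changes to
  first order by \<epsilon> (a x - b/x).\<close>

definition stationary :: "int set" where
  "stationary = {x \<in> units_mod (p ^ k). [a * x = b * modular_inverse (p ^ k) x] (mod p ^ m)}"

lemma exponents: "m \<ge> 1" "h \<ge> 1" "m \<le> h" "h \<le> m + 1" "m + h = k"
  using k unfolding m h by auto

lemma p_gt_1: "p > 1" using p by (simp add: prime_gt_1_int)

lemma modulus_pos: "p ^ k > 0" using p_gt_1 by simp

lemma coprime_one_plus: "i \<ge> 1 \<Longrightarrow> coprime (1 + p ^ i * t) (p ^ k)"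
proof -
  assume "i \<ge> 1"
  then have "[1 + p ^ i * t = 1] (mod p)" by (cases i) (auto simp: cong_iff_dvd_diff)
  then have "coprime (1 + p ^ i * t) p" using coprime_cong_iff coprime_1_left by blast
  then show ?thesis by simp
qed

lemma modular_inverse_mult_cong:
  assumes "coprime x (p ^ k)" "[u * v = 1] (mod p ^ k)"
  shows "[(modular_inverse (p ^ k) (u * x)) = v * modular_inverse (p ^ k) x] (mod p ^ k)"
proof (rule cong_modular_inverse_unique)
  have "[(u * v) * (x * modular_inverse (p ^ k) x) = 1 * 1] (mod p ^ k)"
    by (intro cong_mult assms(2) cong_modular_inverse1[OF assms(1)])
  then show "[u * x * (v * modular_inverse (p ^ k) x) = 1] (mod p ^ k)" by (simp add: mult_ac)
qed

text \<open>Average over the substitutions \<open>x \<mapsto> (1 + p\<^sup>h t) x\<close>, on which the phase is linear in \<open>t\<close>.\<close>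

lemma kloosterman_eq_stationary:
  "kloosterman (p ^ k) a b = (\<Sum>x\<in>stationary. ee (p ^ k) (a * x + b * modular_inverse (p ^ k) x))"
proof -
  define q where "q = p ^ k"
  have q: "q > 0" using modulus_pos by (simp add: q_def)
  define f where "f x = ee q (a * x + b * modular_inverse q x)" for x
  define w where "w x = a * x - b * modular_inverse q x" for x
  have pm: "p ^ m > 0" using p_gt_1 by simp
  have shift: "f ((1 + p ^ h * t) * x) = f x * ee (p ^ m) (t * w x)" if "x \<in> units_mod q" for x t
  proof -
    let ?u = "p ^ h * t" and ?y = "modular_inverse q x"
    have x: "coprime x (p ^ k)" using that by (simp add: units_mod_def q_def)
    \<comment> \<open>2h \<ge> k, so 1 - u inverts 1 + u modulo p^k.\<close>
    have "q dvd ?u * ?u"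
    proof -
      have "q dvd p ^ h * p ^ h" unfolding q_def power_add[symmetric]
        using exponents by (intro le_imp_power_dvd) auto
      then show ?thesis by (metis dvd_mult2 mult.assoc mult.left_commute)
    qed
    then have "[(1 + ?u) * (1 - ?u) = 1] (mod q)"
      by (simp add: cong_iff_dvd_diff algebra_simps)
    then have inv: "[(modular_inverse q ((1 + ?u) * x)) = (1 - ?u) * ?y] (mod q)"
      using modular_inverse_mult_cong[OF x] by (simp add: q_def)
    have "f ((1 + ?u) * x) = ee q (a * ((1 + ?u) * x) + b * ((1 - ?u) * ?y))"
      unfolding f_def by (intro ee_cong q cong_add cong_mult cong_refl inv)
    also have "a * ((1 + ?u) * x) + b * ((1 - ?u) * ?y) = (a * x + b * ?y) + p ^ h * (t * w x)"
      by (simp add: w_def algebra_simps)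
    also have "ee q \<dots> = f x * ee q (p ^ h * (t * w x))" by (simp add: ee_add f_def)
    also have "ee q (p ^ h * (t * w x)) = ee (p ^ m) (t * w x)"
      using ee_scale[of "p ^ h" "p ^ m" "t * w x"] p_gt_1 exponents(5)
      by (simp add: q_def power_add[symmetric] add.commute)
    finally show ?thesis .
  qed
  have fper: "f x = f y" if "[x = y] (mod q)" for x y
    unfolding f_def by (rule ee_kloosterman_cong[OF q that])
  have "of_int (p ^ m) * kloosterman q a b = (\<Sum>t\<in>{0..<p ^ m}. \<Sum>x\<in>units_mod q. f x)"
    using pm by (simp add: kloosterman_def f_def)
  also have "\<dots> = (\<Sum>t\<in>{0..<p ^ m}. \<Sum>x\<in>units_mod q. f ((1 + p ^ h * t) * x))"
    by (intro sum.cong refl sum_units_mult[OF q _ fper, symmetric])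
       (use coprime_one_plus[OF exponents(2)] in \<open>simp_all add: q_def\<close>)
  also have "\<dots> = (\<Sum>x\<in>units_mod q. f x * (\<Sum>t\<in>{0..<p ^ m}. ee (p ^ m) (t * w x)))"
    by (subst sum.swap) (simp add: shift sum_distrib_left)
  also have "\<dots> = (\<Sum>x\<in>units_mod q. if [a * x = b * modular_inverse q x] (mod p ^ m) then of_int (p ^ m) * f x else 0)"
    by (intro sum.cong refl) (simp add: sum_ee[OF pm] w_def cong_iff_dvd_diff)
  also have "\<dots> = (\<Sum>x\<in>stationary. of_int (p ^ m) * f x)"
    unfolding stationary_def q_def by (simp add: sum.inter_filter del: of_int_power)
  finally have "of_int (p ^ m) * kloosterman q a b = of_int (p ^ m) * (\<Sum>x\<in>stationary. f x)"
    by (simp add: sum_distrib_left)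
  then show ?thesis using p_gt_1 unfolding f_def q_def by simp
qed

definition solutions :: "int set" where
  "solutions = {y \<in> {0..<p ^ m}. coprime y p \<and> [a * y\<^sup>2 = b] (mod p ^ m)}"

lemma stationary_iff:
  assumes "x \<in> units_mod (p ^ k)"
  shows "x \<in> stationary \<longleftrightarrow> [a * x\<^sup>2 = b] (mod p ^ m)"
proof -
  let ?y = "modular_inverse (p ^ k) x"
  have x: "coprime x (p ^ k)" using assms by (simp add: units_mod_def)
  have dv: "p ^ m dvd p ^ k" using exponents by (intro le_imp_power_dvd) auto
  have xy: "[x * ?y = 1] (mod p ^ m)" using cong_modular_inverse1[OF x] dv by (rule cong_dvd_modulus)
  have xm: "coprime x (p ^ m)" using x dv coprime_divisors dvd_refl by blast
  have "[a * x = b * ?y] (mod p ^ m) \<longleftrightarrow> [x * (a * x) = x * (b * ?y)] (mod p ^ m)"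
    using cong_mult_lcancel[OF xm] by simp
  also have "x * (a * x) = a * x\<^sup>2" by (simp add: power2_eq_square)
  also have "[a * x\<^sup>2 = x * (b * ?y)] (mod p ^ m) \<longleftrightarrow> [a * x\<^sup>2 = b] (mod p ^ m)"
  proof -
    have "[b * (x * ?y) = b * 1] (mod p ^ m)" by (intro cong_mult cong_refl xy)
    then have "[x * (b * ?y) = b] (mod p ^ m)" by (simp add: mult_ac)
    then show ?thesis using cong_trans cong_sym by blast
  qed
  finally show ?thesis using assms by (simp add: stationary_def)
qed

text \<open>Membership depends on x modulo p^m only, and each class has p^h lifts modulo
  p^k.\<close>

lemma card_stationary: "real (card stationary) = of_int (p ^ h) * real (card solutions)"
proof -
  define F :: "int \<Rightarrow> real" where "F x = (if coprime x p \<and> [a * x\<^sup>2 = b] (mod p ^ m) then 1 else 0)" for x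
  have pm: "p ^ m > 0" using p_gt_1 by simp
  have U: "x \<in> units_mod (p ^ k) \<longleftrightarrow> x \<in> {0..<p ^ k} \<and> coprime x p" for x
    using k by (auto simp: units_mod_def)
  have "stationary \<subseteq> units_mod (p ^ k)" by (auto simp: stationary_def)
  then have "stationary = {x \<in> {0..<p ^ k}. coprime x p \<and> [a * x\<^sup>2 = b] (mod p ^ m)}"
    using stationary_iff U by blast
  then have "real (card stationary) = (\<Sum>x\<in>{0..<p ^ k}. F x)"
    unfolding F_def by (simp add: sum.inter_filter[symmetric])
  also have "p ^ k = int (nat (p ^ h)) * p ^ m"
    using p_gt_1 exponents(5) by (simp add: power_add[symmetric] add.commute)
  also have "(\<Sum>x\<in>{0..<int (nat (p ^ h)) * p ^ m}. F x) = of_nat (nat (p ^ h)) * (\<Sum>x\<in>{0..<p ^ m}. F x)"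
  proof (rule sum_residues_periodic[OF pm])
    fix x y assume xy: "[x = y] (mod p ^ m)"
    then have "[x = y] (mod p)" using exponents(1) by (intro cong_dvd_modulus[OF xy]) simp
    then have 1: "coprime x p \<longleftrightarrow> coprime y p" by (rule coprime_cong_iff)
    have "[a * x\<^sup>2 = a * y\<^sup>2] (mod p ^ m)" by (intro cong_mult cong_pow cong_refl xy)
    then have "[a * x\<^sup>2 = b] (mod p ^ m) \<longleftrightarrow> [a * y\<^sup>2 = b] (mod p ^ m)" using cong_trans cong_sym by blast
    with 1 show "F x = F y" by (simp add: F_def)
  qed
  also have "(\<Sum>x\<in>{0..<p ^ m}. F x) = real (card solutions)"
    unfolding F_def solutions_def by (simp add: sum.inter_filter[symmetric])
  finally show ?thesis using p_gt_1 by simp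
qed

lemma solutions_empty:
  assumes "p dvd a"
  shows "solutions = {}"
proof -
  have "\<not> [a * y\<^sup>2 = b] (mod p ^ m)" for y
  proof
    assume "[a * y\<^sup>2 = b] (mod p ^ m)"
    then have "[a * y\<^sup>2 = b] (mod p)" using exponents(1) by (rule_tac cong_dvd_modulus) auto
    then have "p dvd b" using assms cong_dvd_iff by (metis dvd_mult2)
    then show False using prim assms by blast
  qed
  then show ?thesis by (auto simp: solutions_def)
qed

lemma solutions_dvd:
  assumes "\<not> p dvd a" "y \<in> solutions" "z \<in> solutions"
  shows "p ^ m dvd (y - z) * (y + z)"
proof -
  have "[a * y\<^sup>2 = a * z\<^sup>2] (mod p ^ m)" using assms by (auto simp: solutions_def intro: cong_trans cong_sym)
  moreover have "coprime a (p ^ m)" using assms(1) p prime_imp_coprime coprime_commute by (metis coprime_power_right_iff)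
  ultimately have "[y\<^sup>2 = z\<^sup>2] (mod p ^ m)" using cong_mult_lcancel by blast
  then show ?thesis by (simp add: cong_iff_dvd_diff power2_eq_square algebra_simps)
qed

text \<open>Fix a solution z. As (y - z) + (y + z) = 2y is prime to p, one factor of (y - z)(y + z)
  is prime to p, and p^m divides the other.\<close>

lemma card_solutions_odd:
  assumes "odd p"
  shows "card solutions \<le> 2"
proof (cases "p dvd a \<or> solutions = {}")
  case True
  then show ?thesis using solutions_empty by auto
next
  case False
  then obtain z where z: "z \<in> solutions" and a: "\<not> p dvd a" by auto
  have "solutions \<subseteq> {z, (- z) mod p ^ m}"
  proof
    fix y assume y: "y \<in> solutions"
    have dv: "p ^ m dvd (y - z) * (y + z)" by (rule solutions_dvd[OF a y z])
    have "\<not> (p dvd y - z \<and> p dvd y + z)"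
    proof
      assume "p dvd y - z \<and> p dvd y + z"
      then have "p dvd (y - z) + (y + z)" by (intro dvd_add[of p "y - z" "y + z"]) auto
      moreover have "(y - z) + (y + z) = 2 * y" by simp
      ultimately have "p dvd 2 * y" by (simp only:)
      moreover have "coprime y p" using y by (simp add: solutions_def)
      then have "\<not> p dvd y" using p by (metis coprime_absorb_right not_prime_unit)
      ultimately have "p dvd 2" using p prime_dvd_multD by blast
      then have "p = 2" using p p_gt_1 zdvd_imp_le[of p 2] by simp
      then show False using assms by simp
    qed
    then have "coprime (y - z) (p ^ m) \<or> coprime (y + z) (p ^ m)"
      using p by (metis coprime_commute coprime_power_right_iff prime_imp_coprime)
    then have "p ^ m dvd y - z \<or> p ^ m dvd y - (- z)"
      using dv by (metis coprime_commute coprime_dvd_mult_left_iff coprime_dvd_mult_right_iff diff_minus_eq_add)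
    then have "y mod p ^ m = z mod p ^ m \<or> y mod p ^ m = (- z) mod p ^ m"
      by (simp add: mod_eq_dvd_iff)
    then show "y \<in> {z, (- z) mod p ^ m}" using y z by (auto simp: solutions_def)
  qed
  then have "card solutions \<le> card {z, (- z) mod p ^ m}" by (intro card_mono) auto
  also have "\<dots> \<le> 2" by (simp add: card_insert_if)
  finally show ?thesis .
qed

text \<open>Now y - z = 2u and y + z = 2(u + z) are both even, but z is odd, so one of u and u + z
  is odd. This determines y up to sign only modulo r = 2^(m-1), and each sign has two lifts modulo
  2^m.\<close>

lemma card_solutions_even:
  assumes "p = 2"
  shows "card solutions \<le> 4"
proof (cases "p dvd a \<or> solutions = {}")
  case True
  then show ?thesis using solutions_empty by auto
next
  case False
  then obtain z where z: "z \<in> solutions" and a: "\<not> p dvd a" by auto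
  define r where "r = (2::int) ^ (m - 1)"
  have pm: "p ^ m = 2 * r" using exponents(1) assms by (simp add: r_def flip: power_Suc)
  define W where "W = (\<lambda>c. c mod p ^ m) ` {z, z + r, - z, - z + r}"
  have "solutions \<subseteq> W"
  proof
    fix y assume y: "y \<in> solutions"
    have dv: "2 * r dvd (y - z) * (y + z)" using solutions_dvd[OF a y z] pm by simp
    have "coprime y p" "coprime z p" using y z by (simp_all add: solutions_def)
    then have odd: "odd y" "odd z" using assms by simp_all
    have "even (y - z)" using odd by simp
    then obtain u where u: "y - z = 2 * u" by (rule evenE)
    have v: "y + z = 2 * (u + z)" using u by simp
    have "coprime u r \<or> coprime (u + z) r"
      using odd unfolding r_def by (cases "even u") auto
    moreover have "r dvd 2 * (u * (u + z))"
    proof -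
      have "2 * r dvd 2 * (2 * (u * (u + z)))" using dv unfolding v unfolding u by (simp add: mult_ac)
      then show ?thesis unfolding dvd_mult_cancel_left by simp
    qed
    then have "r dvd (y - z) * (u + z)" "r dvd u * (y + z)" unfolding v unfolding u by (simp_all add: mult_ac)
    ultimately have "r dvd y - z \<or> r dvd y - (- z)"
      by (metis coprime_commute coprime_dvd_mult_left_iff coprime_dvd_mult_right_iff diff_minus_eq_add)
    then obtain c where c: "c = z \<or> c = - z" "r dvd y - c" by blast
    then obtain j where j: "y = c + r * j" by (metis dvdE diff_add_cancel add.commute)
    have "y mod p ^ m = c mod p ^ m \<or> y mod p ^ m = (c + r) mod p ^ m"
    proof (cases "even j")
      case True
      then obtain i where "j = 2 * i" by blast
      then have "y = c + (2 * r) * i" unfolding j by (simp add: algebra_simps)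
      then show ?thesis unfolding pm by simp
    next
      case False
      then obtain i where "j = 2 * i + 1" using oddE by blast
      then have "y = c + r + (2 * r) * i" unfolding j by (simp add: algebra_simps)
      then show ?thesis unfolding pm by simp
    qed
    moreover have "y mod p ^ m = y" using y by (simp add: solutions_def)
    ultimately show "y \<in> W" using c(1) unfolding W_def by auto
  qed
  then have "card solutions \<le> card W" by (intro card_mono) (auto simp: W_def)
  also have "\<dots> \<le> card {z, z + r, - z, - z + r}" unfolding W_def by (intro card_image_le) simp
  also have "\<dots> \<le> 4" by (simp add: card_insert_if)
  finally show ?thesis .
qed

lemma norm_kloosterman_le_stationary: "norm (kloosterman (p ^ k) a b) \<le> of_int (p ^ h) * real (card solutions)"
proof -
  have "norm (kloosterman (p ^ k) a b) \<le> (\<Sum>x\<in>stationary. 1)"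
    unfolding kloosterman_eq_stationary by (rule sum_norm_le) simp
  also have "\<dots> = of_int (p ^ h) * real (card solutions)" using card_stationary by simp
  finally show ?thesis .
qed

text \<open>
  For odd \<open>k\<close> the substitutions \<open>x \<mapsto> (1 + p\<^sup>m t) x\<close> preserve the stationary set and make the phase
  quadratic in \<open>t\<close>; the resulting Gauss sum recovers the missing factor \<open>\<surd>p\<close>.
\<close>

lemma norm_kloosterman_le_gauss:
  assumes odd: "odd p" and k2: "k = 2 * m + 1"
  shows "of_int p * norm (kloosterman (p ^ k) a b) \<le> of_int (p ^ h) * real (card solutions) * sqrt (of_int p)"
proof -
  define q where "q = p ^ k"
  have q: "q > 0" using modulus_pos by (simp add: q_def)
  have p0: "p > 0" using p_gt_1 by simp
  define f where "f x = ee q (a * x + b * modular_inverse q x)" for x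
  define w where "w x = (a * x - b * modular_inverse q x) div p ^ m" for x
  \<comment> \<open>The stationary condition is made part of a function on residues, so that the
    substitution can be carried out in a sum over all units.\<close>
  define F where "F x = (if [a * x = b * modular_inverse q x] (mod p ^ m) then f x else 0)" for x
  have w: "a * x - b * modular_inverse q x = p ^ m * w x" if "x \<in> stationary" for x
    using that unfolding stationary_def w_def q_def by (simp add: cong_iff_dvd_diff)
  have Fper: "F x = F y" if "[x = y] (mod q)" for x y
  proof -
    have "[x = y] (mod p ^ m)" using that exponents unfolding q_def
      by (rule_tac cong_dvd_modulus) (auto intro!: le_imp_power_dvd)
    then have "[a * x = a * y] (mod p ^ m)" by (intro cong_mult cong_refl)
    then have "[a * x = c] (mod p ^ m) \<longleftrightarrow> [a * y = c] (mod p ^ m)" for c using cong_trans cong_sym by blast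
    then show ?thesis unfolding F_def f_def
      using ee_kloosterman_cong[OF q that] modular_inverse_cong[OF q that] by simp
  qed
  have ee_p: "ee q (p ^ m * p ^ m * v) = ee p v" for v
  proof -
    have "q = p ^ m * p ^ m * p" unfolding q_def k2 by (simp add: power_add mult_2)
    then show ?thesis using ee_scale[of "p ^ m * p ^ m" p v] p0 by simp
  qed
  have sumF: "(\<Sum>x\<in>units_mod q. F x) = kloosterman q a b"
    unfolding q_def kloosterman_eq_stationary unfolding stationary_def F_def f_def q_def
    by (simp add: sum.inter_filter)
  have shift: "F ((1 + p ^ m * t) * x)
      = (if x \<in> stationary then f x * ee p (w x * t + b * modular_inverse q x * t\<^sup>2) else 0)"
    if xu: "x \<in> units_mod q" for x t
  proof -
    let ?u = "p ^ m * t" and ?y = "modular_inverse q x"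
    let ?z = "modular_inverse q ((1 + ?u) * x)"
    have x: "coprime x (p ^ k)" using xu by (simp add: units_mod_def q_def)
    \<comment> \<open>3m \<ge> 2m + 1 = k, so the geometric series for the inverse of 1 + u stops at
      the square.\<close>
    have "q dvd ?u ^ 3"
    proof -
      have "q dvd p ^ (m * 3)" unfolding q_def using exponents(1) k2 by (intro le_imp_power_dvd) auto
      then show ?thesis unfolding power_mult_distrib power_mult[symmetric] by simp
    qed
    moreover have "(1 + ?u) * (1 - ?u + ?u\<^sup>2) - 1 = ?u ^ 3"
      by (simp add: power2_eq_square power3_eq_cube algebra_simps)
    ultimately have "[(1 + ?u) * (1 - ?u + ?u\<^sup>2) = 1] (mod q)"
      by (simp add: cong_iff_dvd_diff)
    then have inv: "[?z = (1 - ?u + ?u\<^sup>2) * ?y] (mod q)"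
      using modular_inverse_mult_cong[OF x] by (simp add: q_def)
    have invm: "[?z = ?y] (mod p ^ m)"
    proof -
      have "[?z = (1 - ?u + ?u\<^sup>2) * ?y] (mod p ^ m)"
        using inv exponents unfolding q_def by (rule_tac cong_dvd_modulus) (auto intro!: le_imp_power_dvd)
      moreover have "[(1 - ?u + ?u\<^sup>2) * ?y = 1 * ?y] (mod p ^ m)"
        by (intro cong_mult cong_refl) (simp add: cong_iff_dvd_diff power2_eq_square)
      ultimately show ?thesis using cong_trans by fastforce
    qed
    have "[a * ((1 + ?u) * x) = a * (1 * x)] (mod p ^ m)"
      by (intro cong_mult cong_refl) (simp add: cong_iff_dvd_diff)
    moreover have "[b * ?z = b * ?y] (mod p ^ m)" by (intro cong_mult cong_refl invm)
    ultimately have cond: "[a * ((1 + ?u) * x) = b * ?z] (mod p ^ m) \<longleftrightarrow> x \<in> stationary"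
      using xu unfolding stationary_def q_def by (auto intro: cong_trans cong_sym)
    show ?thesis
    proof (cases "x \<in> stationary")
      case True
      have "f ((1 + ?u) * x) = ee q (a * ((1 + ?u) * x) + b * ((1 - ?u + ?u\<^sup>2) * ?y))"
        unfolding f_def by (intro ee_cong q cong_add cong_mult cong_refl inv)
      also have "a * ((1 + ?u) * x) + b * ((1 - ?u + ?u\<^sup>2) * ?y)
          = (a * x + b * ?y) + p ^ m * t * (a * x - b * ?y) + p ^ m * p ^ m * (b * ?y * t\<^sup>2)"
        by (simp add: power2_eq_square algebra_simps)
      also have "\<dots> = (a * x + b * ?y) + p ^ m * p ^ m * (w x * t + b * ?y * t\<^sup>2)"
        unfolding w[OF True] by (simp add: algebra_simps)
      also have "ee q \<dots> = f x * ee q (p ^ m * p ^ m * (w x * t + b * ?y * t\<^sup>2))"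
        by (simp add: ee_add f_def)
      also have "ee q (p ^ m * p ^ m * (w x * t + b * ?y * t\<^sup>2)) = ee p (w x * t + b * ?y * t\<^sup>2)"
        by (rule ee_p)
      finally show ?thesis using True cond by (simp add: F_def q_def)
    qed (simp add: F_def cond)
  qed
  have "of_int p * kloosterman q a b = (\<Sum>t\<in>{0..<p}. \<Sum>x\<in>units_mod q. F x)"
    using p0 by (simp add: sumF)
  also have "\<dots> = (\<Sum>t\<in>{0..<p}. \<Sum>x\<in>units_mod q. F ((1 + p ^ m * t) * x))"
    by (intro sum.cong refl sum_units_mult[OF q _ Fper, symmetric])
       (use coprime_one_plus[OF exponents(1)] in \<open>simp_all add: q_def\<close>)
  also have "\<dots> = (\<Sum>x\<in>units_mod q. if x \<in> stationary then
      f x * (\<Sum>t\<in>{0..<p}. ee p (w x * t + b * modular_inverse q x * t\<^sup>2)) else 0)"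
    by (subst sum.swap, intro sum.cong refl) (simp add: shift sum_distrib_left)
  also have "\<dots> = (\<Sum>x\<in>{x \<in> units_mod q. x \<in> stationary}. f x * (\<Sum>t\<in>{0..<p}. ee p (w x * t + b * modular_inverse q x * t\<^sup>2)))"
    by (rule sum.inter_filter[symmetric]) simp
  also have "{x \<in> units_mod q. x \<in> stationary} = stationary" by (auto simp: stationary_def q_def)
  finally have eq: "of_int p * kloosterman q a b
      = (\<Sum>x\<in>stationary. f x * (\<Sum>t\<in>{0..<p}. ee p (w x * t + b * modular_inverse q x * t\<^sup>2)))" .
  have "of_int p * norm (kloosterman q a b) = norm (of_int p * kloosterman q a b)"
    using p0 by (simp add: norm_mult)
  also have "\<dots> \<le> (\<Sum>x\<in>stationary. sqrt (of_int p))"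
    unfolding eq
  proof (rule sum_norm_le)
    fix x assume xs: "x \<in> stationary"
    then have xu: "x \<in> units_mod (p ^ k)" by (simp add: stationary_def)
    then have xc: "coprime x (p ^ k)" by (simp add: units_mod_def)
    \<comment> \<open>At a stationary point p | b would give p | a. Hence the quadratic coefficient
      of the Gauss sum is a unit.\<close>
    have nb: "\<not> p dvd b"
    proof
      assume b: "p dvd b"
      have "[a * x\<^sup>2 = b] (mod p ^ m)" using stationary_iff[OF xu] xs by simp
      then have "[a * x\<^sup>2 = b] (mod p)" using exponents(1) by (rule_tac cong_dvd_modulus) auto
      then have "p dvd a * x\<^sup>2" using b cong_dvd_iff by blast
      moreover have "\<not> p dvd x" using xc k p by (metis coprime_absorb_right coprime_power_right_iff not_prime_unit not_numeral_le_zero)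
      ultimately have "p dvd a" using p by (metis prime_dvd_multD prime_dvd_power)
      then show False using b prim by blast
    qed
    have "\<not> p dvd b * modular_inverse q x"
    proof
      assume "p dvd b * modular_inverse q x"
      then have "p dvd modular_inverse q x" using nb p prime_dvd_multD by blast
      moreover have "coprime (modular_inverse q x) (p ^ k)" 
        using coprime_modular_inverse[OF xc] by (simp only: q_def)
      ultimately show False using k p by (metis coprime_absorb_right coprime_power_right_iff not_prime_unit not_numeral_le_zero)
    qed
    then show "norm (f x * (\<Sum>t\<in>{0..<p}. ee p (w x * t + b * modular_inverse q x * t\<^sup>2))) \<le> sqrt (of_int p)"
      using norm_quadratic_gauss_sum_le[OF p odd] by (simp add: norm_mult f_def)
  qed
  also have "\<dots> = of_int (p ^ h) * real (card solutions) * sqrt (of_int p)"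
    using card_stationary by simp
  finally show ?thesis by (simp add: q_def)
qed

text \<open>For odd p there are at most two solutions, and p^(2h) = p^k when k is even; when k is
  odd the Gauss sum pays for the extra factor p. For p = 2 there is no such saving: four solutions
  and 2h \<le> k + 1 give 16 times 2.\<close>

lemma norm_kloosterman_prime_power_sq_le:
  "norm (kloosterman (p ^ k) a b) ^ 2 \<le> (if even p then 32 else 4) * of_int (p ^ k)"
proof (cases "even p")
  case True
  then have p2: "p = 2" using p by (metis primes_dvd_imp_eq two_is_prime_nat prime_int_numeral_eq)
  have c: "real (card solutions) \<le> 4" using card_solutions_even[OF p2] by linarith
  have ph: "(0::real) < of_int (p ^ h)" using p_gt_1 by simp
  have "norm (kloosterman (p ^ k) a b) \<le> of_int (p ^ h) * 4"
    using norm_kloosterman_le_stationary mult_left_mono[OF c less_imp_le[OF ph]] by linarith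
  then have "norm (kloosterman (p ^ k) a b) ^ 2 \<le> (of_int (p ^ h) * 4) ^ 2" by (intro power_mono) auto
  also have "\<dots> = 16 * of_int (p ^ (2 * h))" by (simp add: power_mult_distrib mult.commute[of 2] power_mult)
  also have "\<dots> \<le> 16 * of_int (p ^ (k + 1))"
    using exponents p_gt_1 by (intro mult_left_mono of_int_le_iff[THEN iffD2] power_increasing) auto
  also have "\<dots> = 32 * of_int (p ^ k)" by (simp add: p2)
  finally show ?thesis using True by simp
next
  case False
  have c: "real (card solutions) \<le> 2" using card_solutions_odd[OF False] by linarith
  have ph: "(0::real) < of_int (p ^ h)" using p_gt_1 by simp
  have "norm (kloosterman (p ^ k) a b) ^ 2 \<le> 4 * of_int (p ^ k)"
  proof (cases "even k")
    case True
    then have hk: "h * 2 = k" unfolding h m by auto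
    have "norm (kloosterman (p ^ k) a b) \<le> of_int (p ^ h) * 2"
      using norm_kloosterman_le_stationary mult_left_mono[OF c less_imp_le[OF ph]] by linarith
    then have "norm (kloosterman (p ^ k) a b) ^ 2 \<le> (of_int (p ^ h) * 2) ^ 2" by (intro power_mono) auto
    also have "\<dots> = 4 * of_int (p ^ (h * 2))" by (simp add: power_mult_distrib power_mult)
    finally show ?thesis unfolding hk .
  next
    case False
    then have k2: "k = 2 * m + 1" unfolding m by presburger
    then have hm: "h * 2 = k + 1" unfolding h by simp
    have "of_int p * norm (kloosterman (p ^ k) a b) \<le> of_int (p ^ h) * 2 * sqrt (of_int p)"
    proof -
      have "of_int (p ^ h) * real (card solutions) * sqrt (of_int p) \<le> of_int (p ^ h) * 2 * sqrt (of_int p)"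
        using c ph p_gt_1 by (intro mult_right_mono mult_left_mono) auto
      then show ?thesis using norm_kloosterman_le_gauss[OF \<open>odd p\<close> k2] by linarith
    qed
    then have "(of_int p * norm (kloosterman (p ^ k) a b)) ^ 2 \<le> (of_int (p ^ h) * 2 * sqrt (of_int p)) ^ 2"
      using p_gt_1 by (intro power_mono) auto
    also have "\<dots> = 4 * of_int (p ^ (h * 2)) * of_int p"
      using p_gt_1 by (simp add: power_mult_distrib power_mult)
    also have "\<dots> = (of_int p) ^ 2 * (4 * of_int (p ^ k))" unfolding hm by (simp add: power2_eq_square)
    finally show ?thesis using p_gt_1 unfolding power_mult_distrib by (simp add: mult_le_cancel_left)
  qed
  then show ?thesis using False by simp
qed

end

section \<open>From primitive prime powers to all moduli\<close>

lemma kloosterman_swap: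
  assumes "q > 0"
  shows "kloosterman q a b = kloosterman q b a"
  unfolding kloosterman_def
proof (rule sum.reindex_bij_witness[of _ "modular_inverse q" "modular_inverse q"])
  fix x assume "x \<in> units_mod q"
  then have x: "coprime x q" "x \<in> {0..<q}" by (auto simp: units_mod_def)
  show inv: "modular_inverse q (modular_inverse q x) = x"
    using x by (intro modular_inverse_int_eqI cong_modular_inverse2)
  then show "modular_inverse q (modular_inverse q x) = x" .
  show "modular_inverse q x \<in> units_mod q"
    using x assms by (simp add: units_mod_def modular_inverse_int_nonneg modular_inverse_int_less)
  then show "modular_inverse q x \<in> units_mod q" .
  show "ee q (b * modular_inverse q x + a * modular_inverse q (modular_inverse q x))
      = ee q (a * x + b * modular_inverse q x)"
    by (simp add: inv add.commute)
qed

lemma kloosterman_prime_degenerate: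
  assumes p: "prime p" and "p dvd b" "\<not> p dvd a"
  shows "kloosterman p a b = - 1"
proof -
  have p0: "p > 0" using p by (simp add: prime_gt_0_int)
  have "kloosterman p a b = (\<Sum>x\<in>{1..<p}. ee p (x * a))"
    unfolding kloosterman_def units_mod_prime[OF p]
  proof (intro sum.cong refl ee_cong[OF p0])
    fix x
    show "[a * x + b * modular_inverse p x = x * a] (mod p)"
      using \<open>p dvd b\<close> by (simp add: cong_iff_dvd_diff mult.commute)
  qed
  moreover have "{0..<p} = insert 0 {1..<p}" using p0 by auto
  ultimately show ?thesis using sum_ee[OF p0, of a] assms(3) by (simp add: add_eq_0_iff)
qed

lemma norm_kloosterman_trivial: "q > 0 \<Longrightarrow> norm (kloosterman q a b) \<le> of_int q"
proof -
  assume q: "q > 0"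
  have "norm (kloosterman q a b) \<le> (\<Sum>x\<in>units_mod q. 1)"
    unfolding kloosterman_def by (rule sum_norm_le) simp
  also have "\<dots> \<le> (\<Sum>x\<in>{0..<q}. 1)" by (rule sum_mono2) (auto simp: units_mod_def)
  also have "\<dots> = of_int q" using q by simp
  finally show ?thesis .
qed

text \<open>The factor \<open>4\<close> at \<open>p = 2\<close> pays for the four square roots modulo powers of \<open>2\<close>.\<close>

lemma norm_kloosterman_primitive:
  assumes p: "prime p" and k: "k \<ge> 1" and prim: "\<not> (p dvd a \<and> p dvd b)"
  shows "norm (kloosterman (p ^ k) a b) ^ 2 \<le> (if even p then 4 else 1) * (real k + 1) ^ 2 * of_int (p ^ k)"
proof (cases "k = 1")
  case True
  have p1: "real_of_int p \<ge> 1" using p prime_gt_0_int[of p] by simp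
  have "norm (kloosterman p a b) \<le> 2 * sqrt (of_int p)"
  proof (cases "p dvd a \<or> p dvd b")
    case True
    then have "kloosterman p a b = - 1"
      using prim kloosterman_prime_degenerate[OF p, of b a] kloosterman_prime_degenerate[OF p, of a b]
        kloosterman_swap[of p a b] p by (auto simp: prime_gt_0_int)
    then have "norm (kloosterman p a b) = 1" by simp
    moreover have "1 \<le> sqrt (of_int p)" using p1 by simp
    ultimately show ?thesis by linarith
  next
    case False
    then show ?thesis using weil_bound[OF p] by blast
  qed
  then have "norm (kloosterman p a b) ^ 2 \<le> (2 * sqrt (of_int p)) ^ 2" by (intro power_mono) auto
  also have "\<dots> = 4 * of_int p" using p1 by (simp add: power_mult_distrib)
  finally have "norm (kloosterman p a b) ^ 2 \<le> 4 * of_int p" .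
  then show ?thesis using True p1 by auto
next
  case False
  then have k2: "k \<ge> 2" using k by simp
  have pk: "real_of_int (p ^ k) \<ge> 0" using p prime_gt_0_int[of p] by simp
  \<comment> \<open>For k \<ge> 2 the square is at least 9, which covers the constant 4 for odd p
    and, with the factor 4, the constant 32 for p = 2. At k = 1 it equals 4, exactly the square of
    Weil's constant.\<close>
  have "(2 + 1) ^ 2 \<le> (real k + 1) ^ 2" using k2 by (intro power_mono) auto
  then have "(if even p then 32 else 4) \<le> (if even p then 4 else 1) * (real k + 1) ^ 2" by auto
  then have "(if even p then 32 else 4) * of_int (p ^ k) \<le> (if even p then 4 else 1) * (real k + 1) ^ 2 * of_int (p ^ k)"
    using pk by (rule mult_right_mono)
  then show ?thesis
    using norm_kloosterman_prime_power_sq_le[OF p k2 refl refl prim] by linarith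
qed

text \<open>If the gcd is p^j with j < k, scaling out p^j gives p^(2j) p^(k-j) = p^k p^j, so the gcd
  enters to the first power. For j = k the trivial bound has the same form.\<close>

lemma norm_kloosterman_prime_power:
  assumes p: "prime p"
  shows "norm (kloosterman (p ^ k) a b) ^ 2
    \<le> (if even p then 4 else 1) * (real k + 1) ^ 2 * of_int (p ^ k) * of_int (gcd (gcd a b) (p ^ k))"
proof -
  define g where "g = gcd (gcd a b) (p ^ k)"
  have p0: "p > 0" using p by (simp add: prime_gt_0_int)
  have "g dvd p ^ k" by (simp add: g_def)
  then obtain j where j: "j \<le> k" "normalize g = normalize (p ^ j)"
    using divides_primepow_weak[OF p] by blast
  then have gj: "g = p ^ j" using p0 by (simp add: g_def)
  have C: "1 \<le> (if even p then 4 else (1::real)) * (real k + 1) ^ 2"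
  proof -
    have "1 * 1 \<le> (if even p then 4 else (1::real)) * (real k + 1) ^ 2" by (intro mult_mono) auto
    then show ?thesis by (simp only: mult_1)
  qed
  show ?thesis
  proof (cases "j = k")
    case True
    have "norm (kloosterman (p ^ k) a b) ^ 2 \<le> of_int (p ^ k) ^ 2"
      using norm_kloosterman_trivial[of "p ^ k" a b] p0 by (intro power_mono) auto
    also have "\<dots> = 1 * (of_int (p ^ k) * of_int g)" using gj True by (simp add: power2_eq_square)
    also have "\<dots> \<le> ((if even p then 4 else 1) * (real k + 1) ^ 2) * (of_int (p ^ k) * of_int g)"
      by (rule mult_right_mono[OF C]) (use p0 gj in simp)
    finally show ?thesis by (simp add: g_def mult.assoc)
  next
    case False
    define l where "l = k - j"
    have l: "l \<ge> 1" "k = j + l" using j(1) False by (auto simp: l_def)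
    have "p ^ j dvd a" "p ^ j dvd b" unfolding gj[symmetric] g_def by (meson dvd_trans gcd_dvd1 gcd_dvd2)+
    then obtain a' b' where ab: "a = p ^ j * a'" "b = p ^ j * b'" by (auto simp: dvd_def)
    have prim: "\<not> (p dvd a' \<and> p dvd b')"
    proof
      assume "p dvd a' \<and> p dvd b'"
      then have "p ^ (j + 1) dvd a" "p ^ (j + 1) dvd b" unfolding ab by auto
      moreover have "p ^ (j + 1) dvd p ^ k" using l by (intro le_imp_power_dvd) auto
      ultimately have "p ^ (j + 1) dvd g" unfolding g_def by simp
      then have "p ^ (j + 1) dvd p ^ j" by (simp only: gj)
      then have "p ^ (j + 1) \<le> p ^ j" using p0 by (intro zdvd_imp_le) auto
      then show False using prime_gt_1_int[OF p] by simp
    qed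
    have "kloosterman (p ^ k) a b = of_int (p ^ j) * kloosterman (p ^ l) a' b'"
      unfolding ab l(2) by (rule kloosterman_scale[OF prime_gt_1_int[OF p] l(1)])
    then have "norm (kloosterman (p ^ k) a b) ^ 2 = of_int (p ^ j) ^ 2 * norm (kloosterman (p ^ l) a' b') ^ 2"
      using p0 by (simp add: norm_mult norm_power power_mult_distrib)
    also have "\<dots> \<le> of_int (p ^ j) ^ 2 * ((if even p then 4 else 1) * (real l + 1) ^ 2 * of_int (p ^ l))"
      by (intro mult_left_mono norm_kloosterman_primitive[OF p l(1) prim]) auto
    also have "\<dots> \<le> of_int (p ^ j) ^ 2 * ((if even p then 4 else 1) * (real k + 1) ^ 2 * of_int (p ^ l))"
      using l p0 by (intro mult_left_mono mult_right_mono power_mono) auto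
    also have "\<dots> = (if even p then 4 else 1) * (real k + 1) ^ 2 * of_int (p ^ k) * of_int g"
      unfolding gj l(2) by (simp add: power_add power2_eq_square)
    finally show ?thesis by (simp add: g_def)
  qed
qed

text \<open>Twisted multiplicativity: q2 u2 + q1 u1 = 1 modulo q1 q2 splits every additive
  character, and the Chinese remainder theorem splits the units.\<close>

lemma kloosterman_mult:
  assumes q1: "q1 > 0" and q2: "q2 > 0" and cop: "coprime q1 q2"
  defines "u1 \<equiv> modular_inverse q2 q1" and "u2 \<equiv> modular_inverse q1 q2"
  shows "kloosterman (q1 * q2) a b = kloosterman q1 (u2 * a) (u2 * b) * kloosterman q2 (u1 * a) (u1 * b)"
proof -
  define q where "q = q1 * q2"
  have q: "q > 0" using q1 q2 by (simp add: q_def)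
  have d1: "q1 dvd q" and d2: "q2 dvd q" by (simp_all add: q_def)
  have u1: "[q1 * u1 = 1] (mod q2)" unfolding u1_def using cop by (rule cong_modular_inverse1)
  have u2: "[q2 * u2 = 1] (mod q1)" unfolding u2_def using cop by (intro cong_modular_inverse1) (simp add: coprime_commute)
  have split: "ee q k = ee q1 (u2 * k) * ee q2 (u1 * k)" for k
  proof -
    have "[q2 * u2 + q1 * u1 = 1 + 0] (mod q1)" by (intro cong_add u2) (simp add: cong_0_iff)
    moreover have "[q2 * u2 + q1 * u1 = 0 + 1] (mod q2)" by (intro cong_add u1) (simp add: cong_0_iff)
    ultimately have "[q2 * u2 + q1 * u1 = 1] (mod q)" unfolding q_def using cop by (intro coprime_cong_mult) simp_all
    then have "[(q2 * u2 + q1 * u1) * k = 1 * k] (mod q)" by (intro cong_mult cong_refl)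
    then have "ee q k = ee q ((q2 * u2 + q1 * u1) * k)" using ee_cong[OF q] by fastforce
    also have "(q2 * u2 + q1 * u1) * k = q2 * (u2 * k) + q1 * (u1 * k)" by (simp add: algebra_simps)
    also have "ee q \<dots> = ee (q2 * q1) (q2 * (u2 * k)) * ee (q1 * q2) (q1 * (u1 * k))"
      by (simp add: ee_add q_def mult.commute)
    also have "\<dots> = ee q1 (u2 * k) * ee q2 (u1 * k)" 
      using q1 q2 by (intro arg_cong2[of _ _ _ _ "\<lambda>x y. x * y"] ee_scale) auto
    finally show ?thesis .
  qed
  define f1 where "f1 x = ee q1 (u2 * a * x + u2 * b * modular_inverse q1 x)" for x
  define f2 where "f2 x = ee q2 (u1 * a * x + u1 * b * modular_inverse q2 x)" for x
  have term1: "ee q (a * x + b * modular_inverse q x) = f1 (x mod q1) * f2 (x mod q2)" if "x \<in> units_mod q" for x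
  proof -
    let ?y = "modular_inverse q x"
    have x: "coprime x q" using that by (simp add: units_mod_def)
    have "[x * ?y = 1] (mod q1)" "[x * ?y = 1] (mod q2)"
      using cong_modular_inverse1[OF x] d1 d2 cong_dvd_modulus by blast+
    then have y: "[(modular_inverse q1 x) = ?y] (mod q1)" "[(modular_inverse q2 x) = ?y] (mod q2)"
      by (auto intro: cong_modular_inverse_unique)
    have "ee q1 (u2 * (a * x + b * ?y)) = f1 x"
      unfolding f1_def by (rule ee_cong[OF q1], subst distrib_left, unfold mult.assoc[symmetric])
        (intro cong_add cong_mult cong_refl cong_sym[OF y(1)])
    also have "\<dots> = f1 (x mod q1)"
      unfolding f1_def by (rule ee_kloosterman_cong[OF q1]) (simp add: cong_def)
    finally have 1: "ee q1 (u2 * (a * x + b * ?y)) = f1 (x mod q1)" .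
    have "ee q2 (u1 * (a * x + b * ?y)) = f2 x"
      unfolding f2_def by (rule ee_cong[OF q2], subst distrib_left, unfold mult.assoc[symmetric])
        (intro cong_add cong_mult cong_refl cong_sym[OF y(2)])
    also have "\<dots> = f2 (x mod q2)"
      unfolding f2_def by (rule ee_kloosterman_cong[OF q2]) (simp add: cong_def)
    finally show ?thesis unfolding split 1 by simp
  qed
  have bij: "bij_betw (\<lambda>x. (x mod q1, x mod q2)) (units_mod q) (units_mod q1 \<times> units_mod q2)"
    unfolding bij_betw_def
  proof
    show "inj_on (\<lambda>x. (x mod q1, x mod q2)) (units_mod q)"
    proof (rule inj_onI)
      fix x y assume xy: "x \<in> units_mod q" "y \<in> units_mod q" "(x mod q1, x mod q2) = (y mod q1, y mod q2)"
      then have "[x = y] (mod q)" unfolding q_def using cop by (intro coprime_cong_mult) (auto simp: cong_def)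
      then show "x = y" using xy by (auto simp: cong_def units_mod_def)
    qed
    show "(\<lambda>x. (x mod q1, x mod q2)) ` units_mod q = units_mod q1 \<times> units_mod q2"
    proof (intro equalityI subsetI)
      fix z assume "z \<in> (\<lambda>x. (x mod q1, x mod q2)) ` units_mod q"
      then show "z \<in> units_mod q1 \<times> units_mod q2"
        using q1 q2 by (auto simp: units_mod_def q_def)
    next
      fix z assume "z \<in> units_mod q1 \<times> units_mod q2"
      then obtain x1 x2 where z: "z = (x1, x2)" "x1 \<in> units_mod q1" "x2 \<in> units_mod q2" by auto
      obtain x where x: "[x = x1] (mod q1)" "[x = x2] (mod q2)"
        using binary_chinese_remainder_int[OF cop] by blast
      have "coprime x q1" "coprime x q2"
        using z coprime_cong_iff[OF x(1)] coprime_cong_iff[OF x(2)] by (auto simp: units_mod_def)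
      then have "coprime x q" by (simp add: q_def)
      then have "x mod q \<in> units_mod q" using q by (simp add: units_mod_def)
      moreover have "x mod q mod q1 = x1" "x mod q mod q2 = x2"
        using x z d1 d2 by (auto simp: mod_mod_cancel cong_def units_mod_def)
      ultimately show "z \<in> (\<lambda>x. (x mod q1, x mod q2)) ` units_mod q"
        using z(1) by (intro image_eqI[of _ _ "x mod q"]) auto
    qed
  qed
  have "kloosterman q a b = (\<Sum>x\<in>units_mod q. (\<lambda>(x1, x2). f1 x1 * f2 x2) (x mod q1, x mod q2))"
    unfolding kloosterman_def by (intro sum.cong refl) (simp add: term1)
  also have "\<dots> = (\<Sum>(x1, x2)\<in>units_mod q1 \<times> units_mod q2. f1 x1 * f2 x2)"
    by (rule sum.reindex_bij_betw[OF bij])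
  also have "\<dots> = (\<Sum>x1\<in>units_mod q1. f1 x1) * (\<Sum>x2\<in>units_mod q2. f2 x2)"
    by (simp add: sum_product sum.cartesian_product)
  finally show ?thesis by (simp add: q_def kloosterman_def f1_def f2_def)
qed

lemma finite_divisors: "q > 0 \<Longrightarrow> finite {d::int. d > 0 \<and> d dvd q}"
  by (rule finite_subset[of _ "{0..q}"]) (auto intro: zdvd_imp_le)

lemma divisor_count_pos: "q > 0 \<Longrightarrow> divisor_count q \<ge> 1"
proof -
  assume q: "q > 0"
  have "1 \<in> {d::int. d > 0 \<and> d dvd q}" by simp
  then have "card {d::int. d > 0 \<and> d dvd q} > 0" using finite_divisors[OF q] card_gt_0_iff by blast
  then show ?thesis by (simp add: divisor_count_def)
qed

text \<open>The products p^i d are distinct: i is recovered as the p-adic valuation, since p does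
  not divide d.\<close>

lemma divisor_count_prime_power_mult:
  assumes p: "prime p" and r: "r > 0" and "\<not> p dvd r"
  shows "(k + 1) * divisor_count r \<le> divisor_count (p ^ k * r)"
proof -
  have p0: "p > 0" using p by (simp add: prime_gt_0_int)
  let ?D = "{d::int. d > 0 \<and> d dvd r}"
  have "(k + 1) * divisor_count r = card ({..k} \<times> ?D)" 
    by (simp only: divisor_count_def card_cartesian_product card_atMost Suc_eq_plus1)
  also have "\<dots> = card ((\<lambda>(i, d). p ^ i * d) ` ({..k} \<times> ?D))"
  proof (rule card_image[symmetric], rule inj_onI)
    fix u v assume uv: "u \<in> {..k} \<times> ?D" "v \<in> {..k} \<times> ?D" "(\<lambda>(i, d). p ^ i * d) u = (\<lambda>(i, d). p ^ i * d) v"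
    obtain i d i' d' where u: "u = (i, d)" and v: "v = (i', d')" by (cases u, cases v)
    have nd: "\<not> p dvd d" "\<not> p dvd d'" using uv assms(3) dvd_trans unfolding u v by blast+
    have eq: "p ^ i * d = p ^ i' * d'" using uv(3) by (simp add: u v)
    have mult: "multiplicity p (p ^ i * d) = i" if "\<not> p dvd d" for i d
      using that p by (intro multiplicity_eqI) (auto simp: mult.assoc)
    have "i = i'" using mult[OF nd(1), of i] mult[OF nd(2), of i'] eq by simp
    then show "u = v" using eq p0 by (simp add: u v)
  qed
  also have "\<dots> \<le> card {d::int. d > 0 \<and> d dvd p ^ k * r}"
  proof (rule card_mono)
    show "finite {d::int. d > 0 \<and> d dvd p ^ k * r}" using p0 r by (intro finite_divisors) simp
    show "(\<lambda>(i, d). p ^ i * d) ` ({..k} \<times> ?D) \<subseteq> {d. d > 0 \<and> d dvd p ^ k * r}"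
      using p0 by (auto intro!: mult_dvd_mono le_imp_power_dvd)
  qed
  finally show ?thesis by (simp add: divisor_count_def)
qed

lemma gcd_unit_mult:
  fixes u a b n :: int
  assumes "coprime u n"
  shows "gcd (gcd (u * a) (u * b)) n = gcd (gcd a b) n"
proof -
  have "gcd (u * a) n = gcd a n" "gcd (u * b) n = gcd b n"
    using assms by (simp_all add: gcd_mult_left_left_cancel coprime_commute)
  then show ?thesis by (metis gcd.assoc gcd.left_commute gcd.commute)
qed

text \<open>Prime powers are split off one at a time; the twists are by units and leave the gcds
  unchanged. The constant depends on the parity of q because the factor 4 is spent at the prime 2
  only, hence at most once.\<close>

lemma kloosterman_bound_aux:
  assumes "q > 0"
  shows "norm (kloosterman q a b) ^ 2
    \<le> (if even q then 4 else 1) * real (divisor_count q) ^ 2 * of_int q * of_int (gcd (gcd a b) q)"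
  using assms
proof (induction "nat q" arbitrary: q a b rule: less_induct)
  case (less q a b)
  show ?case
  proof (cases "q = 1")
    case True
    have "norm (kloosterman 1 a b) ^ 2 \<le> 1 ^ 2"
      using norm_kloosterman_trivial[of 1 a b] by (intro power_mono) auto
    also have "\<dots> \<le> real (divisor_count 1) ^ 2" using divisor_count_pos[of 1] by (intro power_mono) auto
    finally show ?thesis using True by simp
  next
    case False
    then obtain p where p: "prime p" "p dvd q" using prime_divisor_exists[of q] less(2) by auto
    have p1: "p > 1" using p by (simp add: prime_gt_1_int)
    define k where "k = multiplicity p q"
    obtain r where r: "q = p ^ k * r" "\<not> p dvd r"
      unfolding k_def using multiplicity_decompose'[of q p] less(2) p not_prime_unit[of p] by auto
    have r0: "r > 0" using less(2) p1 unfolding r(1) by (simp add: zero_less_mult_iff)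
    have k0: "k \<noteq> 0" using r p by (metis mult_1 power_0)
    have pk: "p ^ k > 1" using p1 k0 by simp
    have "r < q" unfolding r(1) using r0 pk by simp
    have cop: "coprime (p ^ k) r" using r(2) p prime_imp_coprime by (metis coprime_power_left_iff)
    define u1 u2 where "u1 = modular_inverse r (p ^ k)" and "u2 = modular_inverse (p ^ k) r"
    have cu: "coprime u1 r" "coprime u2 (p ^ k)"
      unfolding u1_def u2_def using cop coprime_commute coprime_modular_inverse by blast+
    let ?c = "\<lambda>n::int. if even n then 4 else (1::real)"
    let ?g1 = "gcd (gcd a b) (p ^ k)" and ?g2 = "gcd (gcd a b) r"
    have "kloosterman q a b = kloosterman (p ^ k) (u2 * a) (u2 * b) * kloosterman r (u1 * a) (u1 * b)"
      unfolding r(1) u1_def u2_def using pk by (intro kloosterman_mult cop r0) simp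
    then have "norm (kloosterman q a b) ^ 2
        = norm (kloosterman (p ^ k) (u2 * a) (u2 * b)) ^ 2 * norm (kloosterman r (u1 * a) (u1 * b)) ^ 2"
      by (simp add: norm_mult power_mult_distrib)
    also have "\<dots> \<le> (?c p * (real k + 1) ^ 2 * of_int (p ^ k) * of_int ?g1)
        * (?c r * real (divisor_count r) ^ 2 * of_int r * of_int ?g2)"
    proof (rule mult_mono)
      show "norm (kloosterman (p ^ k) (u2 * a) (u2 * b)) ^ 2 \<le> ?c p * (real k + 1) ^ 2 * of_int (p ^ k) * of_int ?g1"
        using norm_kloosterman_prime_power[OF p(1), of k "u2 * a" "u2 * b"] gcd_unit_mult[OF cu(2)] by simp
      show "norm (kloosterman r (u1 * a) (u1 * b)) ^ 2 \<le> ?c r * real (divisor_count r) ^ 2 * of_int r * of_int ?g2"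
        using less(1)[of r "u1 * a" "u1 * b"] \<open>r < q\<close> r0 gcd_unit_mult[OF cu(1)] by simp
    qed (use p1 in auto)
    also have "\<dots> = (?c p * ?c r) * ((real k + 1) * real (divisor_count r)) ^ 2 * (of_int (p ^ k) * of_int r) * of_int (?g1 * ?g2)"
      by (simp add: power_mult_distrib mult_ac)
    also have "(?c p * ?c r) * ((real k + 1) * real (divisor_count r)) ^ 2 * (of_int (p ^ k) * of_int r) * of_int (?g1 * ?g2)
        \<le> ?c q * real (divisor_count q) ^ 2 * of_int q * of_int (gcd (gcd a b) q)"
    proof (intro mult_mono)
      show "?c p * ?c r \<le> ?c q"
      proof (cases "even p")
        case True
        then have "p = 2" using p by (metis primes_dvd_imp_eq two_is_prime_nat prime_int_numeral_eq)
        then have "odd r" using r(2) by simp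
        then show ?thesis using True k0 by (simp add: r(1))
      qed (simp add: r(1))
      have "real ((k + 1) * divisor_count r) \<le> real (divisor_count q)"
        unfolding of_nat_le_iff r(1) by (rule divisor_count_prime_power_mult[OF p(1) r0 r(2)])
      then show "((real k + 1) * real (divisor_count r)) ^ 2 \<le> real (divisor_count q) ^ 2"
        by (intro power_mono) (auto simp: algebra_simps)
      have "?g1 * ?g2 dvd gcd (gcd a b) q"
      proof (rule divides_mult)
        show "?g1 dvd gcd (gcd a b) q" "?g2 dvd gcd (gcd a b) q" 
          by (rule gcd_greatest[OF gcd_dvd1 dvd_trans[OF gcd_dvd2]], simp add: r(1))+
        show "coprime ?g1 ?g2" using cop by (meson coprime_divisors gcd_dvd2)
      qed
      then have "?g1 * ?g2 \<le> gcd (gcd a b) q" using less(2) by (intro zdvd_imp_le) auto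
      then show "real_of_int (?g1 * ?g2) \<le> of_int (gcd (gcd a b) q)" by (simp only: of_int_le_iff)
    qed (use p1 r0 less(2) in \<open>auto simp: r(1)\<close>)
    finally show ?thesis .
  qed
qed

lemma kloosterman_bound:
  assumes "q > 0"
  shows "norm (kloosterman q a b) ^ 2 \<le> 4 * real (divisor_count q) ^ 2 * of_int q * of_int (gcd (gcd a b) q)"
proof -
  have "(if even q then 4 else 1) * real (divisor_count q) ^ 2 * of_int q * of_int (gcd (gcd a b) q)
      \<le> 4 * real (divisor_count q) ^ 2 * of_int q * of_int (gcd (gcd a b) q)"
    using assms by (intro mult_right_mono) auto
  then show ?thesis using kloosterman_bound_aux[OF assms, of a b] by linarith
qed

section \<open>The variance as a mean value of Kloosterman sums\<close>

lemma sum_interval_shift: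
  fixes f :: "int \<Rightarrow> 'b::comm_monoid_add"
  shows "(\<Sum>x\<in>{b<..b + L}. f x) = (\<Sum>j\<in>{1..L}. f (b + j))"
  by (rule sum.reindex_bij_witness[of _ "\<lambda>j. b + j" "\<lambda>x. x - b"]) auto

lemma sum_residues_1:
  fixes f :: "int \<Rightarrow> 'b::comm_monoid_add"
  assumes "q > 0" "\<And>x y. [x = y] (mod q) \<Longrightarrow> f x = f y"
  shows "(\<Sum>x=1..q. f x) = (\<Sum>x\<in>{0..<q}. f x)"
proof -
  have "(\<Sum>x=1..q. f x) = (\<Sum>x\<in>{0..<q}. f (x + 1))"
    by (rule sum.reindex_bij_witness[of _ "\<lambda>j. j + 1" "\<lambda>x. x - 1"]) auto
  also have "\<dots> = (\<Sum>x\<in>{0..<q}. f x)" by (rule sum_residues_shift[OF assms])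
  finally show ?thesis .
qed

lemma sum_rotate:
  "(\<Sum>x\<in>A. \<Sum>y\<in>B. \<Sum>z\<in>C. f x y z) = (\<Sum>y\<in>B. \<Sum>z\<in>C. \<Sum>x\<in>A. f x y z)"
proof -
  have "(\<Sum>x\<in>A. \<Sum>y\<in>B. \<Sum>z\<in>C. f x y z) = (\<Sum>y\<in>B. \<Sum>x\<in>A. \<Sum>z\<in>C. f x y z)" by (rule sum.swap)
  also have "\<dots> = (\<Sum>y\<in>B. \<Sum>z\<in>C. \<Sum>x\<in>A. f x y z)" by (intro sum.cong refl) (rule sum.swap)
  finally show ?thesis .
qed

text \<open>Any frequencies distinct modulo q are allowed, so that this serves both for a complete
  residue system and for the interval {1..L}.\<close>

lemma parseval:
  fixes w :: "int \<Rightarrow> complex"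
  assumes q: "q > 0" and K: "finite K" "inj_on (\<lambda>k. k mod q) K"
  shows "(\<Sum>a\<in>{0..<q}. norm (\<Sum>k\<in>K. w k * ee q (k * a)) ^ 2) = of_int q * (\<Sum>k\<in>K. norm (w k) ^ 2)"
proof -
  have "complex_of_real (\<Sum>a\<in>{0..<q}. norm (\<Sum>k\<in>K. w k * ee q (k * a)) ^ 2)
      = (\<Sum>a\<in>{0..<q}. (\<Sum>k\<in>K. w k * ee q (k * a)) * cnj (\<Sum>l\<in>K. w l * ee q (l * a)))"
    unfolding of_real_sum complex_norm_square ..
  also have "\<dots> = (\<Sum>a\<in>{0..<q}. \<Sum>k\<in>K. \<Sum>l\<in>K. w k * cnj (w l) * ee q (a * (k - l)))"
  proof (intro sum.cong refl)
    fix a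
    have "ee q (k * a) * cnj (ee q (l * a)) = ee q (a * (k - l))" for k l
      unfolding ee_uminus[symmetric] ee_add[symmetric] by (rule arg_cong[of _ _ "ee q"]) (simp add: algebra_simps)
    then show "(\<Sum>k\<in>K. w k * ee q (k * a)) * cnj (\<Sum>l\<in>K. w l * ee q (l * a))
        = (\<Sum>k\<in>K. \<Sum>l\<in>K. w k * cnj (w l) * ee q (a * (k - l)))"
      unfolding cnj_sum sum_product complex_cnj_mult by (intro sum.cong refl) (simp add: mult_ac flip: \<open>\<And>k l. _ = _\<close>)
  qed
  also have "\<dots> = (\<Sum>k\<in>K. \<Sum>l\<in>K. w k * cnj (w l) * (\<Sum>a\<in>{0..<q}. ee q (a * (k - l))))"
    by (subst sum_rotate) (simp add: sum_distrib_left)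
  also have "\<dots> = (\<Sum>k\<in>K. \<Sum>l\<in>K. if l = k then of_int q * (w k * cnj (w k)) else 0)"
  proof (intro sum.cong refl)
    fix k l assume kl: "k \<in> K" "l \<in> K"
    have "q dvd k - l \<longleftrightarrow> l = k" using K(2) kl by (auto simp: inj_on_def simp flip: mod_eq_dvd_iff)
    then show "w k * cnj (w l) * (\<Sum>a\<in>{0..<q}. ee q (a * (k - l)))
        = (if l = k then of_int q * (w k * cnj (w k)) else 0)"
      unfolding sum_ee[OF q] by simp
  qed
  also have "\<dots> = (\<Sum>k\<in>K. of_int q * (w k * cnj (w k)))" using K(1) by simp
  also have "\<dots> = complex_of_real (of_int q * (\<Sum>k\<in>K. norm (w k) ^ 2))"
    unfolding of_real_mult of_real_sum complex_norm_square sum_distrib_left by simp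
  finally show ?thesis by (simp only: of_real_eq_iff)
qed

definition interval_sum :: "int \<Rightarrow> int \<Rightarrow> int \<Rightarrow> complex" where
  "interval_sum q L k = (\<Sum>j\<in>{1..L}. ee q (k * j))"

definition fourier :: "int \<Rightarrow> (int \<Rightarrow> complex) \<Rightarrow> int \<Rightarrow> complex" where
  "fourier q f l = (\<Sum>x\<in>{0..<q}. f x * ee q (- (l * x)))"

lemma fourier_inversion:
  assumes q: "q > 0" and per: "\<And>x y. [x = y] (mod q) \<Longrightarrow> f x = f y"
  shows "of_int q * f x = (\<Sum>l\<in>{0..<q}. fourier q f l * ee q (l * x))"
proof -
  have "(\<Sum>l\<in>{0..<q}. fourier q f l * ee q (l * x)) = (\<Sum>l\<in>{0..<q}. \<Sum>y\<in>{0..<q}. f y * ee q (l * (x - y)))"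
    unfolding fourier_def sum_distrib_right
  proof (intro sum.cong refl)
    fix l y
    have "ee q (- (l * y)) * ee q (l * x) = ee q (l * (x - y))"
      unfolding ee_add[symmetric] by (rule arg_cong[of _ _ "ee q"]) (simp add: algebra_simps)
    then show "f y * ee q (- (l * y)) * ee q (l * x) = f y * ee q (l * (x - y))" by (simp add: mult.assoc)
  qed
  also have "\<dots> = (\<Sum>y\<in>{0..<q}. f y * (if q dvd x - y then of_int q else 0))"
    by (subst sum.swap) (simp add: sum_distrib_left[symmetric] sum_ee[OF q])
  also have "\<dots> = (\<Sum>y\<in>{0..<q}. if y = x mod q then of_int q * f x else 0)"
  proof (intro sum.cong refl)
    fix y assume y: "y \<in> {0..<q}"
    have "q dvd x - y \<longleftrightarrow> y = x mod q"
      using y unfolding mod_eq_dvd_iff[symmetric] by auto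
    moreover have "f (x mod q) = f x" by (rule per) (simp add: cong_def)
    ultimately show "f y * (if q dvd x - y then of_int q else 0) = (if y = x mod q then of_int q * f x else 0)"
      by simp
  qed
  also have "\<dots> = of_int q * f x" using q by (simp add: sum.delta)
  finally show ?thesis ..
qed

text \<open>A window sum is a convolution with the interval {1..L}, so its Fourier coefficients are
  products. Inversion contributes 1/q^2 and Parseval q.\<close>

lemma sum_norm_window_sq:
  assumes q: "q > 0" and per: "\<And>x y. [x = y] (mod q) \<Longrightarrow> f x = f y"
  shows "(\<Sum>b=1..q. norm (\<Sum>j\<in>{1..L}. f (b + j)) ^ 2)
    = (\<Sum>l\<in>{0..<q}. norm (fourier q f l) ^ 2 * norm (interval_sum q L l) ^ 2) / of_int q"
proof -
  define w where "w l = fourier q f l * interval_sum q L l / of_int q" for l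
  have expand: "(\<Sum>j\<in>{1..L}. f (b + j)) = (\<Sum>l\<in>{0..<q}. w l * ee q (l * b))" for b
  proof -
    have "(\<Sum>j\<in>{1..L}. f (b + j)) = (\<Sum>j\<in>{1..L}. (\<Sum>l\<in>{0..<q}. fourier q f l * ee q (l * (b + j))) / of_int q)"
      using q by (intro sum.cong refl) (simp add: fourier_inversion[OF q per, symmetric])
    also have "\<dots> = (\<Sum>j\<in>{1..L}. \<Sum>l\<in>{0..<q}. fourier q f l * ee q (l * j) / of_int q * ee q (l * b))"
      unfolding sum_divide_distrib by (intro sum.cong refl) (simp add: distrib_left ee_add)
    also have "\<dots> = (\<Sum>l\<in>{0..<q}. w l * ee q (l * b))"
      by (subst sum.swap) (simp add: w_def interval_sum_def sum_distrib_left sum_distrib_right sum_divide_distrib)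
    finally show ?thesis .
  qed
  have "(\<Sum>b=1..q. norm (\<Sum>j\<in>{1..L}. f (b + j)) ^ 2) = (\<Sum>b\<in>{0..<q}. norm (\<Sum>j\<in>{1..L}. f (b + j)) ^ 2)"
  proof (rule sum_residues_1[OF q])
    fix x y assume xy: "[x = y] (mod q)"
    have "f (x + j) = f (y + j)" for j by (intro per cong_add cong_refl xy)
    then show "norm (\<Sum>j\<in>{1..L}. f (x + j)) ^ 2 = norm (\<Sum>j\<in>{1..L}. f (y + j)) ^ 2" by simp
  qed
  also have "\<dots> = of_int q * (\<Sum>l\<in>{0..<q}. norm (w l) ^ 2)"
    unfolding expand by (rule parseval[OF q]) (auto simp: inj_on_def)
  also have "\<dots> = (\<Sum>l\<in>{0..<q}. norm (fourier q f l) ^ 2 * norm (interval_sum q L l) ^ 2) / of_int q"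
    unfolding w_def sum_distrib_left sum_divide_distrib using q
    by (intro sum.cong refl) (simp add: norm_mult norm_divide power_mult_distrib power_divide power2_eq_square)
  finally show ?thesis .
qed

text \<open>Parseval with the roles exchanged: the integers of the interval are the frequencies,
  distinct modulo m because L \<le> m.\<close>

lemma sum_norm_interval_sum_sq:
  assumes "m > 0" "0 \<le> L" "L \<le> m"
  shows "(\<Sum>i\<in>{0..<m}. norm (interval_sum m L i) ^ 2) = of_int m * of_int L"
proof -
  have "inj_on (\<lambda>k. k mod m) {1..L}"
  proof (rule inj_onI)
    fix x y assume xy: "x \<in> {1..L}" "y \<in> {1..L}" "x mod m = y mod m"
    then have "m dvd x - y" by (simp add: mod_eq_dvd_iff)
    moreover have "\<bar>x - y\<bar> < m" using xy assms by auto
    ultimately show "x = y" using dvd_imp_le_int[of "x - y" m] by fastforce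
  qed
  then have "(\<Sum>i\<in>{0..<m}. norm (\<Sum>k\<in>{1..L}. 1 * ee m (k * i)) ^ 2) = of_int m * (\<Sum>k\<in>{1..L}. norm (1::complex) ^ 2)"
    by (intro parseval assms(1)) auto
  then show ?thesis using assms by (simp add: interval_sum_def mult.commute)
qed

lemma interval_sum_add_period:
  assumes m: "m > 0" and L: "L \<ge> 0" and i: "\<not> m dvd i"
  shows "interval_sum m (L + int n * m) i = interval_sum m L i"
proof (induction n)
  case (Suc n)
  define L' where "L' = L + int n * m"
  have L': "L' \<ge> 0" using m L by (simp add: L'_def)
  have "{1..L' + m} = {1..L'} \<union> {L'<..L' + m}" using L' m by auto
  then have "interval_sum m (L' + m) i = interval_sum m L' i + (\<Sum>j\<in>{L'<..L' + m}. ee m (i * j))"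
    unfolding interval_sum_def by (auto intro: sum.union_disjoint)
  also have "(\<Sum>j\<in>{L'<..L' + m}. ee m (i * j)) = (\<Sum>j=1..m. ee m (i * (L' + j)))"
    by (rule sum_interval_shift)
  also have "\<dots> = (\<Sum>j\<in>{0..<m}. ee m (i * (L' + j)))"
    by (rule sum_residues_1[OF m]) (intro ee_cong m cong_mult cong_add cong_refl)
  also have "\<dots> = ee m (i * L') * (\<Sum>j\<in>{0..<m}. ee m (j * i))"
    by (simp add: sum_distrib_left distrib_left ee_add mult.commute)
  also have "\<dots> = 0" using i by (simp add: sum_ee[OF m])
  finally show ?case using Suc by (simp add: L'_def algebra_simps)
qed simp

text \<open>The first factor omits i = 0, which is decisive when L > m: there the second factor is
  dominated by the value L^2 at 0, while the first depends only on L modulo m and is at most m^2.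
  For L \<le> m both factors are at most mL.\<close>

lemma interval_sum_products_le:
  assumes m: "m > 0" and L: "L \<ge> 1"
  shows "(\<Sum>i\<in>{1..<m}. norm (interval_sum m L i) ^ 2) * (\<Sum>i\<in>{0..<m}. norm (interval_sum m L i) ^ 2) \<le> 2 * of_int m ^ 2 * of_int L ^ 2"
proof -
  let ?A = "\<Sum>i\<in>{1..<m}. norm (interval_sum m L i) ^ 2" and ?B = "\<Sum>i\<in>{0..<m}. norm (interval_sum m L i) ^ 2"
  have ins: "{0..<m} = insert 0 {1..<m}" using m by auto
  have "interval_sum m L 0 = of_int L" using L by (simp add: interval_sum_def)
  then have B: "?B = of_int L ^ 2 + ?A" using L unfolding ins by simp
  have A0: "?A \<ge> 0" by (intro sum_nonneg) auto
  show ?thesis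
  proof (cases "L \<le> m")
    case True
    then have B': "?B = of_int m * of_int L" using sum_norm_interval_sum_sq[OF m _ True] L by simp
    then have "?A \<le> of_int m * of_int L" using B by (metis le_add_same_cancel2 zero_le_power2)
    then have "?A * ?B \<le> (of_int m * of_int L) * (of_int m * of_int L)"
      unfolding B' using m L by (intro mult_right_mono) auto
    also have "\<dots> = of_int m ^ 2 * of_int L ^ 2" by (simp add: power2_eq_square)
    also have "\<dots> \<le> 2 * (of_int m ^ 2 * of_int L ^ 2)" by simp
    finally show ?thesis by (simp only: mult.assoc)
  next
    case False
    \<comment> \<open>complete periods do not contribute at nonzero frequencies\<close>
    define L' where "L' = L mod m"
    have L': "0 \<le> L'" "L' \<le> m" using m by (auto simp: L'_def less_imp_le)
    have "L = L' + int (nat (L div m)) * m" using m L by (simp add: L'_def pos_imp_zdiv_nonneg_iff)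
    then have "interval_sum m L i = interval_sum m L' i" if "i \<in> {1..<m}" for i
      using interval_sum_add_period[OF m L'(1), of i "nat (L div m)"] that zdvd_not_zless[of i m] by simp
    then have "?A = (\<Sum>i\<in>{1..<m}. norm (interval_sum m L' i) ^ 2)" by (intro sum.cong refl) simp
    also have "\<dots> \<le> (\<Sum>i\<in>{0..<m}. norm (interval_sum m L' i) ^ 2)" by (rule sum_mono2) auto
    also have "\<dots> = of_int m * of_int L'" by (rule sum_norm_interval_sum_sq[OF m L'])
    also have "\<dots> \<le> of_int m * of_int m" using L' m by (intro mult_left_mono) auto
    finally have A: "?A \<le> of_int m ^ 2" by (simp add: power2_eq_square)
    also have "\<dots> \<le> of_int L ^ 2" using False m by (intro power_mono) auto
    finally have "?B \<le> 2 * of_int L ^ 2" unfolding B by simp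
    then have "?A * ?B \<le> of_int m ^ 2 * (2 * of_int L ^ 2)" using A A0 by (intro mult_mono) (auto intro: sum_nonneg)
    then show ?thesis by (simp add: mult_ac)
  qed
qed

text \<open>e(dij/q) = e(ij/m), so the frequencies divisible by d live modulo m. The start
  \<open>s\<close> keeps or omits the zero frequency.\<close>

lemma sum_multiples_interval_sum:
  assumes q: "q > 0" and d: "d > 0" "q = d * m" and s: "s = 0 \<or> s = 1"
  shows "(\<Sum>k\<in>{k\<in>{s..<q}. d dvd k}. norm (interval_sum q L k) ^ 2) = (\<Sum>i\<in>{s..<m}. norm (interval_sum m L i) ^ 2)"
proof (rule sum.reindex_bij_witness[of _ "\<lambda>i. d * i" "\<lambda>k. k div d"])
  fix i assume i: "i \<in> {s..<m}"
  show "d * i div d = i" using d by simp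
  have "1 * 1 \<le> d * i" if "s = 1" using d i that by (intro mult_mono) auto
  moreover have "0 \<le> d * i" using d i s by auto
  ultimately show "d * i \<in> {k\<in>{s..<q}. d dvd k}" using d i s by auto
next
  fix k assume k: "k \<in> {k\<in>{s..<q}. d dvd k}"
  then obtain i where i: "k = d * i" by auto
  then show "d * (k div d) = k" using d by simp
  have "s \<le> d * i" "d * i < d * m" using k d i by auto
  then have "i < m" "s \<le> i"
    using d s by (auto simp: zero_le_mult_iff) (smt (verit) mult_nonneg_nonpos)
  then show "k div d \<in> {s..<m}" using i d by simp
  have "interval_sum q L k = interval_sum m L i" unfolding interval_sum_def i d(2) using d(1)
    by (intro sum.cong refl) (simp add: ee_scale mult.assoc)
  then show "norm (interval_sum m L (k div d)) ^ 2 = norm (interval_sum q L k) ^ 2" using i d by simp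
qed

text \<open>The gcd is one of the divisors d of q that divide both k and l, so it is at most the sum
  of all of these, and for fixed d the double sum factors. Each divisor contributes at most 2 q^2
  L^2.\<close>

lemma weighted_gcd_sum:
  assumes q: "q > 0" and L: "L \<ge> 1"
  shows "(\<Sum>k\<in>{1..<q}. \<Sum>l\<in>{0..<q}. of_int (gcd (gcd l k) q) * (norm (interval_sum q L k) ^ 2 * norm (interval_sum q L l) ^ 2))
    \<le> 2 * of_int q ^ 2 * of_int L ^ 2 * real (divisor_count q)"
proof -
  define D where "D = {d::int. d > 0 \<and> d dvd q}"
  have fin: "finite D" unfolding D_def by (rule finite_divisors[OF q])
  let ?w = "\<lambda>k. norm (interval_sum q L k) ^ 2"
  have "(\<Sum>k\<in>{1..<q}. \<Sum>l\<in>{0..<q}. of_int (gcd (gcd l k) q) * (?w k * ?w l))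
      \<le> (\<Sum>k\<in>{1..<q}. \<Sum>l\<in>{0..<q}. \<Sum>d\<in>D. of_int d * ((if d dvd k then ?w k else 0) * (if d dvd l then ?w l else 0)))"
  proof (intro sum_mono)
    fix k l
    let ?g = "gcd (gcd l k) q"
    have g: "?g \<in> D" using q by (simp add: D_def)
    have "of_int ?g * (?w k * ?w l) = of_int ?g * ((if ?g dvd k then ?w k else 0) * (if ?g dvd l then ?w l else 0))"
    proof -
      have "?g dvd k" "?g dvd l" by (meson dvd_trans gcd_dvd1 gcd_dvd2)+
      then show ?thesis by simp
    qed
    also have "\<dots> \<le> (\<Sum>d\<in>D. of_int d * ((if d dvd k then ?w k else 0) * (if d dvd l then ?w l else 0)))"
      using g by (intro member_le_sum fin) (auto simp: D_def)
    finally show "of_int ?g * (?w k * ?w l)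
        \<le> (\<Sum>d\<in>D. of_int d * ((if d dvd k then ?w k else 0) * (if d dvd l then ?w l else 0)))" .
  qed
  also have "\<dots> = (\<Sum>d\<in>D. \<Sum>k\<in>{1..<q}. \<Sum>l\<in>{0..<q}. of_int d * ((if d dvd k then ?w k else 0) * (if d dvd l then ?w l else 0)))"
    by (rule sum_rotate[symmetric])
  also have "\<dots> = (\<Sum>d\<in>D. of_int d * ((\<Sum>k\<in>{1..<q}. if d dvd k then ?w k else 0) * (\<Sum>l\<in>{0..<q}. if d dvd l then ?w l else 0)))"
    by (simp only: sum_product) (simp only: sum_distrib_left)
  also have "\<dots> \<le> (\<Sum>d\<in>D. 2 * of_int q ^ 2 * of_int L ^ 2)"
  proof (rule sum_mono)
    fix d assume "d \<in> D"
    then obtain m where d: "d > 0" "q = d * m" by (auto simp: D_def)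
    have m: "m > 0" using q d by (simp add: zero_less_mult_iff)
    have "(\<Sum>k\<in>{s..<q}. if d dvd k then ?w k else 0) = (\<Sum>i\<in>{s..<m}. norm (interval_sum m L i) ^ 2)"
      if "s = 0 \<or> s = 1" for s
      using sum_multiples_interval_sum[OF q d that, of L] by (simp only: sum.inter_filter finite_atLeastLessThan_int)
    then have "of_int d * ((\<Sum>k\<in>{1..<q}. if d dvd k then ?w k else 0) * (\<Sum>l\<in>{0..<q}. if d dvd l then ?w l else 0))
        \<le> of_int d * (2 * of_int m ^ 2 * of_int L ^ 2)"
      using interval_sum_products_le[OF m L] d by (simp add: mult_left_mono)
    \<comment> \<open>A factor d is given away to make the bound the same for all divisors.\<close>
    also have "\<dots> \<le> of_int d ^ 2 * (2 * of_int m ^ 2 * of_int L ^ 2)"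
    proof (rule mult_right_mono)
      have "real_of_int d * 1 \<le> of_int d * of_int d" using d by (intro mult_left_mono) auto
      then show "real_of_int d \<le> of_int d ^ 2" by (simp add: power2_eq_square)
    qed auto
    also have "\<dots> = 2 * of_int q ^ 2 * of_int L ^ 2" unfolding d(2) by (simp add: power_mult_distrib)
    finally show "of_int d * ((\<Sum>k\<in>{1..<q}. if d dvd k then ?w k else 0) * (\<Sum>l\<in>{0..<q}. if d dvd l then ?w l else 0))
        \<le> 2 * of_int q ^ 2 * of_int L ^ 2" .
  qed
  also have "\<dots> = 2 * of_int q ^ 2 * of_int L ^ 2 * real (divisor_count q)"
    by (simp add: divisor_count_def D_def)
  finally show ?thesis .
qed

text \<open>The value 0 off the units absorbs the coprimality condition on the second variable, so
  that its window becomes a full interval.\<close>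

definition inverse_phase :: "int \<Rightarrow> int \<Rightarrow> int \<Rightarrow> complex" where
  "inverse_phase q n x = (if coprime x q then ee q (- (n * modular_inverse q x)) else 0)"

text \<open>\<open>Y\<close> will be a window of the second variable. Distributing the expected
  count over its elements makes the mean over x vanish when they are units.\<close>

definition balanced_count :: "int \<Rightarrow> int \<Rightarrow> int set \<Rightarrow> int \<Rightarrow> complex" where
  "balanced_count q c Y x = (\<Sum>y\<in>Y. (if [x * y = c] (mod q) then 1 else 0) - 1 / of_int q)"

lemma inverse_phase_cong: "q > 0 \<Longrightarrow> [x = y] (mod q) \<Longrightarrow> inverse_phase q n x = inverse_phase q n y"
  unfolding inverse_phase_def using coprime_cong_iff modular_inverse_cong by metis

lemma balanced_count_cong:
  assumes "[x = y] (mod q)"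
  shows "balanced_count q c Y x = balanced_count q c Y y"
proof -
  have "[x * z = c] (mod q) \<longleftrightarrow> [y * z = c] (mod q)" for z
  proof -
    have "[x * z = y * z] (mod q)" by (intro cong_mult assms cong_refl)
    then show ?thesis using cong_trans cong_sym by blast
  qed
  then show ?thesis by (simp add: balanced_count_def)
qed

lemma fourier_inverse_phase: "fourier q (inverse_phase q n) l = kloosterman q (- l) (- n)"
proof -
  have "fourier q (inverse_phase q n) l
      = (\<Sum>x\<in>{0..<q}. if coprime x q then ee q (- l * x + - n * modular_inverse q x) else 0)"
    unfolding fourier_def inverse_phase_def
    by (intro sum.cong refl) (simp add: ee_add[symmetric] add.commute)
  then show ?thesis unfolding kloosterman_def sum_units_eq .
qed

text \<open>A unit y admits exactly one x modulo q, namely c/y, and the transform of a single point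
  is a phase. The subtracted 1/q contributes only for q | l, where it cancels the 1 coming from each
  y.\<close>

lemma fourier_balanced_count:
  assumes q: "q > 0" and Y: "\<And>y. y \<in> Y \<Longrightarrow> coprime y q"
  shows "fourier q (balanced_count q c Y) l = (if q dvd l then 0 else \<Sum>y\<in>Y. inverse_phase q (l * c) y)"
proof -
  have one: "(\<Sum>x\<in>{0..<q}. (if [x * y = c] (mod q) then 1 else 0) * ee q (- (l * x))) = inverse_phase q (l * c) y"
    if y: "coprime y q" for y
  proof -
    let ?z = "modular_inverse q y"
    have iff: "[x * y = c] (mod q) \<longleftrightarrow> x = (c * ?z) mod q" if x: "x \<in> {0..<q}" for x
    proof -
      have "[x * y = c] (mod q) \<longleftrightarrow> [?z * (x * y) = ?z * c] (mod q)"
        using cong_mult_lcancel[OF coprime_modular_inverse[OF y]] by simp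
      also have "[?z * (x * y) = x * 1] (mod q)"
      proof -
        have "[x * (?z * y) = x * 1] (mod q)" by (intro cong_mult cong_refl cong_modular_inverse2 y)
        then show ?thesis by (simp add: mult_ac)
      qed
      then have "[?z * (x * y) = ?z * c] (mod q) \<longleftrightarrow> [x = c * ?z] (mod q)"
        using cong_trans cong_sym by (metis mult.commute mult_1_right)
      also have "\<dots> \<longleftrightarrow> x = (c * ?z) mod q" using x by (simp add: cong_def)
      finally show ?thesis .
    qed
    have "(\<Sum>x\<in>{0..<q}. (if [x * y = c] (mod q) then 1 else 0) * ee q (- (l * x)))
        = (\<Sum>x\<in>{0..<q}. if x = (c * ?z) mod q then ee q (- (l * ((c * ?z) mod q))) else 0)"
      by (intro sum.cong refl) (simp add: iff)
    also have "\<dots> = ee q (- (l * ((c * ?z) mod q)))" using q by (simp add: sum.delta)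
    also have "\<dots> = ee q (- (l * (c * ?z)))"
    proof (rule ee_cong[OF q])
      have "[l * ((c * ?z) mod q) = l * (c * ?z)] (mod q)" by (intro cong_mult cong_refl) (simp add: cong_def)
      then show "[- (l * ((c * ?z) mod q)) = - (l * (c * ?z))] (mod q)" by (simp only: cong_minus_minus_iff)
    qed
    finally show ?thesis using y by (simp add: inverse_phase_def mult.assoc)
  qed
  have "fourier q (balanced_count q c Y) l
      = (\<Sum>x\<in>{0..<q}. \<Sum>y\<in>Y. (if [x * y = c] (mod q) then 1 else 0) * ee q (- (l * x)) - ee q (- (l * x)) / of_int q)"
    unfolding fourier_def balanced_count_def sum_distrib_right
    by (intro sum.cong refl) (simp add: left_diff_distrib)
  also have "\<dots> = (\<Sum>y\<in>Y. inverse_phase q (l * c) y - (\<Sum>x\<in>{0..<q}. ee q (- (l * x))) / of_int q)"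
    by (subst sum.swap, intro sum.cong refl) (simp only: sum_subtractf one[OF Y] sum_divide_distrib)
  also have "(\<Sum>x\<in>{0..<q}. ee q (- (l * x))) = (if q dvd l then of_int q else 0)"
    using sum_ee[OF q, of "- l"] by (simp add: mult.commute)
  also have "(\<Sum>y\<in>Y. inverse_phase q (l * c) y - (if q dvd l then of_int q else 0) / of_int q)
      = (\<Sum>y\<in>Y. inverse_phase q (l * c) y - (if q dvd l then 1 else 0))"
    using q by (intro sum.cong refl) simp
  also have "\<dots> = (if q dvd l then 0 else \<Sum>y\<in>Y. inverse_phase q (l * c) y)"
  proof (cases "q dvd l")
    case True
    then have "inverse_phase q (l * c) y = 1" if "y \<in> Y" for y
      using Y[OF that] q by (simp add: inverse_phase_def ee_eq_1_iff)
    then show ?thesis using True by simp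
  qed simp
  finally show ?thesis .
qed

text \<open>Parseval is applied once per variable: in a for fixed b, where the frequency 0 drops
  out, and then in b for fixed k, where the transform of \<open>inverse_phase\<close> is a
  Kloosterman sum and l = 0 remains.\<close>

lemma discrepancy_variance:
  fixes q L c :: int
  assumes q: "q > 0"
  shows "(\<Sum>a = 1..q. \<Sum>b = 1..q.
        norm (\<Sum>x\<in>{a<..a + L}. balanced_count q c {y\<in>{b<..b + L}. coprime y q} x) ^ 2)
    = (\<Sum>k\<in>{1..<q}. \<Sum>l\<in>{0..<q}. norm (kloosterman q (- l) (- (k * c))) ^ 2
          * (norm (interval_sum q L k) ^ 2 * norm (interval_sum q L l) ^ 2)) / of_int q ^ 2"
proof -
  let ?Y = "\<lambda>b. {y\<in>{b<..b + L}. coprime y q}"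
  let ?w = "\<lambda>k. norm (interval_sum q L k) ^ 2"
  have inner: "(\<Sum>a = 1..q. norm (\<Sum>x\<in>{a<..a + L}. balanced_count q c (?Y b) x) ^ 2)
      = (\<Sum>k\<in>{1..<q}. norm (\<Sum>j\<in>{1..L}. inverse_phase q (k * c) (b + j)) ^ 2 * ?w k) / of_int q" for b
  proof -
    have F: "fourier q (balanced_count q c (?Y b)) k
        = (if q dvd k then 0 else \<Sum>j\<in>{1..L}. inverse_phase q (k * c) (b + j))" for k
    proof -
      have "(\<Sum>y\<in>?Y b. inverse_phase q (k * c) y) = (\<Sum>y\<in>{b<..b + L}. inverse_phase q (k * c) y)"
        by (rule sum.mono_neutral_left) (auto simp: inverse_phase_def)
      also have "\<dots> = (\<Sum>j\<in>{1..L}. inverse_phase q (k * c) (b + j))" by (rule sum_interval_shift)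
      finally show ?thesis by (subst fourier_balanced_count[OF q]) auto
    qed
    have ins: "{0..<q} = insert 0 {1..<q}" using q by auto
    have nd: "\<not> q dvd k" if "k \<in> {1..<q}" for k using that zdvd_not_zless[of k q] by simp
    have "(\<Sum>a = 1..q. norm (\<Sum>x\<in>{a<..a + L}. balanced_count q c (?Y b) x) ^ 2)
        = (\<Sum>a = 1..q. norm (\<Sum>j\<in>{1..L}. balanced_count q c (?Y b) (a + j)) ^ 2)"
      by (simp only: sum_interval_shift)
    also have "\<dots> = (\<Sum>k\<in>{0..<q}. norm (fourier q (balanced_count q c (?Y b)) k) ^ 2 * ?w k) / of_int q"
      by (rule sum_norm_window_sq[OF q balanced_count_cong])
    also have "\<dots> = (\<Sum>k\<in>{1..<q}. norm (\<Sum>j\<in>{1..L}. inverse_phase q (k * c) (b + j)) ^ 2 * ?w k) / of_int q"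
      unfolding F ins by (simp add: nd)
    finally show ?thesis .
  qed
  have outer: "(\<Sum>b = 1..q. norm (\<Sum>j\<in>{1..L}. inverse_phase q n (b + j)) ^ 2)
      = (\<Sum>l\<in>{0..<q}. norm (kloosterman q (- l) (- n)) ^ 2 * ?w l) / of_int q" for n
    unfolding fourier_inverse_phase[symmetric]
    by (rule sum_norm_window_sq[OF q]) (rule inverse_phase_cong[OF q])
  have "(\<Sum>a = 1..q. \<Sum>b = 1..q. norm (\<Sum>x\<in>{a<..a + L}. balanced_count q c (?Y b) x) ^ 2)
      = (\<Sum>b = 1..q. (\<Sum>k\<in>{1..<q}. norm (\<Sum>j\<in>{1..L}. inverse_phase q (k * c) (b + j)) ^ 2 * ?w k) / of_int q)"
    by (subst sum.swap) (simp only: inner)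
  also have "\<dots> = (\<Sum>k\<in>{1..<q}. (\<Sum>b = 1..q. norm (\<Sum>j\<in>{1..L}. inverse_phase q (k * c) (b + j)) ^ 2) * ?w k) / of_int q"
    unfolding sum_divide_distrib[symmetric] sum_distrib_right by (subst sum.swap) (rule refl)
  also have "\<dots> = (\<Sum>k\<in>{1..<q}. (\<Sum>l\<in>{0..<q}. norm (kloosterman q (- l) (- (k * c))) ^ 2 * ?w l) * ?w k) / of_int q ^ 2"
  proof -
    have "(\<Sum>k\<in>K. f k / r * g k) / r = (\<Sum>k\<in>K. f k * g k) / r ^ 2" for f g :: "int \<Rightarrow> real" and r K
      by (simp add: sum_divide_distrib power2_eq_square)
    then show ?thesis unfolding outer .
  qed
  also have "\<dots> = (\<Sum>k\<in>{1..<q}. \<Sum>l\<in>{0..<q}. norm (kloosterman q (- l) (- (k * c))) ^ 2 * (?w k * ?w l)) / of_int q ^ 2"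
    unfolding sum_distrib_right by (simp only: mult_ac)
  finally show ?thesis .
qed

text \<open>As c is a unit, it drops out of the gcd of l, kc and q. The constant is 4 from the
  Kloosterman bound times 2 from the product of interval sums.\<close>

lemma discrepancy_bound:
  fixes q L c :: int
  assumes q: "q \<ge> 1" and L: "1 \<le> L" and c: "coprime c q"
  shows "(\<Sum>a = 1..q. \<Sum>b = 1..q.
        norm (\<Sum>x\<in>{a<..a + L}. balanced_count q c {y\<in>{b<..b + L}. coprime y q} x) ^ 2)
    \<le> 8 * of_int L ^ 2 * of_int q * real (divisor_count q) ^ 3"
proof -
  have q0: "q > 0" using q by simp
  let ?d = "real (divisor_count q)"
  let ?w = "\<lambda>k. norm (interval_sum q L k) ^ 2"
  have "(\<Sum>k\<in>{1..<q}. \<Sum>l\<in>{0..<q}. norm (kloosterman q (- l) (- (k * c))) ^ 2 * (?w k * ?w l))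
      \<le> (\<Sum>k\<in>{1..<q}. \<Sum>l\<in>{0..<q}. (4 * ?d ^ 2 * of_int q * of_int (gcd (gcd l k) q)) * (?w k * ?w l))"
  proof (intro sum_mono mult_right_mono)
    fix k l
    have "gcd (k * c) q = gcd k q" using c by (simp add: mult.commute[of k] gcd_mult_left_left_cancel coprime_commute)
    then have "gcd (gcd (- l) (- (k * c))) q = gcd (gcd l k) q" by (simp add: gcd.assoc)
    then show "norm (kloosterman q (- l) (- (k * c))) ^ 2 \<le> 4 * ?d ^ 2 * of_int q * of_int (gcd (gcd l k) q)"
      using kloosterman_bound[OF q0, of "- l" "- (k * c)"] by simp
  qed auto
  also have "\<dots> = 4 * ?d ^ 2 * of_int q * (\<Sum>k\<in>{1..<q}. \<Sum>l\<in>{0..<q}. of_int (gcd (gcd l k) q) * (?w k * ?w l))"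
    by (simp add: sum_distrib_left mult.assoc)
  also have "\<dots> \<le> 4 * ?d ^ 2 * of_int q * (2 * of_int q ^ 2 * of_int L ^ 2 * ?d)"
    using q0 L by (intro mult_left_mono weighted_gcd_sum) auto
  also have "\<dots> = (8 * of_int L ^ 2 * of_int q * ?d ^ 3) * of_int q ^ 2"
    by (simp add: power2_eq_square power3_eq_cube)
  finally show ?thesis unfolding discrepancy_variance[OF q0] using q0 by (simp add: divide_le_eq)
qed

lemma balanced_count_interval:
  "complex_of_real ((\<Sum>x\<in>A. \<Sum>y\<in>{y\<in>{b<..b + L}. coprime y q \<and> [x * y = c] (mod q)}. 1)
      - 1 / real_of_int q * (\<Sum>x\<in>A. \<Sum>y\<in>{y\<in>{b<..b + L}. coprime y q}. 1))
    = (\<Sum>x\<in>A. balanced_count q c {y\<in>{b<..b + L}. coprime y q} x)"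
proof -
  let ?Y = "{y\<in>{b<..b + L}. coprime y q}"
  have Y: "finite ?Y" by (rule finite_subset[of _ "{b<..b + L}"]) auto
  have "{y\<in>{b<..b + L}. coprime y q \<and> [x * y = c] (mod q)} = {y\<in>?Y. [x * y = c] (mod q)}" for x by auto
  then have "(\<Sum>y\<in>{y\<in>{b<..b + L}. coprime y q \<and> [x * y = c] (mod q)}. 1) = (\<Sum>y\<in>?Y. if [x * y = c] (mod q) then 1 else (0::real))" for x
    by (simp only: sum.inter_filter[OF Y])
  then have eq: "(\<Sum>x\<in>A. \<Sum>y\<in>{y\<in>{b<..b + L}. coprime y q \<and> [x * y = c] (mod q)}. 1)
      - 1 / real_of_int q * (\<Sum>x\<in>A. \<Sum>y\<in>?Y. 1)
    = (\<Sum>x\<in>A. \<Sum>y\<in>?Y. (if [x * y = c] (mod q) then 1 else 0) - 1 / real_of_int q)"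
    by (simp only: sum_subtractf sum_distrib_left mult_1_right)
  show ?thesis unfolding eq balanced_count_def of_real_sum by (intro sum.cong refl) auto
qed

theorem theorem1:
  shows "\<exists>C::real. C > 0 \<and>
    (\<forall>q L c :: int. q \<ge> 1 \<longrightarrow> 1 \<le> L \<longrightarrow> L \<le> q \<longrightarrow> coprime c q \<longrightarrow>
      (\<Sum>a = 1..q. \<Sum>b = 1..q.
        ((\<Sum>q\<^sub>1\<in>{a<..a + L}. \<Sum>q\<^sub>2\<in>{q\<^sub>2\<in>{b<..b + L}. coprime q\<^sub>2 q \<and> [q\<^sub>1 * q\<^sub>2 = c] (mod q)}. 1)
          - 1 / real_of_int q *
            (\<Sum>q\<^sub>1\<in>{a<..a + L}. \<Sum>q\<^sub>2\<in>{q\<^sub>2\<in>{b<..b + L}. coprime q\<^sub>2 q}. 1))\<^sup>2)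
      \<le> C * (real_of_int L)\<^sup>2 * real_of_int q * real (divisor_count q) ^ 3)"
proof (intro exI[of _ 8] conjI allI impI)
  fix q L c :: int
  assume q: "q \<ge> 1" and L: "1 \<le> L" "L \<le> q" and c: "coprime c q"
  show "(\<Sum>a = 1..q. \<Sum>b = 1..q.
        ((\<Sum>q\<^sub>1\<in>{a<..a + L}. \<Sum>q\<^sub>2\<in>{q\<^sub>2\<in>{b<..b + L}. coprime q\<^sub>2 q \<and> [q\<^sub>1 * q\<^sub>2 = c] (mod q)}. 1)
          - 1 / real_of_int q *
            (\<Sum>q\<^sub>1\<in>{a<..a + L}. \<Sum>q\<^sub>2\<in>{q\<^sub>2\<in>{b<..b + L}. coprime q\<^sub>2 q}. 1))\<^sup>2)
      \<le> 8 * (real_of_int L)\<^sup>2 * real_of_int q * real (divisor_count q) ^ 3"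
    using discrepancy_bound[OF q L(1) c]
    by (simp only: balanced_count_interval[symmetric] norm_of_real power2_abs)
qed simp

end
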